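(* Let $\pi_1:V_1\to X_1$ and $\pi_2:V_2\to X_2$ be finite-dimensional locally trivial diffeological vector pseudo-bundles, let $(\tilde f,f)$ be a gluing of the former to the latter such that $f:X_1\supseteq Y\to X_2$ and $\tilde f^*$ are diffeomorphisms (of their domains with their images), and let $g_1,g_2$ be pseudo-metrics on $V_1,V_2$ compatible with this gluing. Then the map $$\Phi^{C\ell( * )}:C\ell(V_2^*,g_2^* )\cup_{(\tilde F^* )^{C\ell}}C\ell(V_1^*,g_1^* )\to C\ell(V_2^*\cup_{\tilde f^*}V_1^*,\widetilde{g^*}),$$ given by $(j_1^{V_2^*})^{C\ell}\circ(j_1^{C\ell(V_2^* )})^{-1}$ over $i_1^{X_2}(X_2\setminus f(Y))$ and by $(j_2^{V_1^*})^{C\ell}\circ(j_2^{C\ell(V_1^* )})^{-1}$ over $i_2^{X_1}(X_1)$, is a smooth diffeomorphism.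
   Context: Diffeological spaces, plots, smooth maps, and the subset, quotient, product, disjoint union and functional diffeologies are in the usual sense of Souriau. $E^*$ denotes the space of smooth linear maps $E\to\mathbb R$ on a diffeological vector space $E$, with the functional diffeology. Pseudo-bundles. A diffeological vector pseudo-bundle is a smooth surjective map $\pi:V\to X$ of diffeological spaces with a vector space structure on each fibre such that fibrewise addition $V\times_XV\to V$, scalar multiplication $\mathbb R\times V\to V$ and the zero section are smooth. The dual pseudo-bundle is $V^*=\bigcup_{x}(\pi^{-1}(x))^*$ with projection $\pi^*$; $q:U'\to V^*$ is a plot iff for every plot $p:U\to V$ the map $(u',u)\mapsto q(u')(p(u))$ is smooth on the set where $q(u')$ and $p(u)$ lie over the same point. $V\oplus V'$ is $V\times_XV'$ with the subset diffeology; $V\otimes V'$ is the fibrewise tensor product, with the finest pseudo-bundle diffeology making $V\times_XV'\to V\otimes V'$ smooth. A pseudo-metric on $V$ (finite-dimensional fibres) is a smooth section $g$ of $V^*\otimes V^*$ such that each $g(x)$ is a symmetric positive semi-definite form of rank $\dim((\pi^{-1}(x))^* )$. The dual pseudo-metric $g^*$ on $V^*$ is defined by $g^*(x)(\Psi_g(v),\Psi_g(w))=g(x)(v,w)$, where $\Psi_g(v)=g(\pi(v))(v,\cdot)$ (fibrewise surjective onto $V^*$). Gluing. For $h:Z_1\supseteq Y'\to Z_2$ smooth, $Z_1\cup_hZ_2=(Z_1\sqcup Z_2)/(z\sim h(z))$ with the quotient of the disjoint union diffeology. The natural inclusions of $Z_1\setminus Y'$ and of $Z_2$ have disjoint images covering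 it; they are denoted $i_1^{Z_1},i_2^{Z_2}$ for base spaces and $j_1^{Z_1},j_2^{Z_2}$ for total spaces (subscript 1 for the left-hand factor, 2 for the right-hand one). A gluing $(\tilde f,f)$ consists of a smooth $f:X_1\supseteq Y\to X_2$ and a smooth fibrewise linear lift $\tilde f:\pi_1^{-1}(Y)\to V_2$. The map $\tilde f^*:(\pi_2^* )^{-1}(f(Y))\to V_1^*$ is $\xi\mapsto\xi\circ\tilde f|_{\pi_1^{-1}(y)}$ for $\xi\in(\pi_2^{-1}(f(y)))^*$; it lifts $f^{-1}$ and gives the gluing $V_2^*\cup_{\tilde f^*}V_1^*\to X_2\cup_{f^{-1}}X_1$. Pseudo-metrics $g_1,g_2$ are compatible with $(\tilde f,f)$ if $g_1(y)(v,w)=g_2(f(y))(\tilde f(v),\tilde f(w))$ for all $y\in Y$, $v,w\in\pi_1^{-1}(y)$. $\widetilde{g^*}$ is the pseudo-metric on $V_2^*\cup_{\tilde f^*}V_1^*$ equal to $g_2^*$ (via $j_1^{V_2^*}$) over $i_1^{X_2}(X_2\setminus f(Y))$ and to $g_1^*$ (via $j_2^{V_1^*}$) over $i_2^{X_1}(X_1)$. Clifford algebras. The dimensions of all fibres are assumed bounded. $C\ell(V,g)=\bigcup_xC\ell(\pi^{-1}(x),g(x))$, where the Clifford algebra is the quotient of the tensor algebra by the relations $v\otimes w+w\otimes v+2g(x)(v,w)=0$, with the quotient diffeology from the pseudo-bundle $T(V)$ of tensor algebras (finite direct sums of tensor powers, up to the maximal fibre dimension, suffice). $(\tilde F^* )^{C\ell}$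 is the fibrewise algebra homomorphism, from the part of $C\ell(V_2^*,g_2^* )$ over $f(Y)$ to $C\ell(V_1^*,g_1^* )$, induced by $\tilde f^*$ (well defined because, under the hypotheses, $g_2^*$ and $g_1^*$ are compatible with $(\tilde f^*,f^{-1})$). $j_1^{C\ell(V_2^* )}$ and $j_2^{C\ell(V_1^* )}$ are the natural inclusions into the glued pseudo-bundle $C\ell(V_2^*,g_2^* )\cup_{(\tilde F^* )^{C\ell}}C\ell(V_1^*,g_1^* )$, and $(j_1^{V_2^*})^{C\ell}$, $(j_2^{V_1^*})^{C\ell}$ are the fibrewise Clifford algebra extensions of $j_1^{V_2^*}:V_2^*\setminus(\pi_2^* )^{-1}(f(Y))\to V_2^*\cup_{\tilde f^*}V_1^*$ and $j_2^{V_1^*}:V_1^*\to V_2^*\cup_{\tilde f^*}V_1^*$, with values in $C\ell(V_2^*\cup_{\tilde f^*}V_1^*,\widetilde{g^*})$.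
   Formalization: Plots of the dual V* are required, besides the evaluation condition, to have smooth projection to the base; otherwise (h(u'),0) with any map h would be a plot, V* would not be a pseudo-bundle and V*⊗V* would be undefined. *)

theory Defs
  imports
    "HOL-Analysis.Analysis"
    "HOL-Library.Poly_Mapping"
    "HOL-Algebra.QuotRing"
    "Jordan_Normal_Form.VS_Connect"
begin

section \<open>Smooth functions on open subsets of Euclidean spaces\<close>

text \<open>
  The dimension of the domain of a plot varies, so \<open>\<real>\<^sup>n\<close> is the library's \<^const>\<open>Euclidean_space\<close>:
  the sequences \<^typ>\<open>nat \<Rightarrow> real\<close> vanishing from index \<open>n\<close> on.
  A function is \<open>C\<^sup>k\<^sup>+\<^sup>1\<close> if it is (totally) differentiable with partial derivatives of class \<open>C\<^sup>k\<close>.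
\<close>

primrec Ck_on :: "nat \<Rightarrow> nat \<Rightarrow> (nat \<Rightarrow> real) set \<Rightarrow> ((nat \<Rightarrow> real) \<Rightarrow> real) \<Rightarrow> bool" where
  "Ck_on n 0 U f \<longleftrightarrow> continuous_on U f"
| "Ck_on n (Suc k) U f \<longleftrightarrow>
     (\<exists>f'. (\<forall>i<n. Ck_on n k U (f' i)) \<and>
       (\<forall>x\<in>U. ((\<lambda>y. (f y - f x - (\<Sum>i<n. f' i x * (y i - x i))) / L2_set (\<lambda>i. y i - x i) {..<n})
                  \<longlongrightarrow> 0) (at x within U)))"

definition Cinf_on :: "nat \<Rightarrow> (nat \<Rightarrow> real) set \<Rightarrow> ((nat \<Rightarrow> real) \<Rightarrow> real) \<Rightarrow> bool" where
  "Cinf_on n U f \<longleftrightarrow> (\<forall>k. Ck_on n k U f)"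

definition Cinf_map ::
    "nat \<Rightarrow> (nat \<Rightarrow> real) set \<Rightarrow> nat \<Rightarrow> (nat \<Rightarrow> real) set \<Rightarrow> ((nat \<Rightarrow> real) \<Rightarrow> nat \<Rightarrow> real) \<Rightarrow> bool" where
  "Cinf_map m W n U F \<longleftrightarrow> F ` W \<subseteq> U \<and> (\<forall>i<n. Cinf_on m W (\<lambda>w. F w i))"


section \<open>Diffeological spaces\<close>

text \<open>
  \<open>plot D n U p\<close>: the restriction of \<open>p\<close> to the open set \<open>U \<subseteq> \<real>\<^sup>n\<close> is a plot. The values of \<open>p\<close>
  outside \<open>U\<close> are irrelevant.
\<close>

record 'a diffsp =
  points :: "'a set"
  plot :: "nat \<Rightarrow> (nat \<Rightarrow> real) set \<Rightarrow> ((nat \<Rightarrow> real) \<Rightarrow> 'a) \<Rightarrow> bool"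

locale diffeological_space =
  fixes D :: "'a diffsp"
  assumes plot_open: "plot D n U p \<Longrightarrow> openin (Euclidean_space n) U"
    and plot_range: "plot D n U p \<Longrightarrow> p ` U \<subseteq> points D"
    and plot_cong: "plot D n U p \<Longrightarrow> (\<And>u. u \<in> U \<Longrightarrow> q u = p u) \<Longrightarrow> plot D n U q"
    and plot_const: "openin (Euclidean_space n) U \<Longrightarrow> x \<in> points D \<Longrightarrow> plot D n U (\<lambda>_. x)"
    and plot_local: "openin (Euclidean_space n) U \<Longrightarrow>
      (\<And>u. u \<in> U \<Longrightarrow> \<exists>W. openin (Euclidean_space n) W \<and> u \<in> W \<and> W \<subseteq> U \<and> plot D n W p) \<Longrightarrow>
      plot D n U p"
    and plot_comp: "plot D n U p \<Longrightarrow> openin (Euclidean_space m) W \<Longrightarrow> Cinf_map m W n U F \<Longrightarrow>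
      plot D m W (\<lambda>w. p (F w))"

definition smooth_map :: "'a diffsp \<Rightarrow> 'b diffsp \<Rightarrow> ('a \<Rightarrow> 'b) \<Rightarrow> bool" where
  "smooth_map D E f \<longleftrightarrow>
     f ` points D \<subseteq> points E \<and> (\<forall>n U p. plot D n U p \<longrightarrow> plot E n U (\<lambda>u. f (p u)))"

definition diffeomorphism :: "'a diffsp \<Rightarrow> 'b diffsp \<Rightarrow> ('a \<Rightarrow> 'b) \<Rightarrow> bool" where
  "diffeomorphism D E f \<longleftrightarrow>
     bij_betw f (points D) (points E) \<and> smooth_map D E f \<and> smooth_map E D (inv_into (points D) f)"

definition D_open :: "'a diffsp \<Rightarrow> 'a set \<Rightarrow> bool" where
  "D_open D S \<longleftrightarrow>
     S \<subseteq> points D \<and> (\<forall>n U p. plot D n U p \<longrightarrow> openin (Euclidean_space n) {u \<in> U. p u \<in> S})"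

definition euclid_diff :: "nat \<Rightarrow> (nat \<Rightarrow> real) set \<Rightarrow> (nat \<Rightarrow> real) diffsp" where
  "euclid_diff n U =
     \<lparr>points = U, plot = \<lambda>m W F. openin (Euclidean_space m) W \<and> Cinf_map m W n U F\<rparr>"

definition real_diff :: "real diffsp" where
  "real_diff = \<lparr>points = UNIV, plot = \<lambda>m W f. openin (Euclidean_space m) W \<and> Cinf_on m W f\<rparr>"

definition sub_diff :: "'a diffsp \<Rightarrow> 'a set \<Rightarrow> 'a diffsp" where
  "sub_diff D A = \<lparr>points = points D \<inter> A, plot = \<lambda>n U p. plot D n U p \<and> p ` U \<subseteq> A\<rparr>"

definition prod_diff :: "'a diffsp \<Rightarrow> 'b diffsp \<Rightarrow> ('a \<times> 'b) diffsp" where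
  "prod_diff D E =
     \<lparr>points = points D \<times> points E,
      plot = \<lambda>n U p. plot D n U (\<lambda>u. fst (p u)) \<and> plot E n U (\<lambda>u. snd (p u))\<rparr>"

definition sum_diff :: "'a diffsp \<Rightarrow> 'b diffsp \<Rightarrow> ('a + 'b) diffsp" where
  "sum_diff D E =
     \<lparr>points = points D <+> points E,
      plot = \<lambda>n U p. openin (Euclidean_space n) U \<and>
        (\<forall>u\<in>U. \<exists>W. openin (Euclidean_space n) W \<and> u \<in> W \<and> W \<subseteq> U \<and>
           ((\<exists>q. plot D n W q \<and> (\<forall>w\<in>W. p w = Inl (q w))) \<or>
            (\<exists>q. plot E n W q \<and> (\<forall>w\<in>W. p w = Inr (q w)))))\<rparr>"

text \<open>The quotient diffeology on the image of \<open>h\<close> (the pushforward of \<open>D\<close> by \<open>h\<close>).\<close>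

definition quot_diff :: "'a diffsp \<Rightarrow> ('a \<Rightarrow> 'b) \<Rightarrow> 'b diffsp" where
  "quot_diff D h =
     \<lparr>points = h ` points D,
      plot = \<lambda>n U p. openin (Euclidean_space n) U \<and>
        (\<forall>u\<in>U. \<exists>W q. openin (Euclidean_space n) W \<and> u \<in> W \<and> W \<subseteq> U \<and>
           plot D n W q \<and> (\<forall>w\<in>W. p w = h (q w)))\<rparr>"


section \<open>Diffeological vector pseudo-bundles\<close>

text \<open>
  A real vector space is a \<^typ>\<open>(real, 'v) module\<close> \<open>M\<close> with \<open>vectorspace class_ring M\<close>; its ring
  multiplication and unit are junk, unless \<open>M\<close> is an algebra (as for tensor and Clifford algebras).
\<close>

record ('x, 'v) bundle_data =
  base_sp :: "'x diffsp"
  total_sp :: "'v diffsp"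
  prj :: "'v \<Rightarrow> 'x"
  fib :: "'x \<Rightarrow> (real, 'v) module"

definition over :: "('x, 'v) bundle_data \<Rightarrow> 'x set \<Rightarrow> 'v set" where
  "over V A = {v \<in> points (total_sp V). prj V v \<in> A}"

locale pseudo_bundle =
  fixes V :: "('x, 'v) bundle_data"
  assumes base_diffeology: "diffeological_space (base_sp V)"
    and total_diffeology: "diffeological_space (total_sp V)"
    and prj_smooth: "smooth_map (total_sp V) (base_sp V) (prj V)"
    and prj_surj: "prj V ` points (total_sp V) = points (base_sp V)"
    and fib_carrier: "x \<in> points (base_sp V) \<Longrightarrow> carrier (fib V x) = over V {x}"
    and fib_vectorspace: "x \<in> points (base_sp V) \<Longrightarrow> vectorspace class_ring (fib V x)"
    and add_smooth:
      "smooth_map (sub_diff (prod_diff (total_sp V) (total_sp V)) {(v, w). prj V v = prj V w})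
         (total_sp V) (\<lambda>(v, w). v \<oplus>\<^bsub>fib V (prj V v)\<^esub> w)"
    and smult_smooth:
      "smooth_map (prod_diff real_diff (total_sp V)) (total_sp V)
         (\<lambda>(r, v). r \<odot>\<^bsub>fib V (prj V v)\<^esub> v)"
    and zero_smooth: "smooth_map (base_sp V) (total_sp V) (\<lambda>x. \<zero>\<^bsub>fib V x\<^esub>)"

definition finite_dim_bundle :: "('x, 'v) bundle_data \<Rightarrow> bool" where
  "finite_dim_bundle V \<longleftrightarrow> (\<forall>x\<in>points (base_sp V). vectorspace.fin_dim class_ring (fib V x))"

definition bounded_dim_bundle :: "('x, 'v) bundle_data \<Rightarrow> bool" where
  "bounded_dim_bundle V \<longleftrightarrow>
     (\<exists>N. \<forall>x\<in>points (base_sp V). vectorspace.dim class_ring (fib V x) \<le> N)"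

text \<open>
  The typical fibre of a trivialisation near \<open>x\<close> is isomorphic to the fibre over \<open>x\<close>, so the
  latter is used as the typical fibre.
\<close>

definition locally_trivial :: "('x, 'v) bundle_data \<Rightarrow> bool" where
  "locally_trivial V \<longleftrightarrow>
     (\<forall>x\<in>points (base_sp V). \<exists>S \<psi>. D_open (base_sp V) S \<and> x \<in> S \<and>
        diffeomorphism (sub_diff (total_sp V) (over V S))
          (prod_diff (sub_diff (base_sp V) S) (sub_diff (total_sp V) (over V {x}))) \<psi> \<and>
        (\<forall>v\<in>over V S. fst (\<psi> v) = prj V v) \<and>
        (\<forall>y\<in>S. linear_map class_ring (fib V y) (fib V x) (\<lambda>v. snd (\<psi> v))))"

text \<open>Transport of the structure of a module or algebra along an injective map \<open>j\<close>.\<close>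

definition transport :: "('a \<Rightarrow> 'b) \<Rightarrow> (real, 'a) module \<Rightarrow> (real, 'b) module" where
  "transport j M = (let i = inv_into (carrier M) j in
     \<lparr>carrier = j ` carrier M,
      mult = \<lambda>a b. j (i a \<otimes>\<^bsub>M\<^esub> i b), one = j \<one>\<^bsub>M\<^esub>,
      zero = j \<zero>\<^bsub>M\<^esub>, add = \<lambda>a b. j (i a \<oplus>\<^bsub>M\<^esub> i b),
      smult = \<lambda>r a. j (r \<odot>\<^bsub>M\<^esub> i a)\<rparr>)"


section \<open>Dual pseudo-bundles\<close>

text \<open>
  An element of \<open>V\<^sup>*\<close> over \<open>x\<close> is a pair \<open>(x, \<phi>)\<close>, where \<open>\<phi>\<close> is a smooth linear function on the fibre
  over \<open>x\<close> (extended by \<open>undefined\<close> outside the fibre).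
\<close>

definition real_vs :: "(real, real) module" where
  "real_vs = \<lparr>carrier = UNIV, mult = (*), one = 1, zero = 0, add = (+), smult = (*)\<rparr>"

definition dual_space :: "'v diffsp \<Rightarrow> (real, 'v) module \<Rightarrow> (real, 'v \<Rightarrow> real) module" where
  "dual_space D E =
     \<lparr>carrier = {\<phi> \<in> extensional (carrier E). linear_map class_ring E real_vs \<phi> \<and>
                  smooth_map (sub_diff D (carrier E)) real_diff \<phi>},
      mult = undefined, one = undefined,
      zero = restrict (\<lambda>v. 0) (carrier E),
      add = \<lambda>\<phi> \<psi>. restrict (\<lambda>v. \<phi> v + \<psi> v) (carrier E),
      smult = \<lambda>r \<phi>. restrict (\<lambda>v. r * \<phi> v) (carrier E)\<rparr>"

text \<open>
  Besides the evaluation condition, plots of \<open>V\<^sup>*\<close> are required to have smooth projection to the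
  base, without which \<open>V\<^sup>*\<close> is not a pseudo-bundle: on \<open>V = X \<times> \<real>\<close>, the map \<open>w \<mapsto> (h(w), id)\<close>
  satisfies the evaluation condition even if \<open>h\<close> is discontinuous.
\<close>

definition dual_diff :: "('x, 'v) bundle_data \<Rightarrow> ('x \<times> ('v \<Rightarrow> real)) diffsp" where
  "dual_diff V =
     \<lparr>points = {(x, \<phi>). x \<in> points (base_sp V) \<and> \<phi> \<in> carrier (dual_space (total_sp V) (fib V x))},
      plot = \<lambda>m W q.
        q ` W \<subseteq> {(x, \<phi>). x \<in> points (base_sp V) \<and>
                          \<phi> \<in> carrier (dual_space (total_sp V) (fib V x))} \<and>
        plot (base_sp V) m W (\<lambda>w. fst (q w)) \<and>
        (\<forall>n U p. plot (total_sp V) n U p \<longrightarrow>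
           smooth_map
             (sub_diff (prod_diff (euclid_diff m W) (euclid_diff n U))
               {(w, u). fst (q w) = prj V (p u)})
             real_diff (\<lambda>(w, u). snd (q w) (p u)))\<rparr>"

definition dual_bundle :: "('x, 'v) bundle_data \<Rightarrow> ('x, 'x \<times> ('v \<Rightarrow> real)) bundle_data" where
  "dual_bundle V =
     \<lparr>base_sp = base_sp V, total_sp = dual_diff V, prj = fst,
      fib = \<lambda>x. transport (Pair x) (dual_space (total_sp V) (fib V x))\<rparr>"


section \<open>Tensor algebras and tensor powers\<close>

text \<open>
  The ring \<open>'v tword \<Rightarrow>\<^sub>0 real\<close> is the free associative unital \<open>\<real>\<close>-algebra on the set of all
  elements of \<^typ>\<open>'v\<close>; its basis is the free monoid of words.
\<close>

datatype 'v tword = Word (letters: "'v list")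

instantiation tword :: (type) monoid_add
begin

definition zero_tword :: "'a tword" where "0 = Word []"

definition plus_tword :: "'a tword \<Rightarrow> 'a tword \<Rightarrow> 'a tword" where
  "a + b = Word (letters a @ letters b)"

instance
  by standard (simp_all add: zero_tword_def plus_tword_def)

end

definition free_alg :: "'v set \<Rightarrow> (real, 'v tword \<Rightarrow>\<^sub>0 real) module" where
  "free_alg E =
     \<lparr>carrier = {a. \<forall>w\<in>Poly_Mapping.keys a. set (letters w) \<subseteq> E},
      mult = (*), one = 1, zero = 0, add = (+),
      smult = \<lambda>r a. Poly_Mapping.map ((*) r) a\<rparr>"

definition alg_quot :: "(real, 'a) module \<Rightarrow> 'a set \<Rightarrow> (real, 'a set) module" where
  "alg_quot A I =
     ring.extend (A Quot I) (module.fields (\<lambda>r C. \<Union>a\<in>C. I +>\<^bsub>A\<^esub> (r \<odot>\<^bsub>A\<^esub> a)))"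

text \<open>
  The tensor algebra \<open>T(M)\<close> is the free algebra on the set of elements of \<open>M\<close>, modulo the linear
  relations of \<open>M\<close>. The ideal is homogeneous, so that \<open>T(M)\<close> is the direct sum of its components of
  degree \<open>r\<close>, and these are the tensor powers: free vector spaces on the \<open>r\<close>-tuples in \<open>M\<close>, modulo
  the multilinear relations.
\<close>

definition tensor_ideal :: "(real, 'v) module \<Rightarrow> ('v tword \<Rightarrow>\<^sub>0 real) set" where
  "tensor_ideal M = genideal (free_alg (carrier M))
     {Poly_Mapping.single (Word [r \<odot>\<^bsub>M\<^esub> v \<oplus>\<^bsub>M\<^esub> s \<odot>\<^bsub>M\<^esub> w]) 1
        - Poly_Mapping.single (Word [v]) r - Poly_Mapping.single (Word [w]) s
      | r s v w. v \<in> carrier M \<and> w \<in> carrier M}"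

definition tensor_algebra :: "(real, 'v) module \<Rightarrow> (real, ('v tword \<Rightarrow>\<^sub>0 real) set) module" where
  "tensor_algebra M = alg_quot (free_alg (carrier M)) (tensor_ideal M)"

definition tensor_class ::
    "(real, 'v) module \<Rightarrow> ('v tword \<Rightarrow>\<^sub>0 real) \<Rightarrow> ('v tword \<Rightarrow>\<^sub>0 real) set" where
  "tensor_class M a = tensor_ideal M +>\<^bsub>free_alg (carrier M)\<^esub> a"

text \<open>The decomposable tensor \<open>v\<^sub>1 \<otimes> \<dots> \<otimes> v\<^sub>r\<close>.\<close>

definition tensor_of :: "(real, 'v) module \<Rightarrow> 'v list \<Rightarrow> ('v tword \<Rightarrow>\<^sub>0 real) set" where
  "tensor_of M vs = tensor_class M (Poly_Mapping.single (Word vs) 1)"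

definition tensor_power ::
    "(real, 'v) module \<Rightarrow> nat \<Rightarrow> (real, ('v tword \<Rightarrow>\<^sub>0 real) set) module" where
  "tensor_power M r = (tensor_algebra M)
     \<lparr>carrier := tensor_class M ` {a \<in> carrier (free_alg (carrier M)).
                    \<forall>w\<in>Poly_Mapping.keys a. length (letters w) = r}\<rparr>"

text \<open>
  The fibre product \<open>V \<times>\<^sub>X \<dots> \<times>\<^sub>X V\<close> of \<open>r\<close> factors. The base point is recorded, so that the fibre
  product of zero factors is \<open>X\<close>.
\<close>

definition fibre_power :: "('x, 'v) bundle_data \<Rightarrow> nat \<Rightarrow> ('x \<times> 'v list) diffsp" where
  "fibre_power V r =
     \<lparr>points = {(x, vs). x \<in> points (base_sp V) \<and> length vs = r \<and> set vs \<subseteq> over V {x}},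
      plot = \<lambda>n U p.
        plot (base_sp V) n U (\<lambda>u. fst (p u)) \<and>
        (\<forall>u\<in>U. length (snd (p u)) = r \<and> set (snd (p u)) \<subseteq> over V {fst (p u)}) \<and>
        (\<forall>i<r. plot (total_sp V) n U (\<lambda>u. snd (p u) ! i))\<rparr>"

text \<open>
  The diffeology of \<open>V\<^sup>\<otimes>\<^sup>r\<close> is the finest pseudo-bundle diffeology for which the universal
  multilinear map on the \<open>r\<close>-fold fibre product is smooth. In particular, \<open>V \<otimes> V\<close> is the
  tensor power with \<open>r = 2\<close>.
\<close>

definition tensor_power_with ::
    "('x, 'v) bundle_data \<Rightarrow> nat \<Rightarrow> ('x \<times> ('v tword \<Rightarrow>\<^sub>0 real) set) diffsp \<Rightarrow>
     ('x, 'x \<times> ('v tword \<Rightarrow>\<^sub>0 real) set) bundle_data" where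
  "tensor_power_with V r D =
     \<lparr>base_sp = base_sp V, total_sp = D, prj = fst,
      fib = \<lambda>x. transport (Pair x) (tensor_power (fib V x) r)\<rparr>"

definition tensor_power_diff ::
    "('x, 'v) bundle_data \<Rightarrow> nat \<Rightarrow> ('x \<times> ('v tword \<Rightarrow>\<^sub>0 real) set) diffsp" where
  "tensor_power_diff V r =
     \<lparr>points = {(x, t). x \<in> points (base_sp V) \<and> t \<in> carrier (tensor_power (fib V x) r)},
      plot = \<lambda>n U p. \<forall>D. pseudo_bundle (tensor_power_with V r D) \<and>
        smooth_map (fibre_power V r) D (\<lambda>(x, vs). (x, tensor_of (fib V x) vs)) \<longrightarrow> plot D n U p\<rparr>"

definition tensor_power_bundle ::
    "('x, 'v) bundle_data \<Rightarrow> nat \<Rightarrow> ('x, 'x \<times> ('v tword \<Rightarrow>\<^sub>0 real) set) bundle_data" where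
  "tensor_power_bundle V r = tensor_power_with V r (tensor_power_diff V r)"

text \<open>
  The pseudo-bundle \<open>T(V)\<close> carries the direct sum diffeology: locally, a plot takes values in a
  finite direct sum of tensor powers, and its components are plots of these.
\<close>

definition tensor_algebra_bundle ::
    "('x, 'v) bundle_data \<Rightarrow> ('x, 'x \<times> ('v tword \<Rightarrow>\<^sub>0 real) set) bundle_data" where
  "tensor_algebra_bundle V =
     \<lparr>base_sp = base_sp V,
      total_sp =
        \<lparr>points = {(x, t). x \<in> points (base_sp V) \<and> t \<in> carrier (tensor_algebra (fib V x))},
         plot = \<lambda>n U p. openin (Euclidean_space n) U \<and>
           (\<forall>u\<in>U. \<exists>W N q. openin (Euclidean_space n) W \<and> u \<in> W \<and> W \<subseteq> U \<and>
              (\<forall>r\<le>N. plot (total_sp (tensor_power_bundle V r)) n W (q r)) \<and>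
              (\<forall>w\<in>W. (\<forall>r\<le>N. fst (q r w) = fst (p w)) \<and>
                 snd (p w) =
                   finsum (tensor_algebra (fib V (fst (p w)))) (\<lambda>r. snd (q r w)) {..N}))\<rparr>,
      prj = fst,
      fib = \<lambda>x. transport (Pair x) (tensor_algebra (fib V x))\<rparr>"


section \<open>Pseudo-metrics\<close>

text \<open>
  An element of \<open>V\<^sup>* \<otimes> V\<^sup>*\<close> over \<open>x\<close> is viewed as a bilinear form on the fibre of \<open>V\<close> over \<open>x\<close>, via
  \<open>(\<phi> \<otimes> \<psi>)(v, w) = \<phi>(v) \<psi>(w)\<close>. The value does not depend on the representative in the free algebra.
\<close>

definition bilin_eval ::
    "(('x \<times> ('v \<Rightarrow> real)) tword \<Rightarrow>\<^sub>0 real) \<Rightarrow> 'v \<Rightarrow> 'v \<Rightarrow> real" where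
  "bilin_eval a v w =
     (\<Sum>z\<in>Poly_Mapping.keys a. case letters z of
        [\<phi>, \<psi>] \<Rightarrow> Poly_Mapping.lookup a z * snd \<phi> v * snd \<psi> w | _ \<Rightarrow> 0)"

definition form_of ::
    "('x \<Rightarrow> 'x \<times> (('x \<times> ('v \<Rightarrow> real)) tword \<Rightarrow>\<^sub>0 real) set) \<Rightarrow> 'x \<Rightarrow> 'v \<Rightarrow> 'v \<Rightarrow> real" where
  "form_of g x v w = the_elem ((\<lambda>a. bilin_eval a v w) ` snd (g x))"

text \<open>\<open>\<Psi>\<^sub>g(v) = g(\<pi>(v))(v, \<cdot>)\<close>, for a family \<open>b\<close> of bilinear forms on the fibres.\<close>

definition form_map ::
    "('x, 'v) bundle_data \<Rightarrow> ('x \<Rightarrow> 'v \<Rightarrow> 'v \<Rightarrow> real) \<Rightarrow> 'v \<Rightarrow> 'x \<times> ('v \<Rightarrow> real)" where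
  "form_map V b v = (prj V v, restrict (b (prj V v) v) (carrier (fib V (prj V v))))"

definition form_rank ::
    "('x, 'v) bundle_data \<Rightarrow> ('x \<Rightarrow> 'v \<Rightarrow> 'v \<Rightarrow> real) \<Rightarrow> 'x \<Rightarrow> nat" where
  "form_rank V b x = vectorspace.dim class_ring
     ((fib (dual_bundle V) x)\<lparr>carrier := form_map V b ` carrier (fib V x)\<rparr>)"

definition pseudo_metric ::
    "('x, 'v) bundle_data \<Rightarrow> ('x \<Rightarrow> 'x \<times> (('x \<times> ('v \<Rightarrow> real)) tword \<Rightarrow>\<^sub>0 real) set) \<Rightarrow> bool" where
  "pseudo_metric V g \<longleftrightarrow>
     smooth_map (base_sp V) (total_sp (tensor_power_bundle (dual_bundle V) 2)) g \<and>
     (\<forall>x\<in>points (base_sp V).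
        fst (g x) = x \<and>
        (\<forall>v\<in>carrier (fib V x). \<forall>w\<in>carrier (fib V x). form_of g x v w = form_of g x w v) \<and>
        (\<forall>v\<in>carrier (fib V x). form_of g x v v \<ge> 0) \<and>
        form_rank V (form_of g) x = vectorspace.dim class_ring (fib (dual_bundle V) x))"

text \<open>\<open>g\<^sup>*(x)(\<Psi>\<^sub>g(v), \<Psi>\<^sub>g(w)) = g(x)(v, w)\<close>\<close>

definition dual_form ::
    "('x, 'v) bundle_data \<Rightarrow> ('x \<Rightarrow> 'v \<Rightarrow> 'v \<Rightarrow> real) \<Rightarrow>
     'x \<Rightarrow> 'x \<times> ('v \<Rightarrow> real) \<Rightarrow> 'x \<times> ('v \<Rightarrow> real) \<Rightarrow> real" where
  "dual_form V b x \<phi> \<psi> =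
     (THE r. \<exists>v\<in>carrier (fib V x). \<exists>w\<in>carrier (fib V x).
        form_map V b v = \<phi> \<and> form_map V b w = \<psi> \<and> r = b x v w)"


section \<open>Gluing\<close>

text \<open>The gluing of \<open>D1\<close> to \<open>D2\<close> along \<open>h\<close>, a map from \<open>A \<subseteq> D1\<close> to \<open>D2\<close>.\<close>

definition glue_class ::
    "'a diffsp \<Rightarrow> 'b diffsp \<Rightarrow> 'a set \<Rightarrow> ('a \<Rightarrow> 'b) \<Rightarrow> 'a + 'b \<Rightarrow> ('a + 'b) set" where
  "glue_class D1 D2 A h z =
     {z' \<in> points D1 <+> points D2. equivclp (\<lambda>a b. \<exists>y\<in>A. a = Inl y \<and> b = Inr (h y)) z z'}"

definition glue_diff ::
    "'a diffsp \<Rightarrow> 'b diffsp \<Rightarrow> 'a set \<Rightarrow> ('a \<Rightarrow> 'b) \<Rightarrow> ('a + 'b) set diffsp" where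
  "glue_diff D1 D2 A h = quot_diff (sum_diff D1 D2) (glue_class D1 D2 A h)"

text \<open>
  The natural inclusions: \<open>incl1\<close> restricted to the complement of \<open>A\<close>, and \<open>incl2\<close>. The maps
  \<open>incl1_inv\<close> and \<open>incl2_inv\<close> are their inverses, defined on the images.
\<close>

definition incl1 :: "'a diffsp \<Rightarrow> 'b diffsp \<Rightarrow> 'a set \<Rightarrow> ('a \<Rightarrow> 'b) \<Rightarrow> 'a \<Rightarrow> ('a + 'b) set" where
  "incl1 D1 D2 A h y = glue_class D1 D2 A h (Inl y)"

definition incl2 :: "'a diffsp \<Rightarrow> 'b diffsp \<Rightarrow> 'a set \<Rightarrow> ('a \<Rightarrow> 'b) \<Rightarrow> 'b \<Rightarrow> ('a + 'b) set" where
  "incl2 D1 D2 A h y = glue_class D1 D2 A h (Inr y)"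

definition incl1_inv :: "'a diffsp \<Rightarrow> 'b diffsp \<Rightarrow> 'a set \<Rightarrow> ('a \<Rightarrow> 'b) \<Rightarrow> ('a + 'b) set \<Rightarrow> 'a" where
  "incl1_inv D1 D2 A h = inv_into (points D1 - A) (incl1 D1 D2 A h)"

definition incl2_inv :: "'a diffsp \<Rightarrow> 'b diffsp \<Rightarrow> 'a set \<Rightarrow> ('a \<Rightarrow> 'b) \<Rightarrow> ('a + 'b) set \<Rightarrow> 'b" where
  "incl2_inv D1 D2 A h = inv_into (points D2) (incl2 D1 D2 A h)"

definition gluing ::
    "('x1, 'v1) bundle_data \<Rightarrow> ('x2, 'v2) bundle_data \<Rightarrow> 'x1 set \<Rightarrow> ('x1 \<Rightarrow> 'x2) \<Rightarrow> ('v1 \<Rightarrow> 'v2) \<Rightarrow>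
     bool" where
  "gluing V1 V2 Y f F \<longleftrightarrow>
     Y \<subseteq> points (base_sp V1) \<and>
     smooth_map (sub_diff (base_sp V1) Y) (base_sp V2) f \<and>
     smooth_map (sub_diff (total_sp V1) (over V1 Y)) (total_sp V2) F \<and>
     (\<forall>v\<in>over V1 Y. prj V2 (F v) = f (prj V1 v)) \<and>
     (\<forall>y\<in>Y. linear_map class_ring (fib V1 y) (fib V2 (f y)) F)"

text \<open>
  The inclusions \<open>j\<^sub>1\<close>, \<open>j\<^sub>2\<close> of the total spaces, and their inverses, for the gluing of \<open>V1\<close> to \<open>V2\<close>
  along a lift \<open>F\<close>, defined over \<open>Y\<close>.
\<close>

abbreviation "tot1 V1 V2 Y F \<equiv> incl1 (total_sp V1) (total_sp V2) (over V1 Y) F"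
abbreviation "tot2 V1 V2 Y F \<equiv> incl2 (total_sp V1) (total_sp V2) (over V1 Y) F"
abbreviation "tot1_inv V1 V2 Y F \<equiv> incl1_inv (total_sp V1) (total_sp V2) (over V1 Y) F"
abbreviation "tot2_inv V1 V2 Y F \<equiv> incl2_inv (total_sp V1) (total_sp V2) (over V1 Y) F"

abbreviation "bas1 V1 V2 Y f \<equiv> incl1 (base_sp V1) (base_sp V2) Y f"
abbreviation "bas2 V1 V2 Y f \<equiv> incl2 (base_sp V1) (base_sp V2) Y f"
abbreviation "bas1_inv V1 V2 Y f \<equiv> incl1_inv (base_sp V1) (base_sp V2) Y f"
abbreviation "bas2_inv V1 V2 Y f \<equiv> incl2_inv (base_sp V1) (base_sp V2) Y f"

definition glue_bundle ::
    "('x1, 'v1) bundle_data \<Rightarrow> ('x2, 'v2) bundle_data \<Rightarrow> 'x1 set \<Rightarrow> ('x1 \<Rightarrow> 'x2) \<Rightarrow> ('v1 \<Rightarrow> 'v2) \<Rightarrow>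
     (('x1 + 'x2) set, ('v1 + 'v2) set) bundle_data" where
  "glue_bundle V1 V2 Y f F =
     \<lparr>base_sp = glue_diff (base_sp V1) (base_sp V2) Y f,
      total_sp = glue_diff (total_sp V1) (total_sp V2) (over V1 Y) F,
      prj = \<lambda>c. the_elem
        ((\<lambda>z. glue_class (base_sp V1) (base_sp V2) Y f (map_sum (prj V1) (prj V2) z)) ` c),
      fib = \<lambda>x.
        if x \<in> bas1 V1 V2 Y f ` (points (base_sp V1) - Y)
        then transport (tot1 V1 V2 Y F) (fib V1 (bas1_inv V1 V2 Y f x))
        else transport (tot2 V1 V2 Y F) (fib V2 (bas2_inv V1 V2 Y f x))\<rparr>"

text \<open>
  The family of forms on the glued pseudo-bundle given by \<open>b1\<close> over the image of the complement
  of \<open>Y\<close> and by \<open>b2\<close> over the image of the base of \<open>V2\<close>.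
\<close>

definition glue_form ::
    "('x1, 'v1) bundle_data \<Rightarrow> ('x2, 'v2) bundle_data \<Rightarrow> 'x1 set \<Rightarrow> ('x1 \<Rightarrow> 'x2) \<Rightarrow> ('v1 \<Rightarrow> 'v2) \<Rightarrow>
     ('x1 \<Rightarrow> 'v1 \<Rightarrow> 'v1 \<Rightarrow> real) \<Rightarrow> ('x2 \<Rightarrow> 'v2 \<Rightarrow> 'v2 \<Rightarrow> real) \<Rightarrow>
     ('x1 + 'x2) set \<Rightarrow> ('v1 + 'v2) set \<Rightarrow> ('v1 + 'v2) set \<Rightarrow> real" where
  "glue_form V1 V2 Y f F b1 b2 x v w =
     (if x \<in> bas1 V1 V2 Y f ` (points (base_sp V1) - Y)
      then b1 (bas1_inv V1 V2 Y f x) (tot1_inv V1 V2 Y F v) (tot1_inv V1 V2 Y F w)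
      else b2 (bas2_inv V1 V2 Y f x) (tot2_inv V1 V2 Y F v) (tot2_inv V1 V2 Y F w))"

definition compatible ::
    "('x1, 'v1) bundle_data \<Rightarrow> 'x1 set \<Rightarrow> ('x1 \<Rightarrow> 'x2) \<Rightarrow> ('v1 \<Rightarrow> 'v2) \<Rightarrow>
     ('x1 \<Rightarrow> 'v1 \<Rightarrow> 'v1 \<Rightarrow> real) \<Rightarrow> ('x2 \<Rightarrow> 'v2 \<Rightarrow> 'v2 \<Rightarrow> real) \<Rightarrow> bool" where
  "compatible V1 Y f F b1 b2 \<longleftrightarrow>
     (\<forall>y\<in>Y. \<forall>v\<in>carrier (fib V1 y). \<forall>w\<in>carrier (fib V1 y). b1 y v w = b2 (f y) (F v) (F w))"

text \<open>The map \<open>\<xi> \<mapsto> \<xi> \<circ> F\<close> from the part of \<open>V\<^sub>2\<^sup>*\<close> over \<open>f(Y)\<close> to \<open>V\<^sub>1\<^sup>*\<close>, for \<open>f\<close> injective on \<open>Y\<close>.\<close>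

definition dual_lift ::
    "('x1, 'v1) bundle_data \<Rightarrow> 'x1 set \<Rightarrow> ('x1 \<Rightarrow> 'x2) \<Rightarrow> ('v1 \<Rightarrow> 'v2) \<Rightarrow>
     'x2 \<times> ('v2 \<Rightarrow> real) \<Rightarrow> 'x1 \<times> ('v1 \<Rightarrow> real)" where
  "dual_lift V1 Y f F = (\<lambda>(x, \<xi>). let y = inv_into Y f x in
     (y, restrict (\<lambda>v. \<xi> (F v)) (carrier (fib V1 y))))"


section \<open>Clifford algebras\<close>

definition clifford_ideal ::
    "(real, 'v) module \<Rightarrow> ('v \<Rightarrow> 'v \<Rightarrow> real) \<Rightarrow> ('v tword \<Rightarrow>\<^sub>0 real) set set" where
  "clifford_ideal M b = (let T = tensor_algebra M in genideal T
     {tensor_of M [v] \<otimes>\<^bsub>T\<^esub> tensor_of M [w] \<oplus>\<^bsub>T\<^esub> tensor_of M [w] \<otimes>\<^bsub>T\<^esub> tensor_of M [v]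
        \<oplus>\<^bsub>T\<^esub> (2 * b v w) \<odot>\<^bsub>T\<^esub> \<one>\<^bsub>T\<^esub>
      | v w. v \<in> carrier M \<and> w \<in> carrier M})"

definition clifford_algebra ::
    "(real, 'v) module \<Rightarrow> ('v \<Rightarrow> 'v \<Rightarrow> real) \<Rightarrow> (real, ('v tword \<Rightarrow>\<^sub>0 real) set set) module" where
  "clifford_algebra M b = alg_quot (tensor_algebra M) (clifford_ideal M b)"

definition clifford_class ::
    "(real, 'v) module \<Rightarrow> ('v \<Rightarrow> 'v \<Rightarrow> real) \<Rightarrow> ('v tword \<Rightarrow>\<^sub>0 real) set \<Rightarrow>
     ('v tword \<Rightarrow>\<^sub>0 real) set set" where
  "clifford_class M b t = clifford_ideal M b +>\<^bsub>tensor_algebra M\<^esub> t"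

definition clifford_bundle ::
    "('x, 'v) bundle_data \<Rightarrow> ('x \<Rightarrow> 'v \<Rightarrow> 'v \<Rightarrow> real) \<Rightarrow>
     ('x, 'x \<times> ('v tword \<Rightarrow>\<^sub>0 real) set set) bundle_data" where
  "clifford_bundle V b =
     \<lparr>base_sp = base_sp V,
      total_sp = quot_diff (total_sp (tensor_algebra_bundle V))
        (\<lambda>(x, t). (x, clifford_class (fib V x) (b x) t)),
      prj = fst,
      fib = \<lambda>x. transport (Pair x) (clifford_algebra (fib V x) (b x))\<rparr>"

text \<open>
  The algebra homomorphisms induced by a map \<open>F\<close> of generators: on free algebras, on tensor
  algebras (with codomain \<open>T(M)\<close>) if \<open>F\<close> is linear, and on Clifford algebras (with codomain the
  Clifford algebra of \<open>M\<close> and \<open>b\<close>) if \<open>F\<close> also preserves the forms. As for \<^const>\<open>FactRing\<close>, the induced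
  map on cosets is \<open>the_elem\<close> of an image, which is a singleton if the map is well defined.
\<close>

definition free_alg_map :: "('v \<Rightarrow> 'w) \<Rightarrow> ('v tword \<Rightarrow>\<^sub>0 real) \<Rightarrow> ('w tword \<Rightarrow>\<^sub>0 real)" where
  "free_alg_map F a = (\<Sum>w\<in>Poly_Mapping.keys a.
     Poly_Mapping.single (Word (map F (letters w))) (Poly_Mapping.lookup a w))"

definition tensor_algebra_map ::
    "(real, 'w) module \<Rightarrow> ('v \<Rightarrow> 'w) \<Rightarrow> ('v tword \<Rightarrow>\<^sub>0 real) set \<Rightarrow> ('w tword \<Rightarrow>\<^sub>0 real) set" where
  "tensor_algebra_map M F t = the_elem ((\<lambda>a. tensor_class M (free_alg_map F a)) ` t)"

definition clifford_algebra_map ::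
    "(real, 'w) module \<Rightarrow> ('w \<Rightarrow> 'w \<Rightarrow> real) \<Rightarrow> ('v \<Rightarrow> 'w) \<Rightarrow>
     ('v tword \<Rightarrow>\<^sub>0 real) set set \<Rightarrow> ('w tword \<Rightarrow>\<^sub>0 real) set set" where
  "clifford_algebra_map M b F c =
     the_elem ((\<lambda>t. clifford_class M b (tensor_algebra_map M F t)) ` c)"

text \<open>
  The fibrewise Clifford algebra extension of a fibrewise linear map \<open>F\<close> lifting \<open>f\<close>, with values
  in the Clifford algebra of \<open>W\<close> and \<open>b\<close>.
\<close>

definition clifford_ext ::
    "('y, 'w) bundle_data \<Rightarrow> ('y \<Rightarrow> 'w \<Rightarrow> 'w \<Rightarrow> real) \<Rightarrow> ('x \<Rightarrow> 'y) \<Rightarrow> ('v \<Rightarrow> 'w) \<Rightarrow>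
     'x \<times> ('v tword \<Rightarrow>\<^sub>0 real) set set \<Rightarrow> 'y \<times> ('w tword \<Rightarrow>\<^sub>0 real) set set" where
  "clifford_ext W b f F = (\<lambda>(x, c). (f x, clifford_algebra_map (fib W (f x)) (b (f x)) F c))"

text \<open>
  The gluing of the Clifford algebras of \<open>(V1, b1)\<close> and \<open>(V2, b2)\<close> along the Clifford extension of
  \<open>F\<close>, and the Clifford algebra of the glued pseudo-bundle with the glued forms.
\<close>

definition glued_clifford ::
    "('x1, 'v1) bundle_data \<Rightarrow> ('x2, 'v2) bundle_data \<Rightarrow> 'x1 set \<Rightarrow> ('x1 \<Rightarrow> 'x2) \<Rightarrow> ('v1 \<Rightarrow> 'v2) \<Rightarrow>
     ('x1 \<Rightarrow> 'v1 \<Rightarrow> 'v1 \<Rightarrow> real) \<Rightarrow> ('x2 \<Rightarrow> 'v2 \<Rightarrow> 'v2 \<Rightarrow> real) \<Rightarrow>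
     (('x1 + 'x2) set,
      ('x1 \<times> ('v1 tword \<Rightarrow>\<^sub>0 real) set set + 'x2 \<times> ('v2 tword \<Rightarrow>\<^sub>0 real) set set) set) bundle_data" where
  "glued_clifford V1 V2 Y f F b1 b2 =
     glue_bundle (clifford_bundle V1 b1) (clifford_bundle V2 b2) Y f (clifford_ext V2 b2 f F)"

definition clifford_glued ::
    "('x1, 'v1) bundle_data \<Rightarrow> ('x2, 'v2) bundle_data \<Rightarrow> 'x1 set \<Rightarrow> ('x1 \<Rightarrow> 'x2) \<Rightarrow> ('v1 \<Rightarrow> 'v2) \<Rightarrow>
     ('x1 \<Rightarrow> 'v1 \<Rightarrow> 'v1 \<Rightarrow> real) \<Rightarrow> ('x2 \<Rightarrow> 'v2 \<Rightarrow> 'v2 \<Rightarrow> real) \<Rightarrow>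
     (('x1 + 'x2) set, ('x1 + 'x2) set \<times> (('v1 + 'v2) set tword \<Rightarrow>\<^sub>0 real) set set) bundle_data" where
  "clifford_glued V1 V2 Y f F b1 b2 =
     clifford_bundle (glue_bundle V1 V2 Y f F) (glue_form V1 V2 Y f F b1 b2)"

definition clifford_comparison ::
    "('x1, 'v1) bundle_data \<Rightarrow> ('x2, 'v2) bundle_data \<Rightarrow> 'x1 set \<Rightarrow> ('x1 \<Rightarrow> 'x2) \<Rightarrow> ('v1 \<Rightarrow> 'v2) \<Rightarrow>
     ('x1 \<Rightarrow> 'v1 \<Rightarrow> 'v1 \<Rightarrow> real) \<Rightarrow> ('x2 \<Rightarrow> 'v2 \<Rightarrow> 'v2 \<Rightarrow> real) \<Rightarrow>
     ('x1 \<times> ('v1 tword \<Rightarrow>\<^sub>0 real) set set + 'x2 \<times> ('v2 tword \<Rightarrow>\<^sub>0 real) set set) set \<Rightarrow>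
     ('x1 + 'x2) set \<times> (('v1 + 'v2) set tword \<Rightarrow>\<^sub>0 real) set set" where
  "clifford_comparison V1 V2 Y f F b1 b2 c =
     (let C1 = clifford_bundle V1 b1; C2 = clifford_bundle V2 b2; FC = clifford_ext V2 b2 f F;
          V = glue_bundle V1 V2 Y f F; b = glue_form V1 V2 Y f F b1 b2 in
      if prj (glued_clifford V1 V2 Y f F b1 b2) c \<in> bas1 V1 V2 Y f ` (points (base_sp V1) - Y)
      then clifford_ext V b (bas1 V1 V2 Y f) (tot1 V1 V2 Y F) (tot1_inv C1 C2 Y FC c)
      else clifford_ext V b (bas2 V1 V2 Y f) (tot2 V1 V2 Y F) (tot2_inv C1 C2 Y FC c))"

end

theory Submission
  imports Defs
begin

text \<open>Locally, the plots of a bundle of tensor or Clifford algebras are exactly the classes of finite sums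
  \<open>\<Sum>\<^sub>i c\<^sub>i v\<^sub>i\<^sub>1 \<dots> v\<^sub>i\<^sub>k\<close> with smooth coefficients \<open>c\<^sub>i\<close> and plots \<open>v\<^sub>i\<^sub>j\<close> of the bundle over a common plot
  of the base. Hence fibrewise algebra extensions of smooth linear maps preserving the forms are smooth. A plot
  of the Clifford bundle of a glued bundle lifts to one of the two sides: a letter at hand that lies on the
  right forces the base plot to the right, and the other letters are moved there by the gluing
  maps. This makes the inverse of the comparison map smooth.

  For dual bundles the forms are compatible because \<open>v \<mapsto> g(x)(v, \<cdot>)\<close> is onto the dual fibre, its rank being
  the dimension of that fibre, and because restriction along the gluing map is injective.\<close>

section \<open>Smooth functions on Euclidean domains\<close>

text \<open>A tensor power carries the intersection of all pseudo-bundle diffeologies for which the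
  universal multilinear map is smooth, and an intersection by itself gives no hold on a single plot.
  The formal sums form one explicit diffeology that takes part in this intersection and lies inside
  every other member; hence it is the intersection. Its operations are smooth because lists of terms
  can be concatenated and rescaled, so smoothness of the operations is created by the construction.
  The argument can therefore run on \<open>vector_family\<close>, a family of vector spaces with
  smooth projection, and reaches the dual bundles without first turning them into pseudo-bundles.
  Clifford elements are represented in the free algebra throughout, where a map of fibres acts
  letter by letter. Plots are lifted through a gluing at the level of letters, before any quotient
  is taken, so that no element of a quotient algebra ever has to be lifted. For duals the direction
  of gluing is reversed: the left factor is the dual of \<open>V2\<close>, glued along the inverse
  of \<open>f\<close>.\<close>

lemma Ck_on_subset: "Ck_on n k U f \<Longrightarrow> W \<subseteq> U \<Longrightarrow> Ck_on n k W f"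
proof (induction k arbitrary: f)
  case 0
  then show ?case by (auto intro: continuous_on_subset)
next
  case (Suc k)
  then obtain f' where f': "\<forall>i<n. Ck_on n k U (f' i)"
    "\<forall>x\<in>U. ((\<lambda>y. (f y - f x - (\<Sum>i<n. f' i x * (y i - x i))) / L2_set (\<lambda>i. y i - x i) {..<n}) \<longlongrightarrow> 0) (at x within U)"
    by auto
  then show ?case using Suc.IH Suc.prems(2)
    by (auto intro!: exI[of _ f'] intro: tendsto_within_subset)
qed

lemma tendsto_within_cong:
  assumes "(f \<longlongrightarrow> l) (at x within U)" "\<And>y. y \<in> U \<Longrightarrow> g y = f y"
  shows "(g \<longlongrightarrow> l) (at x within U)"
proof -
  have "\<forall>\<^sub>F y in at x within U. g y = f y"
    using assms(2) by (auto simp: eventually_at_filter intro: always_eventually)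
  then show ?thesis using assms(1) by (simp cong: tendsto_cong)
qed

lemma Ck_on_cong:
  assumes "Ck_on n k U f" "\<And>x. x \<in> U \<Longrightarrow> g x = f x"
  shows "Ck_on n k U g"
proof (cases k)
  case 0
  then show ?thesis using assms by (metis Ck_on.simps(1) continuous_on_cong)
next
  case (Suc l)
  then obtain f' where f': "\<forall>i<n. Ck_on n l U (f' i)"
    "\<forall>x\<in>U. ((\<lambda>y. (f y - f x - (\<Sum>i<n. f' i x * (y i - x i))) / L2_set (\<lambda>i. y i - x i) {..<n}) \<longlongrightarrow> 0) (at x within U)"
    using assms by auto
  have "((\<lambda>y. (g y - g x - (\<Sum>i<n. f' i x * (y i - x i))) / L2_set (\<lambda>i. y i - x i) {..<n}) \<longlongrightarrow> 0) (at x within U)"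
    if x: "x \<in> U" for x
    by (rule tendsto_within_cong[OF f'(2)[rule_format, OF x]]) (use assms(2) x in auto)
  then show ?thesis using f'(1) Suc by auto
qed

section \<open>Difference quotients, sums and products of C^k functions\<close>

lemma continuous_on_coordinate: "continuous_on U (\<lambda>y::'a \<Rightarrow> real. y i)"
  by (rule continuous_on_subset[OF continuous_on_product_coordinates]) simp

lemma tendsto_coordinate: "((\<lambda>y::'a \<Rightarrow> real. y i) \<longlongrightarrow> x i) (at x within U)"
  using continuous_on_coordinate[of UNIV i] tendsto_within_subset
  unfolding continuous_on_def by blast

lemma tendsto_L2_set_diff:
  "((\<lambda>y::nat \<Rightarrow> real. L2_set (\<lambda>i. y i - x i) {..<n}) \<longlongrightarrow> 0) (at x within U)"
proof -
  have "((\<lambda>y. sqrt (\<Sum>i<n. (y i - x i)\<^sup>2)) \<longlongrightarrow> sqrt (\<Sum>i<n. (x i - x i)\<^sup>2)) (at x within U)"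
    by (intro tendsto_intros tendsto_coordinate)
  then show ?thesis by (simp add: L2_set_def)
qed

lemma L2_set_diff_eq_0:
  "L2_set (\<lambda>i. y i - x i) {..<n} = 0 \<Longrightarrow> i < n \<Longrightarrow> (y::nat \<Rightarrow> real) i = x i"
  by (auto simp: L2_set_eq_0_iff)

text \<open>At \<open>y = x\<close> the quotient is \<open>0 / 0 = 0\<close>, so that it is continuous at \<open>x\<close> whenever it tends to 0.\<close>

definition diff_quot :: "nat \<Rightarrow> ((nat \<Rightarrow> real) \<Rightarrow> real) \<Rightarrow> (nat \<Rightarrow> real) \<Rightarrow> (nat \<Rightarrow> real) \<Rightarrow> (nat \<Rightarrow> real) \<Rightarrow> real" where
  "diff_quot n f d x y =
     (f y - f x - (\<Sum>i<n. d i * (y i - x i))) / L2_set (\<lambda>i. y i - x i) {..<n}"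

lemma Ck_on_Suc:
  "Ck_on n (Suc k) U f \<longleftrightarrow>
     (\<exists>f'. (\<forall>i<n. Ck_on n k U (f' i)) \<and>
       (\<forall>x\<in>U. (diff_quot n f (\<lambda>i. f' i x) x \<longlongrightarrow> 0) (at x within U)))"
  by (simp add: diff_quot_def[abs_def])

declare Ck_on.simps(2)[simp del]

lemma diff_quot_self: "diff_quot n f d x x = 0"
  by (simp add: diff_quot_def)

text \<open>Differentiability as an exact expansion, the remainder being measured in units of the
  distance. If the distance is 0, then \<open>x\<close> and \<open>y\<close> agree below index
  \<open>n\<close>; from \<open>n\<close> on both vanish as points of
  \<open>Euclidean_space n\<close>. So \<open>y = x\<close>, and nothing is lost by the division by
  0.\<close>

lemma diff_quot_expand:
  assumes U: "U \<subseteq> topspace (Euclidean_space n)" "x \<in> U" "y \<in> U"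
  shows "f y = f x + (\<Sum>i<n. d i * (y i - x i)) + diff_quot n f d x y * L2_set (\<lambda>i. y i - x i) {..<n}"
proof (cases "L2_set (\<lambda>i. y i - x i) {..<n} = 0")
  case True
  have "y i = x i" for i
  proof (cases "i < n")
    case False
    then have "y i = 0" "x i = 0" using assms by (auto simp: topspace_Euclidean_space)
    then show ?thesis by simp
  qed (rule L2_set_diff_eq_0[OF True])
  then have "y = x" by auto
  then show ?thesis by (simp add: diff_quot_self)
next
  case False
  then show ?thesis by (simp add: diff_quot_def)
qed

lemma abs_linear_le_L2_set:
  "\<bar>\<Sum>i<n. d i * (y i - x i)\<bar> \<le> (\<Sum>i<n. \<bar>d i\<bar>) * L2_set (\<lambda>i. y i - x i) {..<n}" for x :: "nat \<Rightarrow> real"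
proof -
  have "\<bar>y i - x i\<bar> \<le> L2_set (\<lambda>i. y i - x i) {..<n}" if "i < n" for i
    using member_le_L2_set[of "{..<n}" i "\<lambda>i. \<bar>y i - x i\<bar>"] that by (simp add: L2_set_def)
  then have "\<bar>\<Sum>i<n. d i * (y i - x i)\<bar> \<le> (\<Sum>i<n. \<bar>d i\<bar> * L2_set (\<lambda>i. y i - x i) {..<n})"
    by (intro order.trans[OF sum_abs] sum_mono) (simp add: abs_mult mult_left_mono)
  then show ?thesis by (simp add: sum_distrib_right)
qed

text \<open>For \<open>N = 0\<close> the quotient is 0 by convention, which is at most
  \<open>C\<close>.\<close>

lemma divide_le_of_le_mult: "0 \<le> N \<Longrightarrow> 0 \<le> C \<Longrightarrow> a \<le> C * N \<Longrightarrow> a / N \<le> (C::real)"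
  by (cases "N = 0") (simp_all add: divide_le_eq)

lemma tendsto_of_diff_quot:
  assumes U: "U \<subseteq> topspace (Euclidean_space n)" "x \<in> U"
    and f: "(diff_quot n f d x \<longlongrightarrow> 0) (at x within U)"
  shows "(f \<longlongrightarrow> f x) (at x within U)"
proof -
  have "((\<lambda>y. f x + (\<Sum>i<n. d i * (y i - x i)) + diff_quot n f d x y * L2_set (\<lambda>i. y i - x i) {..<n})
      \<longlongrightarrow> f x + (\<Sum>i<n. d i * (x i - x i)) + 0 * 0) (at x within U)"
    by (intro tendsto_intros tendsto_coordinate f tendsto_L2_set_diff)
  then have "((\<lambda>y. f x + (\<Sum>i<n. d i * (y i - x i)) + diff_quot n f d x y * L2_set (\<lambda>i. y i - x i) {..<n})
      \<longlongrightarrow> f x) (at x within U)" by simp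
  then show ?thesis
    by (rule tendsto_within_cong) (use diff_quot_expand[OF U, of _ f d] in auto)
qed

lemma Ck_on_Suc_imp_continuous:
  assumes "U \<subseteq> topspace (Euclidean_space n)" "Ck_on n (Suc k) U f"
  shows "continuous_on U f"
  using assms tendsto_of_diff_quot unfolding continuous_on_def Ck_on_Suc by blast

lemma Ck_on_mono_Suc:
  assumes U: "U \<subseteq> topspace (Euclidean_space n)"
  shows "Ck_on n (Suc k) U f \<Longrightarrow> Ck_on n k U f"
proof (induction k arbitrary: f)
  case 0
  then show ?case using Ck_on_Suc_imp_continuous[OF U] by auto
next
  case (Suc k)
  obtain f' where f': "\<forall>i<n. Ck_on n (Suc k) U (f' i)"
    "\<forall>x\<in>U. (diff_quot n f (\<lambda>i. f' i x) x \<longlongrightarrow> 0) (at x within U)"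
    using Suc.prems unfolding Ck_on_Suc[of n "Suc k"] by blast
  then have "\<forall>i<n. Ck_on n k U (f' i)" using Suc.IH by blast
  with f'(2) show ?case unfolding Ck_on_Suc[of n k] by blast
qed

lemma Ck_on_const: "Ck_on n k U (\<lambda>_. c)"
proof (induction k arbitrary: c)
  case (Suc k)
  then show ?case
    by (auto simp: Ck_on_Suc diff_quot_def[abs_def] intro!: exI[of _ "\<lambda>_ _. 0"])
qed (simp add: continuous_on_const)

lemma Ck_on_coordinate: "j < n \<Longrightarrow> Ck_on n k U (\<lambda>y. y j)"
proof (cases k)
  case (Suc l)
  assume j: "j < n"
  have "diff_quot n (\<lambda>y. y j) (\<lambda>i. of_bool (i = j)) x = (\<lambda>_. 0)" for x
    using j by (simp add: fun_eq_iff diff_quot_def if_distrib[of "\<lambda>t. t * _"] of_bool_def cong: if_cong)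
  then show ?thesis using Suc j
    by (auto simp: Ck_on_Suc Ck_on_const intro!: exI[of _ "\<lambda>i _. of_bool (i = j)"])
qed (simp add: continuous_on_coordinate)

lemma Ck_on_add: "Ck_on n k U f \<Longrightarrow> Ck_on n k U g \<Longrightarrow> Ck_on n k U (\<lambda>x. f x + g x)"
proof (induction k arbitrary: f g)
  case 0
  then show ?case by (auto intro: continuous_on_add)
next
  case (Suc k)
  obtain f' where f': "\<forall>i<n. Ck_on n k U (f' i)"
    "\<forall>x\<in>U. (diff_quot n f (\<lambda>i. f' i x) x \<longlongrightarrow> 0) (at x within U)"
    using Suc.prems(1) unfolding Ck_on_Suc by blast
  obtain g' where g': "\<forall>i<n. Ck_on n k U (g' i)"
    "\<forall>x\<in>U. (diff_quot n g (\<lambda>i. g' i x) x \<longlongrightarrow> 0) (at x within U)"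
    using Suc.prems(2) unfolding Ck_on_Suc by blast
  have eq: "diff_quot n (\<lambda>x. f x + g x) (\<lambda>i. f' i x + g' i x) x =
      (\<lambda>y. diff_quot n f (\<lambda>i. f' i x) x y + diff_quot n g (\<lambda>i. g' i x) x y)" for x
  proof
    fix y
    have "f y + g y - (f x + g x) - (\<Sum>i<n. (f' i x + g' i x) * (y i - x i)) =
      (f y - f x - (\<Sum>i<n. f' i x * (y i - x i))) + (g y - g x - (\<Sum>i<n. g' i x * (y i - x i)))"
      by (simp add: distrib_right sum.distrib)
    then show "diff_quot n (\<lambda>x. f x + g x) (\<lambda>i. f' i x + g' i x) x y =
      diff_quot n f (\<lambda>i. f' i x) x y + diff_quot n g (\<lambda>i. g' i x) x y"
      unfolding diff_quot_def by (simp only: add_divide_distrib)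
  qed
  have "\<forall>i<n. Ck_on n k U (\<lambda>x. f' i x + g' i x)" using Suc.IH f' g' by blast
  moreover have "(diff_quot n (\<lambda>x. f x + g x) (\<lambda>i. f' i x + g' i x) x \<longlongrightarrow> 0) (at x within U)"
    if "x \<in> U" for x
    unfolding eq using tendsto_add[OF f'(2)[rule_format, OF that] g'(2)[rule_format, OF that]] by simp
  ultimately show ?case unfolding Ck_on_Suc
    by (intro exI[of _ "\<lambda>i x. f' i x + g' i x"]) blast
qed

lemma Ck_on_sum:
  "(\<And>i. i \<in> I \<Longrightarrow> Ck_on n k U (f i)) \<Longrightarrow> Ck_on n k U (\<lambda>x. \<Sum>i\<in>I. f i x)"
  by (induction I rule: infinite_finite_induct) (auto intro: Ck_on_const Ck_on_add)

lemma Ck_on_mult: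
  assumes U: "U \<subseteq> topspace (Euclidean_space n)"
  shows "Ck_on n k U f \<Longrightarrow> Ck_on n k U g \<Longrightarrow> Ck_on n k U (\<lambda>x. f x * g x)"
proof (induction k arbitrary: f g)
  case 0
  then show ?case by (auto intro: continuous_on_mult)
next
  case (Suc k)
  obtain f' where f': "\<forall>i<n. Ck_on n k U (f' i)"
    "\<forall>x\<in>U. (diff_quot n f (\<lambda>i. f' i x) x \<longlongrightarrow> 0) (at x within U)"
    using Suc.prems(1) unfolding Ck_on_Suc by blast
  obtain g' where g': "\<forall>i<n. Ck_on n k U (g' i)"
    "\<forall>x\<in>U. (diff_quot n g (\<lambda>i. g' i x) x \<longlongrightarrow> 0) (at x within U)"
    using Suc.prems(2) unfolding Ck_on_Suc by blast
  note fk = Ck_on_mono_Suc[OF U Suc.prems(1)] and gk = Ck_on_mono_Suc[OF U Suc.prems(2)]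
  have "\<forall>i<n. Ck_on n k U (\<lambda>x. f' i x * g x + f x * g' i x)"
    using Suc.IH f'(1) g'(1) fk gk by (auto intro!: Ck_on_add)
  moreover have "(diff_quot n (\<lambda>x. f x * g x) (\<lambda>i. f' i x * g x + f x * g' i x) x \<longlongrightarrow> 0) (at x within U)"
    if x: "x \<in> U" for x
  proof -
    let ?N = "\<lambda>y. L2_set (\<lambda>i. y i - x i) {..<n}"
    \<comment> \<open>The product rule with remainder: the remainder of \<open>f\<close> times
      \<open>g y\<close>, then \<open>f x\<close> times the remainder of \<open>g\<close>, and
      finally the linear part of \<open>f\<close> times the increment of \<open>g\<close>. In the
      last term the linear part divided by the distance is bounded by the sum of the
      \<open>\<bar>f' i x\<bar>\<close>, and the increment tends to 0 by continuity of
      \<open>g\<close>.\<close>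
    let ?R = "\<lambda>y. diff_quot n f (\<lambda>i. f' i x) x y * g y + f x * diff_quot n g (\<lambda>i. g' i x) x y
      + (\<Sum>i<n. f' i x * (y i - x i)) * (g y - g x) / ?N y"
    have eq: "diff_quot n (\<lambda>x. f x * g x) (\<lambda>i. f' i x * g x + f x * g' i x) x y = ?R y" for y
    proof -
      have "f y * g y - f x * g x - (\<Sum>i<n. (f' i x * g x + f x * g' i x) * (y i - x i)) =
         (f y - f x - (\<Sum>i<n. f' i x * (y i - x i))) * g y + f x * (g y - g x - (\<Sum>i<n. g' i x * (y i - x i)))
         + (\<Sum>i<n. f' i x * (y i - x i)) * (g y - g x)"
        by (simp add: algebra_simps sum.distrib sum_subtractf sum_distrib_left sum_distrib_right)
      then show ?thesis unfolding diff_quot_def by (simp add: add_divide_distrib)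
    qed
    have tg: "(g \<longlongrightarrow> g x) (at x within U)"
      using tendsto_of_diff_quot[OF U x] g'(2) x by blast
    have "((\<lambda>y. (\<Sum>i<n. \<bar>f' i x\<bar>) * \<bar>g y - g x\<bar>) \<longlongrightarrow> (\<Sum>i<n. \<bar>f' i x\<bar>) * \<bar>g x - g x\<bar>) (at x within U)"
      by (intro tendsto_intros tg)
    then have lim: "((\<lambda>y. (\<Sum>i<n. \<bar>f' i x\<bar>) * \<bar>g y - g x\<bar>) \<longlongrightarrow> 0) (at x within U)" by simp
    have bound: "\<bar>(\<Sum>i<n. f' i x * (y i - x i)) * (g y - g x) / ?N y\<bar> \<le> (\<Sum>i<n. \<bar>f' i x\<bar>) * \<bar>g y - g x\<bar>" for y
    proof -
      have "\<bar>\<Sum>i<n. f' i x * (y i - x i)\<bar> / ?N y \<le> (\<Sum>i<n. \<bar>f' i x\<bar>)"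
        by (intro divide_le_of_le_mult abs_linear_le_L2_set L2_set_nonneg sum_nonneg) simp
      then have "\<bar>\<Sum>i<n. f' i x * (y i - x i)\<bar> / ?N y * \<bar>g y - g x\<bar> \<le> (\<Sum>i<n. \<bar>f' i x\<bar>) * \<bar>g y - g x\<bar>"
        by (rule mult_right_mono) simp
      then show ?thesis by (simp add: abs_mult L2_set_nonneg)
    qed
    have "((\<lambda>y. (\<Sum>i<n. f' i x * (y i - x i)) * (g y - g x) / ?N y) \<longlongrightarrow> 0) (at x within U)"
      by (rule Lim_null_comparison[OF always_eventually lim]) (simp only: real_norm_def bound simp_thms)
    then have "(?R \<longlongrightarrow> 0 * g x + f x * 0 + 0) (at x within U)"
      using f'(2) g'(2) x tg by (intro tendsto_intros) auto
    then have "(?R \<longlongrightarrow> 0) (at x within U)" by simp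
    then show ?thesis by (rule tendsto_within_cong) (rule eq)
  qed
  ultimately show ?case unfolding Ck_on_Suc by (intro exI[of _ "\<lambda>i x. f' i x * g x + f x * g' i x"]) blast
qed

section \<open>Smooth functions and smooth maps between Euclidean domains\<close>

lemma Cinf_on_subset: "Cinf_on n U f \<Longrightarrow> W \<subseteq> U \<Longrightarrow> Cinf_on n W f"
  unfolding Cinf_on_def using Ck_on_subset by blast

lemma Cinf_on_cong: "Cinf_on n U f \<Longrightarrow> (\<And>x. x \<in> U \<Longrightarrow> g x = f x) \<Longrightarrow> Cinf_on n U g"
  unfolding Cinf_on_def using Ck_on_cong by blast

lemma Cinf_on_const: "Cinf_on n U (\<lambda>_. c)"
  unfolding Cinf_on_def using Ck_on_const by blast

lemma Cinf_on_coordinate: "j < n \<Longrightarrow> Cinf_on n U (\<lambda>y. y j)"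
  unfolding Cinf_on_def using Ck_on_coordinate by blast

lemma Cinf_on_add: "Cinf_on n U f \<Longrightarrow> Cinf_on n U g \<Longrightarrow> Cinf_on n U (\<lambda>x. f x + g x)"
  unfolding Cinf_on_def using Ck_on_add by blast

lemma Cinf_on_mult:
  "U \<subseteq> topspace (Euclidean_space n) \<Longrightarrow> Cinf_on n U f \<Longrightarrow> Cinf_on n U g \<Longrightarrow> Cinf_on n U (\<lambda>x. f x * g x)"
  unfolding Cinf_on_def using Ck_on_mult by blast

lemma Cinf_map_id: "W \<subseteq> U \<Longrightarrow> Cinf_map n W n U (\<lambda>x. x)"
  by (auto simp: Cinf_map_def Cinf_on_coordinate)

text \<open>The values are sequences with the product topology: coordinates below \<open>n\<close>
  are smooth, and the others vanish since \<open>U\<close> lies in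
  \<open>Euclidean_space n\<close>.\<close>

lemma continuous_on_Cinf_map:
  assumes W: "W \<subseteq> topspace (Euclidean_space m)" and U: "U \<subseteq> topspace (Euclidean_space n)"
    and G: "Cinf_map m W n U G"
  shows "continuous_on W G"
proof (rule continuous_on_coordinatewise_then_product)
  fix i
  show "continuous_on W (\<lambda>x. G x i)"
  proof (cases "i < n")
    case True
    then have "Ck_on m 0 W (\<lambda>x. G x i)" using G unfolding Cinf_map_def Cinf_on_def by blast
    then show ?thesis by simp
  next
    case False
    then have "G x i = 0" if "x \<in> W" for x
      using that G U unfolding Cinf_map_def topspace_Euclidean_space by (auto dest!: subsetD)
    then show ?thesis by (simp cong: continuous_on_cong)
  qed
qed

text \<open>Reparametrising a plot that is known only locally requires open preimages of the small
  domains on which it has its special form.\<close>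

lemma openin_vimage_Cinf_map:
  assumes W: "openin (Euclidean_space m) W" and U: "openin (Euclidean_space n) U"
    and G: "Cinf_map m W n U G" and U': "openin (Euclidean_space n) U'"
  shows "openin (Euclidean_space m) {x \<in> W. G x \<in> U'}"
proof -
  have Wt: "W \<subseteq> topspace (Euclidean_space m)" using W by (rule openin_subset)
  obtain T where T: "open T" "U' = T \<inter> topspace (Euclidean_space n)"
    using U' unfolding Euclidean_space_def by (auto simp: openin_subtopology euclidean_product_topology)
  have "continuous_on W G" using continuous_on_Cinf_map[OF Wt openin_subset[OF U] G] .
  then have "openin (top_of_set W) (W \<inter> G -` T)" using T(1) by (rule continuous_openin_preimage_gen)
  then obtain S where S: "open S" "W \<inter> G -` T = W \<inter> S" by (auto simp: openin_open)
  have "{x \<in> W. G x \<in> U'} = W \<inter> G -` T"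
    using T(2) G openin_subset[OF U] unfolding Cinf_map_def by blast
  moreover have "openin (Euclidean_space m) (topspace (Euclidean_space m) \<inter> S)"
    using S(1) unfolding Euclidean_space_def by (auto simp: openin_subtopology euclidean_product_topology)
  then have "openin (Euclidean_space m) (W \<inter> (topspace (Euclidean_space m) \<inter> S))"
    using W by (rule openin_Int[rotated])
  moreover have "W \<inter> (topspace (Euclidean_space m) \<inter> S) = W \<inter> S" using Wt by blast
  ultimately show ?thesis using S(2) by simp
qed

text \<open>Bounds the increment of a coordinate relative to the distance. In the chain rule this
  controls how far \<open>G y\<close> moves from \<open>G x\<close> compared with \<open>y\<close>
  from \<open>x\<close>.\<close>

lemma diff_quot_bound:
  assumes W: "W \<subseteq> topspace (Euclidean_space m)" "x \<in> W" "y \<in> W"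
  shows "\<bar>f y - f x\<bar> / L2_set (\<lambda>i. y i - x i) {..<m} \<le> (\<Sum>i<m. \<bar>d i\<bar>) + \<bar>diff_quot m f d x y\<bar>"
proof -
  let ?N = "L2_set (\<lambda>i. y i - x i) {..<m}"
  have N: "0 \<le> ?N" by (rule L2_set_nonneg)
  have "f y - f x = (\<Sum>i<m. d i * (y i - x i)) + diff_quot m f d x y * ?N"
    using diff_quot_expand[OF W, of f d] by simp
  then have "\<bar>f y - f x\<bar> \<le> \<bar>\<Sum>i<m. d i * (y i - x i)\<bar> + \<bar>diff_quot m f d x y\<bar> * ?N"
    using N abs_triangle_ineq[of "\<Sum>i<m. d i * (y i - x i)" "diff_quot m f d x y * ?N"]
    by (simp add: abs_mult)
  also have "\<dots> \<le> (\<Sum>i<m. \<bar>d i\<bar>) * ?N + \<bar>diff_quot m f d x y\<bar> * ?N"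
    by (intro add_right_mono abs_linear_le_L2_set)
  finally have "\<bar>f y - f x\<bar> \<le> ((\<Sum>i<m. \<bar>d i\<bar>) + \<bar>diff_quot m f d x y\<bar>) * ?N" by (simp add: distrib_right)
  then show ?thesis using N
    by (intro divide_le_of_le_mult) (auto intro: sum_nonneg add_nonneg_nonneg)
qed

text \<open>The chain rule. The remainder of the composite is the linear part of \<open>f\<close>
  applied to the remainders of the coordinates of \<open>G\<close>, plus the remainder of
  \<open>f\<close> at \<open>G y\<close> times the ratio of the distances in target and source;
  \<open>diff_quot_bound\<close> keeps that ratio under control.\<close>

lemma diff_quot_compose:
  assumes W: "W \<subseteq> topspace (Euclidean_space m)" and U: "U \<subseteq> topspace (Euclidean_space n)"
    and GU: "G ` W \<subseteq> U" and G: "continuous_on W G" and x: "x \<in> W"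
    and f: "(diff_quot n f d (G x) \<longlongrightarrow> 0) (at (G x) within U)"
    and g: "\<And>i. i < n \<Longrightarrow> (diff_quot m (\<lambda>y. G y i) (e i) x \<longlongrightarrow> 0) (at x within W)"
  shows "(diff_quot m (\<lambda>y. f (G y)) (\<lambda>j. \<Sum>i<n. d i * e i j) x \<longlongrightarrow> 0) (at x within W)"
proof -
  let ?N = "\<lambda>y. L2_set (\<lambda>i. y i - x i) {..<m}"
  let ?M = "\<lambda>y. L2_set (\<lambda>i. G y i - G x i) {..<n}"
  let ?\<rho> = "diff_quot n f d (G x)"
  let ?r = "\<lambda>i y. diff_quot m (\<lambda>y. G y i) (e i) x y"
  let ?R = "\<lambda>y. (\<Sum>i<n. d i * ?r i y) + ?\<rho> (G y) * (?M y / ?N y)"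
  have eq: "diff_quot m (\<lambda>y. f (G y)) (\<lambda>j. \<Sum>i<n. d i * e i j) x y = ?R y" if y: "y \<in> W" for y
  proof -
    have "f (G y) = f (G x) + (\<Sum>i<n. d i * (G y i - G x i)) + ?\<rho> (G y) * ?M y"
      using diff_quot_expand[OF U, of "G x" "G y" f d] GU x y by blast
    moreover have "(\<Sum>j<m. (\<Sum>i<n. d i * e i j) * (y j - x j)) = (\<Sum>i<n. d i * (\<Sum>j<m. e i j * (y j - x j)))"
    proof -
      have "(\<Sum>j<m. (\<Sum>i<n. d i * e i j) * (y j - x j)) = (\<Sum>j<m. \<Sum>i<n. d i * (e i j * (y j - x j)))"
        by (simp only: sum_distrib_right mult.assoc)
      also have "\<dots> = (\<Sum>i<n. \<Sum>j<m. d i * (e i j * (y j - x j)))" by (rule sum.swap)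
      also have "\<dots> = (\<Sum>i<n. d i * (\<Sum>j<m. e i j * (y j - x j)))" by (simp only: sum_distrib_left)
      finally show ?thesis .
    qed
    ultimately have "f (G y) - f (G x) - (\<Sum>j<m. (\<Sum>i<n. d i * e i j) * (y j - x j)) =
      (\<Sum>i<n. d i * (G y i - G x i - (\<Sum>j<m. e i j * (y j - x j)))) + ?\<rho> (G y) * ?M y"
      by (simp only: right_diff_distrib[of _ "G y _ - G x _"] sum_subtractf)
    then show ?thesis
      unfolding diff_quot_def[of m "\<lambda>y. f (G y)"] diff_quot_def[of m "\<lambda>y. G y _"]
      by (simp add: add_divide_distrib sum_divide_distrib)
  qed
  \<comment> \<open>\<open>G\<close> may take the value \<open>G x\<close> at points other than
    \<open>x\<close>, so the punctured limit of the remainder cannot simply be composed with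
    \<open>G\<close>. As the remainder vanishes at \<open>G x\<close> itself, the limit holds along
    the full neighbourhood filter within \<open>U\<close>, and this one composes.\<close>
  have "((\<lambda>y. ?\<rho> (G y)) \<longlongrightarrow> 0) (at x within W)"
  proof -
    have "filterlim G (nhds (G x)) (at x within W)"
      using G x by (simp add: continuous_on_def)
    moreover have "\<forall>\<^sub>F y in at x within W. G y \<in> U"
      using GU by (auto simp: eventually_at_filter intro!: always_eventually)
    ultimately have GG: "filterlim G (inf (nhds (G x)) (principal U)) (at x within W)"
      by (simp add: filterlim_inf filterlim_principal)
    have "(?\<rho> \<longlongrightarrow> 0) (inf (nhds (G x)) (principal U))"
    proof -
      have "\<forall>\<^sub>F z in inf (nhds (G x)) (principal U). ?\<rho> z \<in> T" if T: "open T" "0 \<in> T" for T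
      proof -
        have "\<forall>\<^sub>F z in at (G x) within U. ?\<rho> z \<in> T" using f T by (auto simp: tendsto_def)
        then have "\<forall>\<^sub>F z in nhds (G x). z \<in> U \<longrightarrow> ?\<rho> z \<in> T"
          unfolding eventually_at_filter
          by (rule eventually_mono) (metis diff_quot_self T(2))
        then show ?thesis by (simp add: eventually_inf_principal)
      qed
      then show ?thesis by (simp add: tendsto_def)
    qed
    then show ?thesis using GG by (rule filterlim_compose)
  qed
  then have "((\<lambda>y. \<bar>?\<rho> (G y)\<bar> * (\<Sum>i<n. (\<Sum>j<m. \<bar>e i j\<bar>) + \<bar>?r i y\<bar>)) \<longlongrightarrow>
      \<bar>0\<bar> * (\<Sum>i<n. (\<Sum>j<m. \<bar>e i j\<bar>) + \<bar>0\<bar>)) (at x within W)"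
    using g by (intro tendsto_intros) auto
  then have lim: "((\<lambda>y. \<bar>?\<rho> (G y)\<bar> * (\<Sum>i<n. (\<Sum>j<m. \<bar>e i j\<bar>) + \<bar>?r i y\<bar>)) \<longlongrightarrow> 0) (at x within W)"
    by simp
  have "\<bar>?\<rho> (G y) * (?M y / ?N y)\<bar> \<le> \<bar>?\<rho> (G y)\<bar> * (\<Sum>i<n. (\<Sum>j<m. \<bar>e i j\<bar>) + \<bar>?r i y\<bar>)"
    if y: "y \<in> W" for y
  proof -
    have "?M y / ?N y \<le> (\<Sum>i<n. \<bar>G y i - G x i\<bar>) / ?N y"
      by (intro divide_right_mono L2_set_le_sum_abs L2_set_nonneg)
    also have "\<dots> \<le> (\<Sum>i<n. (\<Sum>j<m. \<bar>e i j\<bar>) + \<bar>?r i y\<bar>)"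
      unfolding sum_divide_distrib by (intro sum_mono diff_quot_bound[OF W x y])
    finally show ?thesis
      unfolding abs_mult abs_divide by (intro mult_left_mono) (auto simp: L2_set_nonneg)
  qed
  then have "\<forall>\<^sub>F y in at x within W. norm (?\<rho> (G y) * (?M y / ?N y)) \<le>
      \<bar>?\<rho> (G y)\<bar> * (\<Sum>i<n. (\<Sum>j<m. \<bar>e i j\<bar>) + \<bar>?r i y\<bar>)"
    unfolding eventually_at_filter real_norm_def by (intro always_eventually) blast
  then have "((\<lambda>y. ?\<rho> (G y) * (?M y / ?N y)) \<longlongrightarrow> 0) (at x within W)"
    using lim by (rule Lim_null_comparison)
  then have "(?R \<longlongrightarrow> (\<Sum>i<n. d i * 0) + 0) (at x within W)"
    using g by (intro tendsto_intros) auto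
  then have "(?R \<longlongrightarrow> 0) (at x within W)" by simp
  then show ?thesis by (rule tendsto_within_cong) (rule eq)
qed

text \<open>Induction on \<open>k\<close> with \<open>G\<close> fixed: a partial derivative of the
  composite is a sum of products of some \<open>f' i\<close> after \<open>G\<close>, which is C^k by
  the induction hypothesis, with partial derivatives of the coordinates of \<open>G\<close>.\<close>

lemma Ck_on_compose:
  assumes W: "W \<subseteq> topspace (Euclidean_space m)" and U: "U \<subseteq> topspace (Euclidean_space n)"
    and G: "Cinf_map m W n U G"
  shows "Ck_on n k U f \<Longrightarrow> Ck_on m k W (\<lambda>x. f (G x))"
proof (induction k arbitrary: f)
  case 0
  have "G ` W \<subseteq> U" using G by (simp add: Cinf_map_def)
  with 0 show ?case
    using continuous_on_compose2[OF _ continuous_on_Cinf_map[OF W U G]] by simp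
next
  case (Suc k)
  have GU: "G ` W \<subseteq> U" using G by (simp add: Cinf_map_def)
  obtain f' where f': "\<forall>i<n. Ck_on n k U (f' i)"
    "\<forall>x\<in>U. (diff_quot n f (\<lambda>i. f' i x) x \<longlongrightarrow> 0) (at x within U)"
    using Suc.prems unfolding Ck_on_Suc by blast
  have "\<exists>g'. (\<forall>j<m. Ck_on m k W (g' j)) \<and>
      (\<forall>x\<in>W. (diff_quot m (\<lambda>y. G y i) (\<lambda>j. g' j x) x \<longlongrightarrow> 0) (at x within W))" if "i \<in> {..<n}" for i
  proof -
    have "Ck_on m (Suc k) W (\<lambda>y. G y i)" using G that by (simp add: Cinf_map_def Cinf_on_def)
    then show ?thesis unfolding Ck_on_Suc .
  qed
  then obtain g' where g': "\<And>i j. i < n \<Longrightarrow> j < m \<Longrightarrow> Ck_on m k W (g' i j)"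
    "\<And>i x. i < n \<Longrightarrow> x \<in> W \<Longrightarrow> (diff_quot m (\<lambda>y. G y i) (\<lambda>j. g' i j x) x \<longlongrightarrow> 0) (at x within W)"
    unfolding lessThan_iff by metis
  have "\<forall>j<m. Ck_on m k W (\<lambda>x. \<Sum>i<n. f' i (G x) * g' i j x)"
    using Suc.IH f'(1) g'(1) by (auto intro!: Ck_on_sum Ck_on_mult[OF W])
  moreover have "(diff_quot m (\<lambda>y. f (G y)) (\<lambda>j. \<Sum>i<n. f' i (G x) * g' i j x) x \<longlongrightarrow> 0) (at x within W)"
    if x: "x \<in> W" for x
    using f'(2) GU x g'(2) by (intro diff_quot_compose[OF W U GU continuous_on_Cinf_map[OF W U G] x]) auto
  ultimately show ?case unfolding Ck_on_Suc
    by (intro exI[of _ "\<lambda>j x. \<Sum>i<n. f' i (G x) * g' i j x"]) blast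
qed

lemma Cinf_on_compose:
  "W \<subseteq> topspace (Euclidean_space m) \<Longrightarrow> U \<subseteq> topspace (Euclidean_space n) \<Longrightarrow> Cinf_map m W n U G \<Longrightarrow>
    Cinf_on n U f \<Longrightarrow> Cinf_on m W (\<lambda>x. f (G x))"
  unfolding Cinf_on_def using Ck_on_compose by blast

lemma Cinf_map_compose:
  assumes "W \<subseteq> topspace (Euclidean_space m)" "U \<subseteq> topspace (Euclidean_space n)"
    "Cinf_map m W n U G" "Cinf_map n U l T F"
  shows "Cinf_map m W l T (\<lambda>x. F (G x))"
  using assms Cinf_on_compose[OF assms(1,2,3)] unfolding Cinf_map_def by blast
section \<open>Real vector spaces and algebras\<close>

text \<open>An additive inverse of \<open>v\<close> is \<open>(-1) \<odot> v\<close>, by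
  distributivity and \<open>0 \<odot> v = \<zero>\<close>, so the conditions do not ask for
  one.\<close>

lemma vectorspace_class_ringI:
  fixes M :: "(real, 'a, 'm) module_scheme" (structure)
  assumes "\<zero> \<in> carrier M"
    and "\<And>v w. v \<in> carrier M \<Longrightarrow> w \<in> carrier M \<Longrightarrow> v \<oplus> w \<in> carrier M"
    and "\<And>r v. v \<in> carrier M \<Longrightarrow> r \<odot> v \<in> carrier M"
    and "\<And>v w. v \<in> carrier M \<Longrightarrow> w \<in> carrier M \<Longrightarrow> v \<oplus> w = w \<oplus> v"
    and "\<And>u v w. u \<in> carrier M \<Longrightarrow> v \<in> carrier M \<Longrightarrow> w \<in> carrier M \<Longrightarrow> (u \<oplus> v) \<oplus> w = u \<oplus> (v \<oplus> w)"
    and zero: "\<And>v. v \<in> carrier M \<Longrightarrow> v \<oplus> \<zero> = v"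
    and zero_smult: "\<And>v. v \<in> carrier M \<Longrightarrow> 0 \<odot> v = \<zero>"
    and one: "\<And>v. v \<in> carrier M \<Longrightarrow> 1 \<odot> v = v"
    and "\<And>r s v. v \<in> carrier M \<Longrightarrow> (r * s) \<odot> v = r \<odot> (s \<odot> v)"
    and distrib: "\<And>r s v. v \<in> carrier M \<Longrightarrow> (r + s) \<odot> v = r \<odot> v \<oplus> s \<odot> v"
    and "\<And>r v w. v \<in> carrier M \<Longrightarrow> w \<in> carrier M \<Longrightarrow> r \<odot> (v \<oplus> w) = r \<odot> v \<oplus> r \<odot> w"
  shows "vectorspace class_ring M"
proof (rule vs_criteria)
  show "\<forall>v\<in>carrier M. \<exists>w\<in>carrier M. v \<oplus> w = \<zero>"
  proof
    fix v assume v: "v \<in> carrier M"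
    have "v \<oplus> (-1) \<odot> v = 1 \<odot> v \<oplus> (-1) \<odot> v" using v one by simp
    also have "\<dots> = (1 + (-1)) \<odot> v" using v distrib by metis
    finally show "\<exists>w\<in>carrier M. v \<oplus> w = \<zero>" using v assms(3) zero_smult by auto
  qed
qed (use assms in \<open>auto intro: class_field\<close>)

context
  fixes M :: "(real, 'a, 'm) module_scheme" (structure)
  assumes M: "vectorspace class_ring M"
begin

interpretation vectorspace class_ring M by (rule M)

lemma vectorspace_smult_closed: "v \<in> carrier M \<Longrightarrow> r \<odot> v \<in> carrier M"
  using smult_closed[of r v] by simp

lemma vectorspace_add_closed: "v \<in> carrier M \<Longrightarrow> w \<in> carrier M \<Longrightarrow> v \<oplus> w \<in> carrier M"
  by (rule a_closed)

lemma vectorspace_zero_closed: "\<zero> \<in> carrier M"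
  by (rule zero_closed)

lemma vectorspace_smult_one: "v \<in> carrier M \<Longrightarrow> 1 \<odot> v = v"
  using smult_one by simp

lemma vectorspace_smult_assoc: "v \<in> carrier M \<Longrightarrow> (r * s) \<odot> v = r \<odot> (s \<odot> v)"
  using smult_assoc1[of r s v] by simp

lemma vectorspace_smult_l_distr: "v \<in> carrier M \<Longrightarrow> (r + s) \<odot> v = r \<odot> v \<oplus> s \<odot> v"
  using smult_l_distr[of r s v] by simp

lemma vectorspace_smult_r_distr:
  "v \<in> carrier M \<Longrightarrow> w \<in> carrier M \<Longrightarrow> r \<odot> (v \<oplus> w) = r \<odot> v \<oplus> r \<odot> w"
  using smult_r_distr[of r v w] by simp

lemma vectorspace_smult_zero: "v \<in> carrier M \<Longrightarrow> 0 \<odot> v = \<zero>"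
  using smult_l_null[of v] by simp

lemmas vectorspace_add = a_assoc a_comm l_zero r_zero

text \<open>Since \<open>q\<close> may fail to be injective, the same statement serves transports
  and quotients.\<close>

lemma vectorspace_image:
  fixes N :: "(real, 'b, 'n) module_scheme"
  assumes carr: "carrier N = q ` carrier M"
    and zero: "\<zero>\<^bsub>N\<^esub> = q \<zero>"
    and add: "\<And>v w. v \<in> carrier M \<Longrightarrow> w \<in> carrier M \<Longrightarrow> q v \<oplus>\<^bsub>N\<^esub> q w = q (v \<oplus> w)"
    and smult: "\<And>r v. v \<in> carrier M \<Longrightarrow> r \<odot>\<^bsub>N\<^esub> q v = q (r \<odot> v)"
  shows "vectorspace class_ring N"
  by (rule vectorspace_class_ringI)
    (auto simp: carr zero add smult vectorspace_smult_closed vectorspace_add_closed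
      vectorspace_zero_closed vectorspace_smult_one vectorspace_smult_assoc vectorspace_smult_l_distr
      vectorspace_smult_r_distr vectorspace_smult_zero a_ac)

lemma vectorspace_subspace:
  assumes S: "S \<subseteq> carrier M" "\<zero> \<in> S"
    and "\<And>v w. v \<in> S \<Longrightarrow> w \<in> S \<Longrightarrow> v \<oplus> w \<in> S" "\<And>r v. v \<in> S \<Longrightarrow> r \<odot> v \<in> S"
  shows "vectorspace class_ring (M\<lparr>carrier := S\<rparr>)"
  by (rule vectorspace_class_ringI)
    (use assms in \<open>auto simp: vectorspace_smult_one vectorspace_smult_assoc vectorspace_smult_l_distr
      vectorspace_smult_r_distr vectorspace_smult_zero a_assoc subset_iff intro: a_comm\<close>)

end

lemma linear_map_class_ringI:
  fixes M :: "(real, 'a, 'm) module_scheme" and N :: "(real, 'b, 'n) module_scheme"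
  assumes "vectorspace class_ring M" "vectorspace class_ring N"
    and "\<And>v. v \<in> carrier M \<Longrightarrow> G v \<in> carrier N"
    and "\<And>v w. v \<in> carrier M \<Longrightarrow> w \<in> carrier M \<Longrightarrow> G (v \<oplus>\<^bsub>M\<^esub> w) = G v \<oplus>\<^bsub>N\<^esub> G w"
    and "\<And>r v. v \<in> carrier M \<Longrightarrow> G (r \<odot>\<^bsub>M\<^esub> v) = r \<odot>\<^bsub>N\<^esub> G v"
  shows "linear_map class_ring M N G"
  using assms unfolding linear_map_def mod_hom_def mod_hom_axioms_def module_hom_def vectorspace_def
  by auto

lemma linear_map_class_ringD:
  fixes M :: "(real, 'a, 'm) module_scheme" and N :: "(real, 'b, 'n) module_scheme"
  assumes "linear_map class_ring M N G"
  shows "vectorspace class_ring M" "vectorspace class_ring N"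
    and "v \<in> carrier M \<Longrightarrow> G v \<in> carrier N"
    and "v \<in> carrier M \<Longrightarrow> w \<in> carrier M \<Longrightarrow> G (v \<oplus>\<^bsub>M\<^esub> w) = G v \<oplus>\<^bsub>N\<^esub> G w"
    and "v \<in> carrier M \<Longrightarrow> G (r \<odot>\<^bsub>M\<^esub> v) = r \<odot>\<^bsub>N\<^esub> G v"
  using assms unfolding linear_map_def mod_hom_def mod_hom_axioms_def module_hom_def by auto

lemma transport_simps:
  assumes "inj_on j (carrier M)"
  shows "carrier (transport j M) = j ` carrier M" "\<zero>\<^bsub>transport j M\<^esub> = j \<zero>\<^bsub>M\<^esub>"
    and "v \<in> carrier M \<Longrightarrow> w \<in> carrier M \<Longrightarrow> j v \<oplus>\<^bsub>transport j M\<^esub> j w = j (v \<oplus>\<^bsub>M\<^esub> w)"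
    and "v \<in> carrier M \<Longrightarrow> r \<odot>\<^bsub>transport j M\<^esub> j v = j (r \<odot>\<^bsub>M\<^esub> v)"
  using assms by (simp_all add: transport_def Let_def)

lemma vectorspace_transport:
  "vectorspace class_ring M \<Longrightarrow> inj_on j (carrier M) \<Longrightarrow> vectorspace class_ring (transport j M)"
  by (erule vectorspace_image[where q = j]) (rule transport_simps; assumption)+

lemma linear_map_transport:
  "vectorspace class_ring M \<Longrightarrow> inj_on j (carrier M) \<Longrightarrow> linear_map class_ring M (transport j M) j"
  by (rule linear_map_class_ringI) (simp_all add: vectorspace_transport transport_simps(1) transport_simps(3,4)[symmetric])

section \<open>Associative real algebras and their quotients\<close>

locale real_algebra = ring A for A :: "(real, 'a) module" (structure) +
  assumes vectorspace: "vectorspace class_ring A"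
    and smult_mult_left: "a \<in> carrier A \<Longrightarrow> b \<in> carrier A \<Longrightarrow> (r \<odot> a) \<otimes> b = r \<odot> (a \<otimes> b)"
    and smult_mult_right: "a \<in> carrier A \<Longrightarrow> b \<in> carrier A \<Longrightarrow> a \<otimes> (r \<odot> b) = r \<odot> (a \<otimes> b)"
begin

lemma smult_closed: "a \<in> carrier A \<Longrightarrow> r \<odot> a \<in> carrier A"
  by (rule vectorspace_smult_closed[OF vectorspace])

lemma real_algebra_image:
  fixes B :: "(real, 'b) module"
  assumes carr: "carrier B = q ` carrier A"
    and zero: "\<zero>\<^bsub>B\<^esub> = q \<zero>"
    and one: "\<one>\<^bsub>B\<^esub> = q \<one>"
    and add: "\<And>v w. v \<in> carrier A \<Longrightarrow> w \<in> carrier A \<Longrightarrow> q v \<oplus>\<^bsub>B\<^esub> q w = q (v \<oplus> w)"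
    and mult: "\<And>v w. v \<in> carrier A \<Longrightarrow> w \<in> carrier A \<Longrightarrow> q v \<otimes>\<^bsub>B\<^esub> q w = q (v \<otimes> w)"
    and smult: "\<And>r v. v \<in> carrier A \<Longrightarrow> r \<odot>\<^bsub>B\<^esub> q v = q (r \<odot> v)"
  shows "real_algebra B"
proof -
  have B: "vectorspace class_ring B"
    using vectorspace carr zero add smult by (rule vectorspace_image)
  then interpret B: vectorspace class_ring B .
  have "ring B"
    by (rule ringI[OF B.abelian_group_axioms monoidI])
      (auto simp: carr zero one add mult m_assoc l_distr r_distr)
  then show ?thesis
    by (rule real_algebra.intro) (unfold_locales,
      auto simp: B carr mult smult smult_mult_left smult_mult_right smult_closed)
qed

text \<open>Scaling by \<open>r\<close> is multiplication by \<open>r \<odot> \<one>\<close>, so a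
  ring ideal of an algebra is a linear subspace.\<close>

lemma ideal_smult_closed:
  assumes "ideal I A" "a \<in> I"
  shows "r \<odot> a \<in> I"
proof -
  interpret ideal I A by fact
  have "a \<in> carrier A" using assms a_subset by blast
  then have "r \<odot> a = (r \<odot> \<one>) \<otimes> a" by (simp add: smult_mult_left)
  then show ?thesis using I_l_closed[OF assms(2), of "r \<odot> \<one>"] smult_closed by simp
qed

text \<open>\<open>alg_quot\<close> defines the scalar action as a union over the representatives of
  a coset. The union collapses to one coset because the ideal is closed under scalars, so that all
  representatives give the same result.\<close>

lemma
  assumes I: "ideal I A"
  shows carrier_alg_quot: "carrier (alg_quot A I) = (\<lambda>a. I +> a) ` carrier A"
    and zero_alg_quot: "\<zero>\<^bsub>alg_quot A I\<^esub> = I +> \<zero>"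
    and one_alg_quot: "\<one>\<^bsub>alg_quot A I\<^esub> = I +> \<one>"
    and add_alg_quot: "\<And>a b. a \<in> carrier A \<Longrightarrow> b \<in> carrier A \<Longrightarrow> (I +> a) \<oplus>\<^bsub>alg_quot A I\<^esub> (I +> b) = I +> (a \<oplus> b)"
    and mult_alg_quot: "\<And>a b. a \<in> carrier A \<Longrightarrow> b \<in> carrier A \<Longrightarrow> (I +> a) \<otimes>\<^bsub>alg_quot A I\<^esub> (I +> b) = I +> (a \<otimes> b)"
    and smult_alg_quot: "\<And>a. a \<in> carrier A \<Longrightarrow> r \<odot>\<^bsub>alg_quot A I\<^esub> (I +> a) = I +> (r \<odot> a)"
proof -
  interpret ideal I A by fact
  note defs = alg_quot_def FactRing_def ring.defs module.defs
  show "carrier (alg_quot A I) = (\<lambda>a. I +> a) ` carrier A"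
    by (auto simp: defs A_RCOSETS_def')
  show "\<zero>\<^bsub>alg_quot A I\<^esub> = I +> \<zero>"
    using a_rcos_zero[OF I, of \<zero>] additive_subgroup.zero_closed[OF additive_subgroup_axioms] by (simp add: defs)
  show "\<one>\<^bsub>alg_quot A I\<^esub> = I +> \<one>" by (simp add: defs)
  show "\<And>a b. a \<in> carrier A \<Longrightarrow> b \<in> carrier A \<Longrightarrow> (I +> a) \<oplus>\<^bsub>alg_quot A I\<^esub> (I +> b) = I +> (a \<oplus> b)"
    by (simp add: defs a_rcos_sum)
  show "\<And>a b. a \<in> carrier A \<Longrightarrow> b \<in> carrier A \<Longrightarrow> (I +> a) \<otimes>\<^bsub>alg_quot A I\<^esub> (I +> b) = I +> (a \<otimes> b)"
    by (simp add: defs rcoset_mult_add)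
  show "r \<odot>\<^bsub>alg_quot A I\<^esub> (I +> a) = I +> (r \<odot> a)" if a: "a \<in> carrier A" for a
  proof -
    have "I +> (r \<odot> b) = I +> (r \<odot> a)" if "b \<in> I +> a" for b
    proof -
      obtain i where i: "i \<in> I" "b = i \<oplus> a" using \<open>b \<in> I +> a\<close> by (auto simp: a_r_coset_def')
      have ic: "i \<in> carrier A" using i(1) a_subset by blast
      have "r \<odot> b = r \<odot> i \<oplus> r \<odot> a" using i(2) ic a by (simp add: vectorspace_smult_r_distr[OF vectorspace])
      moreover have "r \<odot> i \<in> I" using I i(1) by (rule ideal_smult_closed)
      ultimately have "r \<odot> b \<in> I +> (r \<odot> a)" by (auto simp: a_r_coset_def')
      then show ?thesis using a_repr_independence'[of "r \<odot> b" "r \<odot> a"] smult_closed[OF a] by simp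
    qed
    moreover have "a \<in> I +> a" using a by (rule a_rcos_self)
    ultimately have "(\<Union>b\<in>I +> a. I +> (r \<odot> b)) = I +> (r \<odot> a)" by blast
    then show ?thesis by (simp add: defs)
  qed
qed

lemma real_algebra_alg_quot: "ideal I A \<Longrightarrow> real_algebra (alg_quot A I)"
  by (rule real_algebra_image[where q = "\<lambda>a. I +> a"])
    (simp_all add: carrier_alg_quot zero_alg_quot one_alg_quot add_alg_quot mult_alg_quot smult_alg_quot)

end

lemma ideal_coset_eqI:
  assumes "ideal I A" "a \<in> carrier A" "i \<in> I"
  shows "I +>\<^bsub>A\<^esub> (i \<oplus>\<^bsub>A\<^esub> a) = I +>\<^bsub>A\<^esub> a"
proof -
  interpret ideal I A by fact
  have "i \<oplus>\<^bsub>A\<^esub> a \<in> I +>\<^bsub>A\<^esub> a" using assms(3) by (auto simp: a_r_coset_def')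
  then show ?thesis using a_repr_independence'[of "i \<oplus>\<^bsub>A\<^esub> a" a] assms(2) by simp
qed

text \<open>The preimage of \<open>J\<close> is an ideal of \<open>A\<close> that contains
  \<open>S\<close>, hence it contains the ideal generated by \<open>S\<close>.\<close>

lemma ring_hom_genideal_subset:
  assumes A: "ring A" and B: "ring B" and \<phi>: "\<phi> \<in> Ring.ring_hom A B" and S: "S \<subseteq> carrier A"
    and J: "ideal J B" and SJ: "\<phi> ` S \<subseteq> J"
  shows "\<phi> ` genideal A S \<subseteq> J"
proof -
  interpret ring_hom_ring A B \<phi> using A B \<phi> by (simp add: ring_hom_ringI2)
  have "ideal {a \<in> carrier A. \<phi> a \<in> J} A" using J by (rule ideal_vimage)
  then have "genideal A S \<subseteq> {a \<in> carrier A. \<phi> a \<in> J}"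
    by (rule R.genideal_minimal) (use S SJ in auto)
  then show ?thesis by auto
qed

text \<open>The induced map of quotients, in the form \<^const>\<open>the_elem\<close> of an image used in the definitions.\<close>

lemma the_elem_coset_image:
  assumes A: "ring A" and I: "ideal I A" and B: "ring B" and J: "ideal J B"
    and \<phi>: "\<phi> \<in> Ring.ring_hom A B" and IJ: "\<phi> ` I \<subseteq> J" and a: "a \<in> carrier A"
  shows "the_elem ((\<lambda>a. J +>\<^bsub>B\<^esub> \<phi> a) ` (I +>\<^bsub>A\<^esub> a)) = J +>\<^bsub>B\<^esub> \<phi> a"
proof -
  interpret I: ideal I A by fact
  have "J +>\<^bsub>B\<^esub> \<phi> b = J +>\<^bsub>B\<^esub> \<phi> a" if b: "b \<in> I +>\<^bsub>A\<^esub> a" for b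
  proof -
    obtain i where i: "i \<in> I" "b = i \<oplus>\<^bsub>A\<^esub> a" using b by (auto simp: a_r_coset_def')
    then have "\<phi> b = \<phi> i \<oplus>\<^bsub>B\<^esub> \<phi> a" using a I.a_subset ring_hom_add[OF \<phi>] by blast
    moreover have "\<phi> i \<in> J" using i(1) IJ by blast
    moreover have "\<phi> a \<in> carrier B" using ring_hom_closed[OF \<phi> a] .
    ultimately show ?thesis using ideal_coset_eqI[OF J] by metis
  qed
  moreover have "a \<in> I +>\<^bsub>A\<^esub> a" using a by (rule I.a_rcos_self)
  ultimately have "(\<lambda>a. J +>\<^bsub>B\<^esub> \<phi> a) ` (I +>\<^bsub>A\<^esub> a) = {J +>\<^bsub>B\<^esub> \<phi> a}" by blast
  then show ?thesis by simp
qed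

section \<open>Tensor and Clifford algebras\<close>

lemma poly_mapping_sum_single: "(\<Sum>w\<in>Poly_Mapping.keys a. Poly_Mapping.single w (Poly_Mapping.lookup a w)) = a"
  by (rule poly_mapping_eqI) (simp add: lookup_sum lookup_single when_def in_keys_iff)

text \<open>Additive induction over the finite support. The case of one word keeps the membership of
  \<open>w\<close> in the keys of \<open>a\<close>, so that facts about the words of
  \<open>a\<close> stay available, whereas its coefficient is arbitrary.\<close>

lemma poly_mapping_single_induct [case_names zero single add]:
  fixes a :: "'a \<Rightarrow>\<^sub>0 'b::comm_monoid_add"
  assumes "P 0" and "\<And>w r. w \<in> Poly_Mapping.keys a \<Longrightarrow> P (Poly_Mapping.single w r)"
    and "\<And>b c. P b \<Longrightarrow> P c \<Longrightarrow> P (b + c)"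
  shows "P a"
proof -
  have "P (\<Sum>w\<in>K. Poly_Mapping.single w (Poly_Mapping.lookup a w))" if "K \<subseteq> Poly_Mapping.keys a" for K
    using finite_subset[OF that finite_keys] that
    by (induction K rule: finite_induct) (auto intro: assms)
  then show ?thesis using poly_mapping_sum_single by (metis subset_refl)
qed

lemma carrier_free_alg: "carrier (free_alg E) = {a. \<forall>w\<in>Poly_Mapping.keys a. set (letters w) \<subseteq> E}"
  and free_alg_ops: "monoid.mult (free_alg E) = (*)" "\<one>\<^bsub>free_alg E\<^esub> = 1" "\<zero>\<^bsub>free_alg E\<^esub> = 0"
    "add (free_alg E) = (+)" "r \<odot>\<^bsub>free_alg E\<^esub> a = Poly_Mapping.single 0 r * a"
  by (simp_all add: free_alg_def mult_map_scale_conv_mult)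

lemma free_alg_closed:
  "0 \<in> carrier (free_alg E)" "1 \<in> carrier (free_alg E)"
  "a \<in> carrier (free_alg E) \<Longrightarrow> b \<in> carrier (free_alg E) \<Longrightarrow> a + b \<in> carrier (free_alg E)"
  "a \<in> carrier (free_alg E) \<Longrightarrow> b \<in> carrier (free_alg E) \<Longrightarrow> a * b \<in> carrier (free_alg E)"
  "a \<in> carrier (free_alg E) \<Longrightarrow> - a \<in> carrier (free_alg E)"
proof -
  assume a: "a \<in> carrier (free_alg E)" and b: "b \<in> carrier (free_alg E)"
  then show "a + b \<in> carrier (free_alg E)" using keys_add[of a b] by (fastforce simp: carrier_free_alg)
  show "a * b \<in> carrier (free_alg E)" using keys_mult[of a b] a b
    by (fastforce simp: carrier_free_alg plus_tword_def)
qed (auto simp: carrier_free_alg keys_one zero_tword_def in_keys_iff)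

lemma single_in_free_alg: "set vs \<subseteq> E \<Longrightarrow> Poly_Mapping.single (Word vs) r \<in> carrier (free_alg E)"
  by (auto simp: carrier_free_alg)

lemma ring_free_alg: "ring (free_alg E)"
proof (rule ringI)
  show "abelian_group (free_alg E)"
  proof (rule abelian_groupI)
    show "\<And>x. x \<in> carrier (free_alg E) \<Longrightarrow> \<exists>y\<in>carrier (free_alg E). y \<oplus>\<^bsub>free_alg E\<^esub> x = \<zero>\<^bsub>free_alg E\<^esub>"
      by (rule_tac x = "- x" in bexI) (auto simp: free_alg_ops free_alg_closed)
  qed (auto simp: free_alg_ops free_alg_closed)
  show "monoid (free_alg E)"
    by (rule monoidI) (auto simp: free_alg_ops free_alg_closed mult.assoc)
qed (auto simp: free_alg_ops algebra_simps)

text \<open>Index 0 is the empty word, the unit of the monoid. Scalars are thus realised inside the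
  free algebra as central elements, which makes the product bilinear.\<close>

lemma single_zero_tword_commute:
  fixes a :: "'v tword \<Rightarrow>\<^sub>0 real"
  shows "Poly_Mapping.single 0 r * a = a * Poly_Mapping.single 0 r"
  by (induction a rule: poly_mapping_single_induct) (simp_all add: mult_single algebra_simps mult.commute)

lemma real_algebra_free_alg: "real_algebra (free_alg E)"
proof (rule real_algebra.intro[OF ring_free_alg real_algebra_axioms.intro])
  have s: "Poly_Mapping.single 0 r \<in> carrier (free_alg E)" for r
    using single_in_free_alg[of "[]"] by (simp add: zero_tword_def)
  have sm: "(Poly_Mapping.single 0 (r * t) :: 'a tword \<Rightarrow>\<^sub>0 real) = Poly_Mapping.single 0 r * Poly_Mapping.single 0 t" for r t
    by (simp add: mult_single)
  have o: "Poly_Mapping.single 0 1 * a = a" for a :: "'a tword \<Rightarrow>\<^sub>0 real"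
    using single_one[where 'a = "'a tword" and 'b = real] by (simp del: single_one)
  show "vectorspace class_ring (free_alg E)"
    by (rule vectorspace_class_ringI)
      (auto simp: free_alg_ops free_alg_closed s sm o single_add algebra_simps)
  fix a b :: "'a tword \<Rightarrow>\<^sub>0 real" and r :: real
  show "(r \<odot>\<^bsub>free_alg E\<^esub> a) \<otimes>\<^bsub>free_alg E\<^esub> b = r \<odot>\<^bsub>free_alg E\<^esub> (a \<otimes>\<^bsub>free_alg E\<^esub> b)"
    by (simp add: free_alg_ops mult.assoc)
  have "a * (Poly_Mapping.single 0 r * b) = Poly_Mapping.single 0 r * (a * b)"
    by (metis mult.assoc single_zero_tword_commute)
  then show "a \<otimes>\<^bsub>free_alg E\<^esub> (r \<odot>\<^bsub>free_alg E\<^esub> b) = r \<odot>\<^bsub>free_alg E\<^esub> (a \<otimes>\<^bsub>free_alg E\<^esub> b)"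
    by (simp add: free_alg_ops)
qed

lemma free_alg_map_add: "free_alg_map G (a + b) = free_alg_map G a + free_alg_map G b"
  unfolding free_alg_map_def
  by (rule setsum_keys_plus_distrib[where f = "\<lambda>w c. Poly_Mapping.single (Word (map G (letters w))) c"])
     (simp_all add: single_add)

lemma free_alg_map_zero: "free_alg_map G 0 = 0"
  by (simp add: free_alg_map_def)

lemma free_alg_map_single: "free_alg_map G (Poly_Mapping.single w r) = Poly_Mapping.single (Word (map G (letters w))) r"
  by (simp add: free_alg_map_def)

lemma free_alg_map_diff: "free_alg_map G (a - b) = free_alg_map G a - free_alg_map G b"
  using free_alg_map_add[of G "a - b" b] by simp

lemma free_alg_map_one: "free_alg_map G 1 = 1"
  unfolding single_one[symmetric] free_alg_map_single by (simp add: zero_tword_def)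

lemma free_alg_map_mult: "free_alg_map G (a * b) = free_alg_map G a * free_alg_map G b"
proof (induction a rule: poly_mapping_single_induct)
  case (single w r)
  show ?case
    by (induction b rule: poly_mapping_single_induct)
      (simp_all add: free_alg_map_zero free_alg_map_single free_alg_map_add mult_single distrib_left plus_tword_def)
qed (simp_all add: free_alg_map_zero free_alg_map_add distrib_right)

lemma free_alg_map_closed:
  assumes "a \<in> carrier (free_alg E)" "\<And>v. v \<in> E \<Longrightarrow> G v \<in> E'"
  shows "free_alg_map G a \<in> carrier (free_alg E')"
proof -
  have w: "set (letters w) \<subseteq> E" if "w \<in> Poly_Mapping.keys a" for w
    using assms(1) that by (auto simp: carrier_free_alg)
  show ?thesis
  proof (induction a rule: poly_mapping_single_induct)
    case (single z r)
    then show ?case using w[of z] assms(2) unfolding free_alg_map_single by (intro single_in_free_alg) auto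
  qed (simp_all add: free_alg_map_zero free_alg_map_add free_alg_closed)
qed

lemma free_alg_map_compose:
  "free_alg_map K (free_alg_map G a) = free_alg_map (\<lambda>v. K (G v)) a"
  by (induction a rule: poly_mapping_single_induct)
    (simp_all add: free_alg_map_zero free_alg_map_single free_alg_map_add comp_def)

lemma free_alg_map_cong:
  assumes "a \<in> carrier (free_alg E)" "\<And>v. v \<in> E \<Longrightarrow> G v = K v"
  shows "free_alg_map G a = free_alg_map K a"
  unfolding free_alg_map_def using assms
  by (intro sum.cong arg_cong2[of _ _ _ _ Poly_Mapping.single] refl arg_cong[of _ _ Word] map_cong)
     (auto simp: carrier_free_alg)

lemma free_alg_map_ident: "free_alg_map (\<lambda>v. v) a = a"
  unfolding free_alg_map_def by (simp add: poly_mapping_sum_single)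

lemma ring_hom_free_alg_map:
  "(\<And>v. v \<in> E \<Longrightarrow> G v \<in> E') \<Longrightarrow> free_alg_map G \<in> Ring.ring_hom (free_alg E) (free_alg E')"
  by (rule ring_hom_memI)
    (auto simp: free_alg_ops free_alg_map_add free_alg_map_mult free_alg_map_one intro: free_alg_map_closed)

section \<open>Tensor algebras\<close>

abbreviation tensor_relations :: "(real, 'v) module \<Rightarrow> ('v tword \<Rightarrow>\<^sub>0 real) set" where
  "tensor_relations M \<equiv> {Poly_Mapping.single (Word [r \<odot>\<^bsub>M\<^esub> v \<oplus>\<^bsub>M\<^esub> s \<odot>\<^bsub>M\<^esub> w]) 1
        - Poly_Mapping.single (Word [v]) r - Poly_Mapping.single (Word [w]) s
      | r s v w. v \<in> carrier M \<and> w \<in> carrier M}"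

lemma tensor_relations_subset:
  assumes "vectorspace class_ring M"
  shows "tensor_relations M \<subseteq> carrier (free_alg (carrier M))"
proof
  fix a assume "a \<in> tensor_relations M"
  then obtain r s v w where vw: "v \<in> carrier M" "w \<in> carrier M" and
    a: "a = Poly_Mapping.single (Word [r \<odot>\<^bsub>M\<^esub> v \<oplus>\<^bsub>M\<^esub> s \<odot>\<^bsub>M\<^esub> w]) 1 + (- Poly_Mapping.single (Word [v]) r) + (- Poly_Mapping.single (Word [w]) s)"
    by auto
  have "r \<odot>\<^bsub>M\<^esub> v \<oplus>\<^bsub>M\<^esub> s \<odot>\<^bsub>M\<^esub> w \<in> carrier M"
    using assms vw by (simp add: vectorspace_smult_closed vectorspace_add_closed)
  then show "a \<in> carrier (free_alg (carrier M))"
    unfolding a using vw by (intro free_alg_closed single_in_free_alg) auto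
qed

lemma ideal_tensor_ideal:
  "vectorspace class_ring M \<Longrightarrow> ideal (tensor_ideal M) (free_alg (carrier M))"
  unfolding tensor_ideal_def by (rule ring.genideal_ideal[OF ring_free_alg tensor_relations_subset])

text \<open>Linearity of \<open>G\<close> turns the relation for \<open>r\<close>, \<open>s\<close>,
  \<open>v\<close>, \<open>w\<close> into the relation for \<open>r\<close>, \<open>s\<close>,
  \<open>G v\<close>, \<open>G w\<close>; the inclusion of generators extends to the generated
  ideals.\<close>

lemma free_alg_map_tensor_ideal:
  assumes "linear_map class_ring M N G"
  shows "free_alg_map G ` tensor_ideal M \<subseteq> tensor_ideal N"
  unfolding tensor_ideal_def[of M]
proof (rule ring_hom_genideal_subset[OF ring_free_alg ring_free_alg])
  note G = linear_map_class_ringD[OF assms]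
  show "free_alg_map G \<in> Ring.ring_hom (free_alg (carrier M)) (free_alg (carrier N))"
    by (rule ring_hom_free_alg_map) (rule G)
  show "tensor_relations M \<subseteq> carrier (free_alg (carrier M))" using G(1) by (rule tensor_relations_subset)
  show "ideal (tensor_ideal N) (free_alg (carrier N))" using G(2) by (rule ideal_tensor_ideal)
  have "free_alg_map G ` tensor_relations M \<subseteq> tensor_relations N"
  proof
    fix a assume "a \<in> free_alg_map G ` tensor_relations M"
    then obtain r s v w where vw: "v \<in> carrier M" "w \<in> carrier M" and
      a: "a = free_alg_map G (Poly_Mapping.single (Word [r \<odot>\<^bsub>M\<^esub> v \<oplus>\<^bsub>M\<^esub> s \<odot>\<^bsub>M\<^esub> w]) 1
        - Poly_Mapping.single (Word [v]) r - Poly_Mapping.single (Word [w]) s)" by blast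
    have "G (r \<odot>\<^bsub>M\<^esub> v \<oplus>\<^bsub>M\<^esub> s \<odot>\<^bsub>M\<^esub> w) = r \<odot>\<^bsub>N\<^esub> G v \<oplus>\<^bsub>N\<^esub> s \<odot>\<^bsub>N\<^esub> G w"
      using vw by (simp add: G vectorspace_smult_closed[OF G(1)])
    then have "a = Poly_Mapping.single (Word [r \<odot>\<^bsub>N\<^esub> G v \<oplus>\<^bsub>N\<^esub> s \<odot>\<^bsub>N\<^esub> G w]) 1
        - Poly_Mapping.single (Word [G v]) r - Poly_Mapping.single (Word [G w]) s"
      by (simp add: a free_alg_map_diff free_alg_map_single)
    then show "a \<in> tensor_relations N" using G(3) vw by blast
  qed
  moreover have "tensor_relations N \<subseteq> tensor_ideal N"
    unfolding tensor_ideal_def by (rule ring.genideal_self[OF ring_free_alg tensor_relations_subset[OF G(2)]])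
  ultimately show "free_alg_map G ` tensor_relations M \<subseteq> tensor_ideal N" by blast
qed

lemma real_algebra_tensor_algebra: "vectorspace class_ring M \<Longrightarrow> real_algebra (tensor_algebra M)"
  unfolding tensor_algebra_def
  by (rule real_algebra.real_algebra_alg_quot[OF real_algebra_free_alg ideal_tensor_ideal])

text \<open>Later computations take place in the free algebra and pass to classes through these
  rules.\<close>

lemma
  assumes M: "vectorspace class_ring M"
  shows carrier_tensor_algebra: "carrier (tensor_algebra M) = tensor_class M ` carrier (free_alg (carrier M))"
    and tensor_class_zero: "\<zero>\<^bsub>tensor_algebra M\<^esub> = tensor_class M 0"
    and tensor_class_one: "\<one>\<^bsub>tensor_algebra M\<^esub> = tensor_class M 1"
    and tensor_class_add: "\<And>a b. a \<in> carrier (free_alg (carrier M)) \<Longrightarrow> b \<in> carrier (free_alg (carrier M)) \<Longrightarrow>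
      tensor_class M a \<oplus>\<^bsub>tensor_algebra M\<^esub> tensor_class M b = tensor_class M (a + b)"
    and tensor_class_mult: "\<And>a b. a \<in> carrier (free_alg (carrier M)) \<Longrightarrow> b \<in> carrier (free_alg (carrier M)) \<Longrightarrow>
      tensor_class M a \<otimes>\<^bsub>tensor_algebra M\<^esub> tensor_class M b = tensor_class M (a * b)"
    and tensor_class_smult: "\<And>a. a \<in> carrier (free_alg (carrier M)) \<Longrightarrow>
      r \<odot>\<^bsub>tensor_algebra M\<^esub> tensor_class M a = tensor_class M (Poly_Mapping.single 0 r * a)"
proof -
  note I = ideal_tensor_ideal[OF M] and A = real_algebra_free_alg[of "carrier M"]
  note q = real_algebra.carrier_alg_quot[OF A I] real_algebra.zero_alg_quot[OF A I] real_algebra.one_alg_quot[OF A I]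
    real_algebra.add_alg_quot[OF A I] real_algebra.mult_alg_quot[OF A I] real_algebra.smult_alg_quot[OF A I]
  note q' = q[unfolded free_alg_ops, folded tensor_algebra_def tensor_class_def]
  show "carrier (tensor_algebra M) = tensor_class M ` carrier (free_alg (carrier M))"
    "\<zero>\<^bsub>tensor_algebra M\<^esub> = tensor_class M 0" "\<one>\<^bsub>tensor_algebra M\<^esub> = tensor_class M 1"
    using q' by (simp_all add: tensor_class_def[abs_def])
  show "\<And>a b. a \<in> carrier (free_alg (carrier M)) \<Longrightarrow> b \<in> carrier (free_alg (carrier M)) \<Longrightarrow>
      tensor_class M a \<oplus>\<^bsub>tensor_algebra M\<^esub> tensor_class M b = tensor_class M (a + b)"
    "\<And>a b. a \<in> carrier (free_alg (carrier M)) \<Longrightarrow> b \<in> carrier (free_alg (carrier M)) \<Longrightarrow>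
      tensor_class M a \<otimes>\<^bsub>tensor_algebra M\<^esub> tensor_class M b = tensor_class M (a * b)"
    "\<And>a. a \<in> carrier (free_alg (carrier M)) \<Longrightarrow>
      r \<odot>\<^bsub>tensor_algebra M\<^esub> tensor_class M a = tensor_class M (Poly_Mapping.single 0 r * a)"
    by (rule q'; assumption)+
qed

lemma tensor_algebra_map_class:
  assumes G: "linear_map class_ring M N G" and a: "a \<in> carrier (free_alg (carrier M))"
  shows "tensor_algebra_map N G (tensor_class M a) = tensor_class N (free_alg_map G a)"
  unfolding tensor_algebra_map_def tensor_class_def
proof (rule the_elem_coset_image[OF ring_free_alg _ ring_free_alg _ _ free_alg_map_tensor_ideal[OF G] a])
  show "free_alg_map G \<in> Ring.ring_hom (free_alg (carrier M)) (free_alg (carrier N))"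
    by (rule ring_hom_free_alg_map) (rule linear_map_class_ringD[OF G])
qed (use linear_map_class_ringD(1,2)[OF G] in \<open>auto intro: ideal_tensor_ideal\<close>)

lemma tensor_class_closed:
  "vectorspace class_ring M \<Longrightarrow> a \<in> carrier (free_alg (carrier M)) \<Longrightarrow> tensor_class M a \<in> carrier (tensor_algebra M)"
  by (simp add: carrier_tensor_algebra)

lemma ring_hom_tensor_algebra_map:
  assumes "linear_map class_ring M N G"
  shows "tensor_algebra_map N G \<in> Ring.ring_hom (tensor_algebra M) (tensor_algebra N)"
proof -
  note G = linear_map_class_ringD[OF assms]
  note tm = tensor_algebra_map_class[OF assms]
  have c: "free_alg_map G a \<in> carrier (free_alg (carrier N))" if "a \<in> carrier (free_alg (carrier M))" for a
    using that G(3) by (rule free_alg_map_closed)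
  show ?thesis
  proof (rule ring_hom_memI)
    fix x y assume "x \<in> carrier (tensor_algebra M)" "y \<in> carrier (tensor_algebra M)"
    then obtain a b where ab: "a \<in> carrier (free_alg (carrier M))" "b \<in> carrier (free_alg (carrier M))"
      and xy: "x = tensor_class M a" "y = tensor_class M b"
      by (auto simp: carrier_tensor_algebra[OF G(1)])
    show "tensor_algebra_map N G (x \<otimes>\<^bsub>tensor_algebra M\<^esub> y) = tensor_algebra_map N G x \<otimes>\<^bsub>tensor_algebra N\<^esub> tensor_algebra_map N G y"
      "tensor_algebra_map N G (x \<oplus>\<^bsub>tensor_algebra M\<^esub> y) = tensor_algebra_map N G x \<oplus>\<^bsub>tensor_algebra N\<^esub> tensor_algebra_map N G y"
      using ab by (simp_all add: xy tm c tensor_class_mult[OF G(1)] tensor_class_mult[OF G(2)]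
        tensor_class_add[OF G(1)] tensor_class_add[OF G(2)] free_alg_closed free_alg_map_mult free_alg_map_add)
  next
    fix x assume "x \<in> carrier (tensor_algebra M)"
    then show "tensor_algebra_map N G x \<in> carrier (tensor_algebra N)"
      using c tensor_class_closed[OF G(2)] by (auto simp: carrier_tensor_algebra[OF G(1)] tm)
  next
    show "tensor_algebra_map N G \<one>\<^bsub>tensor_algebra M\<^esub> = \<one>\<^bsub>tensor_algebra N\<^esub>"
      by (simp add: tensor_class_one[OF G(1)] tensor_class_one[OF G(2)] tm free_alg_closed free_alg_map_one)
  qed
qed

section \<open>Clifford algebras\<close>

abbreviation clifford_relations ::
    "(real, 'v) module \<Rightarrow> ('v \<Rightarrow> 'v \<Rightarrow> real) \<Rightarrow> ('v tword \<Rightarrow>\<^sub>0 real) set set" where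
  "clifford_relations M b \<equiv> {tensor_of M [v] \<otimes>\<^bsub>tensor_algebra M\<^esub> tensor_of M [w]
        \<oplus>\<^bsub>tensor_algebra M\<^esub> tensor_of M [w] \<otimes>\<^bsub>tensor_algebra M\<^esub> tensor_of M [v]
        \<oplus>\<^bsub>tensor_algebra M\<^esub> (2 * b v w) \<odot>\<^bsub>tensor_algebra M\<^esub> \<one>\<^bsub>tensor_algebra M\<^esub>
      | v w. v \<in> carrier M \<and> w \<in> carrier M}"

text \<open>A lift of the Clifford relation to the free algebra; the last summand is a multiple of
  the empty word, hence of the unit. With it the generators of the Clifford ideal are classes of
  explicit elements.\<close>

definition clifford_relator :: "('v \<Rightarrow> 'v \<Rightarrow> real) \<Rightarrow> 'v \<Rightarrow> 'v \<Rightarrow> ('v tword \<Rightarrow>\<^sub>0 real)" where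
  "clifford_relator b v w = Poly_Mapping.single (Word [v, w]) 1 + Poly_Mapping.single (Word [w, v]) 1
     + Poly_Mapping.single 0 (2 * b v w)"

lemma clifford_relator_closed:
  "v \<in> E \<Longrightarrow> w \<in> E \<Longrightarrow> clifford_relator b v w \<in> carrier (free_alg E)"
  unfolding clifford_relator_def zero_tword_def by (intro free_alg_closed single_in_free_alg) auto

lemma clifford_relations_eq:
  assumes M: "vectorspace class_ring M"
  shows "clifford_relations M b = {tensor_class M (clifford_relator b v w) | v w. v \<in> carrier M \<and> w \<in> carrier M}"
proof -
  have "tensor_of M [v] \<otimes>\<^bsub>tensor_algebra M\<^esub> tensor_of M [w]
        \<oplus>\<^bsub>tensor_algebra M\<^esub> tensor_of M [w] \<otimes>\<^bsub>tensor_algebra M\<^esub> tensor_of M [v]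
        \<oplus>\<^bsub>tensor_algebra M\<^esub> (2 * b v w) \<odot>\<^bsub>tensor_algebra M\<^esub> \<one>\<^bsub>tensor_algebra M\<^esub> =
      tensor_class M (clifford_relator b v w)" if "v \<in> carrier M" "w \<in> carrier M" for v w
    using that
    by (simp add: tensor_of_def tensor_class_mult[OF M] tensor_class_add[OF M] tensor_class_one[OF M]
      tensor_class_smult[OF M] free_alg_closed single_in_free_alg mult_single plus_tword_def clifford_relator_def
      zero_tword_def)
  then show ?thesis by (intro Collect_cong iffI; elim exE conjE; metis)
qed

lemma clifford_relations_subset:
  "vectorspace class_ring M \<Longrightarrow> clifford_relations M b \<subseteq> carrier (tensor_algebra M)"
  unfolding clifford_relations_eq using clifford_relator_closed by (auto intro!: tensor_class_closed)

lemma ring_tensor_algebra: "vectorspace class_ring M \<Longrightarrow> ring (tensor_algebra M)"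
  using real_algebra.axioms(1) real_algebra_tensor_algebra by blast

lemma ideal_clifford_ideal:
  "vectorspace class_ring M \<Longrightarrow> ideal (clifford_ideal M b) (tensor_algebra M)"
  unfolding clifford_ideal_def Let_def
  by (rule ring.genideal_ideal[OF ring_tensor_algebra clifford_relations_subset])

text \<open>A map preserving the forms sends the relator of \<open>v\<close>, \<open>w\<close> to
  the relator of \<open>G v\<close>, \<open>G w\<close>, because the constant term is the same on
  both sides.\<close>

lemma tensor_algebra_map_clifford_ideal:
  assumes lin: "linear_map class_ring M N G"
    and b: "\<And>v w. v \<in> carrier M \<Longrightarrow> w \<in> carrier M \<Longrightarrow> b v w = b' (G v) (G w)"
  shows "tensor_algebra_map N G ` clifford_ideal M b \<subseteq> clifford_ideal N b'"
proof -
  note G = linear_map_class_ringD[OF lin]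
  have "tensor_algebra_map N G ` clifford_relations M b \<subseteq> clifford_relations N b'"
  proof
    fix x assume "x \<in> tensor_algebra_map N G ` clifford_relations M b"
    then obtain v w where vw: "v \<in> carrier M" "w \<in> carrier M"
      and x: "x = tensor_algebra_map N G (tensor_class M (clifford_relator b v w))"
      unfolding clifford_relations_eq[OF G(1)] by blast
    have "x = tensor_class N (free_alg_map G (clifford_relator b v w))"
      unfolding x using lin clifford_relator_closed[OF vw] by (rule tensor_algebra_map_class)
    also have "free_alg_map G (clifford_relator b v w) = clifford_relator b' (G v) (G w)"
      unfolding clifford_relator_def by (simp add: free_alg_map_add free_alg_map_single b[OF vw] zero_tword_def)
    finally show "x \<in> clifford_relations N b'" unfolding clifford_relations_eq[OF G(2)] using G(3) vw by blast
  qed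
  moreover have "clifford_relations N b' \<subseteq> clifford_ideal N b'"
    unfolding clifford_ideal_def Let_def
    by (rule ring.genideal_self[OF ring_tensor_algebra clifford_relations_subset]) (rule G)+
  ultimately have "tensor_algebra_map N G ` clifford_relations M b \<subseteq> clifford_ideal N b'" by blast
  then show ?thesis
    unfolding clifford_ideal_def[of M] Let_def
    by (rule ring_hom_genideal_subset[OF ring_tensor_algebra[OF G(1)] ring_tensor_algebra[OF G(2)]
        ring_hom_tensor_algebra_map[OF lin] clifford_relations_subset[OF G(1)] ideal_clifford_ideal[OF G(2)]])
qed

text \<open>Both quotients at once. Every Clifford element has such a representative in the free
  algebra, and there induced maps act on letters.\<close>

definition clifford_of :: "(real, 'v) module \<Rightarrow> ('v \<Rightarrow> 'v \<Rightarrow> real) \<Rightarrow> ('v tword \<Rightarrow>\<^sub>0 real) \<Rightarrow>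
    ('v tword \<Rightarrow>\<^sub>0 real) set set" where
  "clifford_of M b a = clifford_class M b (tensor_class M a)"

lemma clifford_algebra_map_of:
  assumes G: "linear_map class_ring M N G"
    and b: "\<And>v w. v \<in> carrier M \<Longrightarrow> w \<in> carrier M \<Longrightarrow> b v w = b' (G v) (G w)"
    and a: "a \<in> carrier (free_alg (carrier M))"
  shows "clifford_algebra_map N b' G (clifford_of M b a) = clifford_of N b' (free_alg_map G a)"
proof -
  have "clifford_algebra_map N b' G (clifford_of M b a) =
      clifford_class N b' (tensor_algebra_map N G (tensor_class M a))"
    unfolding clifford_algebra_map_def clifford_of_def clifford_class_def
  proof (rule the_elem_coset_image)
    show "tensor_algebra_map N G ` clifford_ideal M b \<subseteq> clifford_ideal N b'"
      using G b by (rule tensor_algebra_map_clifford_ideal)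
  qed (use linear_map_class_ringD(1,2)[OF G] a in \<open>simp_all add: ring_tensor_algebra ideal_clifford_ideal
      ring_hom_tensor_algebra_map[OF G] tensor_class_closed\<close>)
  then show ?thesis by (simp add: clifford_of_def tensor_algebra_map_class[OF G a])
qed

text \<open>An inverse of \<open>G\<close> need not be given as a map on all of \<open>N\<close>, so that injectivity is
  obtained from an inverse on generators.\<close>

lemma clifford_of_free_alg_map_inj:
  assumes G: "linear_map class_ring M N G" and inj: "inj_on G (carrier M)" and surj: "G ` carrier M = carrier N"
    and b: "\<And>v w. v \<in> carrier M \<Longrightarrow> w \<in> carrier M \<Longrightarrow> b v w = b' (G v) (G w)"
    and a: "a \<in> carrier (free_alg (carrier M))" "c \<in> carrier (free_alg (carrier M))"
    and eq: "clifford_of N b' (free_alg_map G a) = clifford_of N b' (free_alg_map G c)"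
  shows "clifford_of M b a = clifford_of M b c"
proof -
  note G' = linear_map_class_ringD[OF G]
  let ?K = "inv_into (carrier M) G"
  have KG: "?K (G v) = v" if "v \<in> carrier M" for v using inj that by simp
  have K: "linear_map class_ring N M ?K"
  proof (rule linear_map_class_ringI[OF G'(2,1)], unfold surj[symmetric])
    fix v w r assume "v \<in> G ` carrier M" "w \<in> G ` carrier M"
    then obtain v' w' where v: "v' \<in> carrier M" "v = G v'" and w: "w' \<in> carrier M" "w = G w'" by blast
    show "?K (v \<oplus>\<^bsub>N\<^esub> w) = ?K v \<oplus>\<^bsub>M\<^esub> ?K w"
      using v w KG vectorspace_add_closed[OF G'(1)] by (simp flip: G'(4))
  next
    fix v r assume "v \<in> G ` carrier M"
    then obtain v' where v: "v' \<in> carrier M" "v = G v'" by blast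
    show "?K (r \<odot>\<^bsub>N\<^esub> v) = r \<odot>\<^bsub>M\<^esub> ?K v" using v KG vectorspace_smult_closed[OF G'(1)] by (simp flip: G'(5))
    show "?K v \<in> carrier M" using v KG by simp
  qed
  \<comment> \<open>\<open>?K\<close> preserves the forms because \<open>G\<close> does. The map it
    induces undoes the one induced by \<open>G\<close> on classes, since it does so letter by letter
    on representatives.\<close>
  have "clifford_algebra_map M b ?K (clifford_of N b' (free_alg_map G a)) = clifford_of M b a"
    if a: "a \<in> carrier (free_alg (carrier M))" for a
  proof -
    have "clifford_algebra_map M b ?K (clifford_of N b' (free_alg_map G a)) =
        clifford_of M b (free_alg_map ?K (free_alg_map G a))"
      using K
    proof (rule clifford_algebra_map_of)
      show "b' v w = b (?K v) (?K w)" if "v \<in> carrier N" "w \<in> carrier N" for v w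
        using that b KG by (auto simp flip: surj)
      show "free_alg_map G a \<in> carrier (free_alg (carrier N))" using a G'(3) by (rule free_alg_map_closed)
    qed
    also have "free_alg_map ?K (free_alg_map G a) = a"
      unfolding free_alg_map_compose using free_alg_map_cong[OF a, of _ "\<lambda>v. v"] KG
      by (simp add: free_alg_map_ident)
    finally show ?thesis .
  qed
  from this[OF a(1)] this[OF a(2)] eq show ?thesis by metis
qed
section \<open>Plots of tensor and Clifford algebra bundles\<close>

text \<open>A diffeology without the locality axiom. The dual diffeology is used only in this weaker sense.\<close>

locale plot_system =
  fixes D :: "'a diffsp"
  assumes plot_open: "plot D n U p \<Longrightarrow> openin (Euclidean_space n) U"
    and plot_range: "plot D n U p \<Longrightarrow> p ` U \<subseteq> points D"
    and plot_cong: "plot D n U p \<Longrightarrow> (\<And>u. u \<in> U \<Longrightarrow> q u = p u) \<Longrightarrow> plot D n U q"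
    and plot_const: "openin (Euclidean_space n) U \<Longrightarrow> x \<in> points D \<Longrightarrow> plot D n U (\<lambda>_. x)"
    and plot_comp: "plot D n U p \<Longrightarrow> openin (Euclidean_space m) W \<Longrightarrow> Cinf_map m W n U F \<Longrightarrow>
      plot D m W (\<lambda>w. p (F w))"
begin

lemma plot_restrict: "plot D n U p \<Longrightarrow> openin (Euclidean_space n) W \<Longrightarrow> W \<subseteq> U \<Longrightarrow> plot D n W p"
  using plot_comp[of n U p n W "\<lambda>x. x"] Cinf_map_id by blast

lemma plot_in_points: "plot D n U p \<Longrightarrow> u \<in> U \<Longrightarrow> p u \<in> points D"
  using plot_range by blast

end

sublocale diffeological_space \<subseteq> plot_system
  by unfold_locales (fact plot_open plot_range plot_cong plot_const plot_comp)+

lemma smooth_mapD: "smooth_map D E f \<Longrightarrow> plot D n U p \<Longrightarrow> plot E n U (\<lambda>u. f (p u))"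
  by (simp add: smooth_map_def)

section \<open>Pseudo-bundles and families of vector spaces\<close>

context pseudo_bundle
begin

lemma add_plot:
  assumes p: "plot (total_sp V) n U p" and q: "plot (total_sp V) n U q"
    and pq: "\<And>u. u \<in> U \<Longrightarrow> prj V (p u) = prj V (q u)"
  shows "plot (total_sp V) n U (\<lambda>u. p u \<oplus>\<^bsub>fib V (prj V (p u))\<^esub> q u)"
proof -
  have "plot (sub_diff (prod_diff (total_sp V) (total_sp V)) {(v, w). prj V v = prj V w}) n U (\<lambda>u. (p u, q u))"
    using p q pq by (auto simp: sub_diff_def prod_diff_def)
  from smooth_mapD[OF add_smooth this] show ?thesis by simp
qed

lemma smult_plot:
  assumes p: "plot (total_sp V) n U p" and c: "Cinf_on n U c"
  shows "plot (total_sp V) n U (\<lambda>u. c u \<odot>\<^bsub>fib V (prj V (p u))\<^esub> p u)"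
proof -
  have "openin (Euclidean_space n) U" using total_diffeology p by (rule diffeological_space.plot_open)
  then have "plot (prod_diff real_diff (total_sp V)) n U (\<lambda>u. (c u, p u))"
    using p c by (auto simp: prod_diff_def real_diff_def)
  from smooth_mapD[OF smult_smooth this] show ?thesis by simp
qed

lemma zero_plot: "plot (base_sp V) n U x \<Longrightarrow> plot (total_sp V) n U (\<lambda>u. \<zero>\<^bsub>fib V (x u)\<^esub>)"
  using smooth_mapD[OF zero_smooth] by blast

end

text \<open>The common ground of pseudo-bundles, their duals and glued families, each of which is
  shown to be an instance. The base carries a full diffeology, since base plots are assembled from
  local pieces.\<close>

locale vector_family =
  fixes V :: "('x, 'v) bundle_data"
  assumes base_diffeology: "diffeological_space (base_sp V)"
    and total_plots: "plot_system (total_sp V)"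
    and prj_smooth: "smooth_map (total_sp V) (base_sp V) (prj V)"
    and fib_carrier: "x \<in> points (base_sp V) \<Longrightarrow> carrier (fib V x) = over V {x}"
    and fib_vectorspace: "x \<in> points (base_sp V) \<Longrightarrow> vectorspace class_ring (fib V x)"
begin

sublocale base: diffeological_space "base_sp V"
  by (rule base_diffeology)

sublocale total: plot_system "total_sp V"
  by (rule total_plots)

lemma prj_in_base: "v \<in> points (total_sp V) \<Longrightarrow> prj V v \<in> points (base_sp V)"
  using prj_smooth by (auto simp: smooth_map_def)

lemma in_fib_iff: "x \<in> points (base_sp V) \<Longrightarrow> v \<in> carrier (fib V x) \<longleftrightarrow> v \<in> points (total_sp V) \<and> prj V v = x"
  by (simp add: fib_carrier over_def)

end

lemma (in diffeological_space) plot_system: "plot_system D"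
  by unfold_locales

lemma (in pseudo_bundle) vector_family: "vector_family V"
  using base_diffeology diffeological_space.plot_system[OF total_diffeology] prj_smooth fib_carrier
    fib_vectorspace by (rule vector_family.intro)

section \<open>Formal sums with smooth coefficients\<close>

text \<open>Terms are kept as lists of functions, not as elements of the free algebra depending on a parameter:
  letters that collide or coefficients that vanish at some parameter leave the list unchanged.\<close>

type_synonym 'v formal_terms = "(((nat \<Rightarrow> real) \<Rightarrow> real) \<times> ((nat \<Rightarrow> real) \<Rightarrow> 'v) list) list"

definition formal_sum :: "'v formal_terms \<Rightarrow> (nat \<Rightarrow> real) \<Rightarrow> ('v tword \<Rightarrow>\<^sub>0 real)" where
  "formal_sum ts u = (\<Sum>(c, vs)\<leftarrow>ts. Poly_Mapping.single (Word (map (\<lambda>v. v u) vs)) (c u))"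

text \<open>The base plot is recorded separately: an empty list of terms, or a list of multiples of
  the empty word, does not determine a base point.\<close>

definition formal_plot ::
    "('x, 'v) bundle_data \<Rightarrow> nat \<Rightarrow> (nat \<Rightarrow> real) set \<Rightarrow> ((nat \<Rightarrow> real) \<Rightarrow> 'x) \<Rightarrow> 'v formal_terms \<Rightarrow> bool" where
  "formal_plot V n W x ts \<longleftrightarrow> plot (base_sp V) n W x \<and>
     (\<forall>(c, vs)\<in>set ts. Cinf_on n W c \<and>
       (\<forall>v\<in>set vs. plot (total_sp V) n W v \<and> (\<forall>w\<in>W. prj V (v w) = x w)))"

text \<open>\<open>Q\<close> constrains the lengths of words and \<open>K\<close> passes to classes,
  so one notion serves tensor powers (\<open>Q\<close> fixes the length to \<open>r\<close>), tensor
  algebras and Clifford algebras (\<open>Q\<close> always true).\<close>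

definition formal_class_plot ::
    "('x, 'v) bundle_data \<Rightarrow> (nat \<Rightarrow> bool) \<Rightarrow> ('x \<Rightarrow> ('v tword \<Rightarrow>\<^sub>0 real) \<Rightarrow> 'c) \<Rightarrow>
     nat \<Rightarrow> (nat \<Rightarrow> real) set \<Rightarrow> ((nat \<Rightarrow> real) \<Rightarrow> 'x \<times> 'c) \<Rightarrow> bool" where
  "formal_class_plot V Q K n U p \<longleftrightarrow> openin (Euclidean_space n) U \<and>
     (\<forall>u\<in>U. \<exists>W x ts. openin (Euclidean_space n) W \<and> u \<in> W \<and> W \<subseteq> U \<and> formal_plot V n W x ts \<and>
        (\<forall>(c, vs)\<in>set ts. Q (length vs)) \<and> (\<forall>w\<in>W. p w = (x w, K (x w) (formal_sum ts w))))"

lemma formal_class_plotE: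
  assumes "formal_class_plot V Q K n U p" "u \<in> U"
  obtains W x ts where "openin (Euclidean_space n) W" "u \<in> W" "W \<subseteq> U" "formal_plot V n W x ts"
    "\<And>c vs. (c, vs) \<in> set ts \<Longrightarrow> Q (length vs)" "\<And>w. w \<in> W \<Longrightarrow> p w = (x w, K (x w) (formal_sum ts w))"
proof -
  obtain W x ts where W: "openin (Euclidean_space n) W" "u \<in> W" "W \<subseteq> U" "formal_plot V n W x ts"
    "\<forall>(c, vs)\<in>set ts. Q (length vs)" "\<forall>w\<in>W. p w = (x w, K (x w) (formal_sum ts w))"
    using assms unfolding formal_class_plot_def by blast
  from W(5) have "Q (length vs)" if "(c, vs) \<in> set ts" for c vs using that by auto
  then show ?thesis using that[OF W(1-4)] W(6) by blast
qed

lemma formal_class_plotI: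
  assumes "openin (Euclidean_space n) W" "formal_plot V n W x ts"
    "\<And>c vs. (c, vs) \<in> set ts \<Longrightarrow> Q (length vs)" "\<And>w. w \<in> W \<Longrightarrow> p w = (x w, K (x w) (formal_sum ts w))"
  shows "formal_class_plot V Q K n W p"
  unfolding formal_class_plot_def
proof (intro conjI ballI)
  fix u assume "u \<in> W"
  then show "\<exists>W' x ts. openin (Euclidean_space n) W' \<and> u \<in> W' \<and> W' \<subseteq> W \<and> formal_plot V n W' x ts \<and>
        (\<forall>(c, vs)\<in>set ts. Q (length vs)) \<and> (\<forall>w\<in>W'. p w = (x w, K (x w) (formal_sum ts w)))"
    using assms by (intro exI[of _ W] exI[of _ x] exI[of _ ts]) auto
qed (fact assms)

lemma formal_class_plot_open: "formal_class_plot V Q K n U p \<Longrightarrow> openin (Euclidean_space n) U"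
  by (simp add: formal_class_plot_def)

lemma formal_class_plot_local:
  assumes "openin (Euclidean_space n) U"
    "\<And>u. u \<in> U \<Longrightarrow> \<exists>W. openin (Euclidean_space n) W \<and> u \<in> W \<and> W \<subseteq> U \<and> formal_class_plot V Q K n W p"
  shows "formal_class_plot V Q K n U p"
  unfolding formal_class_plot_def
proof (intro conjI ballI)
  fix u assume "u \<in> U"
  then obtain W where W: "u \<in> W" "W \<subseteq> U" "formal_class_plot V Q K n W p" using assms(2) by blast
  then obtain W' x ts where "openin (Euclidean_space n) W'" "u \<in> W'" "W' \<subseteq> W" "formal_plot V n W' x ts"
    "\<forall>(c, vs)\<in>set ts. Q (length vs)" "\<forall>w\<in>W'. p w = (x w, K (x w) (formal_sum ts w))"
    unfolding formal_class_plot_def by blast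
  with W(2) show "\<exists>W x ts. openin (Euclidean_space n) W \<and> u \<in> W \<and> W \<subseteq> U \<and> formal_plot V n W x ts \<and>
        (\<forall>(c, vs)\<in>set ts. Q (length vs)) \<and> (\<forall>w\<in>W. p w = (x w, K (x w) (formal_sum ts w)))" by blast
qed (fact assms)

lemma formal_class_plot_cong:
  assumes p: "formal_class_plot V Q K n U p" and eq: "\<And>u. u \<in> U \<Longrightarrow> q u = p u"
  shows "formal_class_plot V Q K n U q"
proof (rule formal_class_plot_local[OF formal_class_plot_open[OF p]])
  fix u assume u: "u \<in> U"
  obtain W x ts where W: "openin (Euclidean_space n) W" "u \<in> W" "W \<subseteq> U" "formal_plot V n W x ts"
    "\<And>c vs. (c, vs) \<in> set ts \<Longrightarrow> Q (length vs)" "\<And>w. w \<in> W \<Longrightarrow> p w = (x w, K (x w) (formal_sum ts w))"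
    by (rule formal_class_plotE[OF p u]) blast
  have "formal_class_plot V Q K n W q"
    using W(1,4,5) by (rule formal_class_plotI) (use W(3,6) eq in auto)
  with W(1-3) show "\<exists>W. openin (Euclidean_space n) W \<and> u \<in> W \<and> W \<subseteq> U \<and> formal_class_plot V Q K n W q"
    by blast
qed

lemma formal_plotD:
  assumes "formal_plot V n W x ts"
  shows "plot (base_sp V) n W x" "(c, vs) \<in> set ts \<Longrightarrow> Cinf_on n W c"
    "(c, vs) \<in> set ts \<Longrightarrow> v \<in> set vs \<Longrightarrow> plot (total_sp V) n W v"
    "(c, vs) \<in> set ts \<Longrightarrow> v \<in> set vs \<Longrightarrow> w \<in> W \<Longrightarrow> prj V (v w) = x w"
proof -
  have *: "\<forall>(c, vs)\<in>set ts. Cinf_on n W c \<and>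
       (\<forall>v\<in>set vs. plot (total_sp V) n W v \<and> (\<forall>w\<in>W. prj V (v w) = x w))"
    using assms by (simp add: formal_plot_def)
  show "plot (base_sp V) n W x" using assms by (simp add: formal_plot_def)
  show "(c, vs) \<in> set ts \<Longrightarrow> Cinf_on n W c" using bspec[OF *] by blast
  show "(c, vs) \<in> set ts \<Longrightarrow> v \<in> set vs \<Longrightarrow> plot (total_sp V) n W v" using bspec[OF *] by blast
  show "(c, vs) \<in> set ts \<Longrightarrow> v \<in> set vs \<Longrightarrow> w \<in> W \<Longrightarrow> prj V (v w) = x w" using bspec[OF *] by blast
qed

lemma formal_plotI:
  assumes "plot (base_sp V) n W x" "\<And>c vs. (c, vs) \<in> set ts \<Longrightarrow> Cinf_on n W c"
    "\<And>c vs v. (c, vs) \<in> set ts \<Longrightarrow> v \<in> set vs \<Longrightarrow> plot (total_sp V) n W v"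
    "\<And>c vs v w. (c, vs) \<in> set ts \<Longrightarrow> v \<in> set vs \<Longrightarrow> w \<in> W \<Longrightarrow> prj V (v w) = x w"
  shows "formal_plot V n W x ts"
  unfolding formal_plot_def
proof (intro conjI ballI)
  fix t assume t: "t \<in> set ts"
  obtain c vs where "t = (c, vs)" by (cases t)
  then show "case t of (c, vs) \<Rightarrow> Cinf_on n W c \<and>
       (\<forall>v\<in>set vs. plot (total_sp V) n W v \<and> (\<forall>w\<in>W. prj V (v w) = x w))"
    using assms(2-4)[of c vs] t by simp
qed (fact assms)

lemma formal_sum_simps [simp]:
  "formal_sum [] u = 0"
  "formal_sum ((c, vs) # ts) u = Poly_Mapping.single (Word (map (\<lambda>v. v u) vs)) (c u) + formal_sum ts u"
  "formal_sum (ts @ ts') u = formal_sum ts u + formal_sum ts' u"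
  by (simp_all add: formal_sum_def)

lemma formal_sum_concat: "formal_sum (concat tss) u = (\<Sum>ts\<leftarrow>tss. formal_sum ts u)"
  by (induction tss) simp_all

lemma formal_sum_map:
  "formal_sum (map (\<lambda>(c, vs). (\<lambda>w. c (F w), map (\<lambda>v w. v (F w)) vs)) ts) w = formal_sum ts (F w)"
  by (induction ts) (auto simp: comp_def)

lemma free_alg_map_formal_sum:
  "free_alg_map G (formal_sum ts u) = formal_sum (map (\<lambda>(c, vs). (c, map (\<lambda>v u. G (v u)) vs)) ts) u"
  by (induction ts) (auto simp: free_alg_map_zero free_alg_map_add free_alg_map_single comp_def)

lemma formal_sum_smult:
  "Poly_Mapping.single 0 (r u) * formal_sum ts u = formal_sum (map (\<lambda>(c, vs). (\<lambda>u. r u * c u, vs)) ts) u"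
  by (induction ts) (auto simp: distrib_left mult_single)

text \<open>Grouping the terms by length decomposes a formal sum into its homogeneous components,
  which is how it enters the direct sum diffeology.\<close>

lemma formal_sum_filter:
  assumes "\<And>c vs. (c, vs) \<in> set ts \<Longrightarrow> length vs \<le> N"
  shows "(\<Sum>r\<le>N. formal_sum (filter (\<lambda>(c, vs). length vs = r) ts) u) = formal_sum ts u"
  using assms
proof (induction ts)
  case (Cons t ts)
  obtain c vs where t: "t = (c, vs)" by (cases t)
  have "length vs \<le> N" using Cons.prems[of c vs] t by simp
  moreover have "formal_sum (filter (\<lambda>(c, vs). length vs = r) (t # ts)) u =
      (if r = length vs then Poly_Mapping.single (Word (map (\<lambda>v. v u) vs)) (c u) else 0)
      + formal_sum (filter (\<lambda>(c, vs). length vs = r) ts) u" for r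
    by (simp add: t)
  ultimately have "(\<Sum>r\<le>N. formal_sum (filter (\<lambda>(c, vs). length vs = r) (t # ts)) u) =
      Poly_Mapping.single (Word (map (\<lambda>v. v u) vs)) (c u)
      + (\<Sum>r\<le>N. formal_sum (filter (\<lambda>(c, vs). length vs = r) ts) u)"
    by (simp add: sum.distrib del: filter.simps)
  also have "(\<Sum>r\<le>N. formal_sum (filter (\<lambda>(c, vs). length vs = r) ts) u) = formal_sum ts u"
    using Cons.prems by (intro Cons.IH) auto
  finally show ?case by (simp add: t)
qed simp

context vector_family
begin

lemma formal_plot_restrict:
  "formal_plot V n W x ts \<Longrightarrow> openin (Euclidean_space n) W' \<Longrightarrow> W' \<subseteq> W \<Longrightarrow> formal_plot V n W' x ts"
proof (rule formal_plotI)
  assume ts: "formal_plot V n W x ts" and W': "openin (Euclidean_space n) W'" "W' \<subseteq> W"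
  note ts' = formal_plotD[OF ts]
  show "plot (base_sp V) n W' x" using ts'(1) W' by (rule base.plot_restrict)
  fix c vs assume t: "(c, vs) \<in> set ts"
  show "Cinf_on n W' c" using ts'(2)[OF t] W'(2) by (rule Cinf_on_subset)
  fix v assume v: "v \<in> set vs"
  show "plot (total_sp V) n W' v" using ts'(3)[OF t v] W' by (rule total.plot_restrict)
  show "prj V (v w) = x w" if "w \<in> W'" for w using ts'(4)[OF t v] W'(2) that by blast
qed

lemma formal_plot_cong:
  "formal_plot V n W x ts \<Longrightarrow> (\<And>w. w \<in> W \<Longrightarrow> y w = x w) \<Longrightarrow> formal_plot V n W y ts"
proof (rule formal_plotI)
  assume ts: "formal_plot V n W x ts" and eq: "\<And>w. w \<in> W \<Longrightarrow> y w = x w"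
  note ts' = formal_plotD[OF ts]
  show "plot (base_sp V) n W y" using ts'(1) eq by (rule base.plot_cong)
  fix c vs assume t: "(c, vs) \<in> set ts"
  show "Cinf_on n W c" using t by (rule ts')
  fix v assume v: "v \<in> set vs"
  show "plot (total_sp V) n W v" using t v by (rule ts')
  show "prj V (v w) = y w" if "w \<in> W" for w using ts'(4)[OF t v that] eq[OF that] by simp
qed

lemma formal_plot_append:
  "formal_plot V n W x (ts @ ts') \<longleftrightarrow> formal_plot V n W x ts \<and> formal_plot V n W x ts'"
  unfolding formal_plot_def set_append ball_Un by (intro iffI conjI; elim conjE; assumption)

lemma formal_plot_comp:
  assumes ts: "formal_plot V n U x ts" and W: "openin (Euclidean_space m) W" and F: "Cinf_map m W n U F"
  shows "formal_plot V m W (\<lambda>w. x (F w)) (map (\<lambda>(c, vs). (\<lambda>w. c (F w), map (\<lambda>v w. v (F w)) vs)) ts)"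
proof -
  note ts' = formal_plotD[OF ts]
  have U: "openin (Euclidean_space n) U" using ts'(1) by (rule base.plot_open)
  have FU: "F w \<in> U" if "w \<in> W" for w using F that by (auto simp: Cinf_map_def)
  show ?thesis
  proof (rule formal_plotI)
    show "plot (base_sp V) m W (\<lambda>w. x (F w))" using ts'(1) W F by (rule base.plot_comp)
    fix c' vs' assume "(c', vs') \<in> set (map (\<lambda>(c, vs). (\<lambda>w. c (F w), map (\<lambda>v w. v (F w)) vs)) ts)"
    then obtain c vs where t: "(c, vs) \<in> set ts" and c': "c' = (\<lambda>w. c (F w))" and vs': "vs' = map (\<lambda>v w. v (F w)) vs"
      by auto
    show "Cinf_on m W c'"
      unfolding c' using openin_subset[OF W] openin_subset[OF U] F ts'(2)[OF t] by (rule Cinf_on_compose)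
    fix v' assume "v' \<in> set vs'"
    then obtain v where v: "v \<in> set vs" and v': "v' = (\<lambda>w. v (F w))" unfolding vs' by auto
    show "plot (total_sp V) m W v'" unfolding v' using ts'(3)[OF t v] W F by (rule total.plot_comp)
    show "prj V (v' w) = x (F w)" if "w \<in> W" for w unfolding v' using t v FU[OF that] by (rule ts'(4))
  qed
qed

lemma formal_letters:
  assumes "formal_plot V n W x ts" "(c, vs) \<in> set ts" "w \<in> W"
  shows "set (map (\<lambda>v. v w) vs) \<subseteq> carrier (fib V (x w))"
proof -
  note ts = formal_plotD[OF assms(1)]
  have "x w \<in> points (base_sp V)" using base.plot_in_points ts(1) assms(3) by blast
  then show ?thesis
    using ts(4)[OF assms(2) _ assms(3)] total.plot_in_points[OF ts(3)[OF assms(2)] assms(3)]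
    by (auto simp: in_fib_iff)
qed

lemma formal_sum_closed:
  assumes ts: "formal_plot V n W x ts" and w: "w \<in> W"
  shows "formal_sum ts w \<in> carrier (free_alg (carrier (fib V (x w))))"
proof -
  have "\<forall>(c, vs)\<in>set ts. set (map (\<lambda>v. v w) vs) \<subseteq> carrier (fib V (x w))"
    using formal_letters[OF ts _ w] by auto
  then show ?thesis
  proof (induction ts)
    case (Cons t ts)
    obtain c vs where t: "t = (c, vs)" by (cases t)
    have "set (map (\<lambda>v. v w) vs) \<subseteq> carrier (fib V (x w))" using Cons.prems t by simp
    moreover have "formal_sum ts w \<in> carrier (free_alg (carrier (fib V (x w))))" using Cons by simp
    ultimately show ?case unfolding t formal_sum_simps by (intro free_alg_closed(3) single_in_free_alg)
  qed (simp add: free_alg_closed)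
qed

text \<open>Constant plots arise from the finite support of a representative: one term per key, with
  constant coefficient and constant letters.\<close>

lemma formal_plot_const:
  assumes W: "openin (Euclidean_space n) W" and x: "x \<in> points (base_sp V)"
    and a: "a \<in> carrier (free_alg (carrier (fib V x)))"
  obtains ts where "formal_plot V n W (\<lambda>_. x) ts" "\<And>w. formal_sum ts w = a"
    "\<And>c vs. (c, vs) \<in> set ts \<Longrightarrow> \<exists>z\<in>Poly_Mapping.keys a. length vs = length (letters z)"
proof -
  obtain zs where zs: "set zs = Poly_Mapping.keys a" "distinct zs"
    using finite_distinct_list[of "Poly_Mapping.keys a"] finite_keys by auto
  let ?ts = "map (\<lambda>z. (\<lambda>_. Poly_Mapping.lookup a z, map (\<lambda>v _. v) (letters z))) zs"
  have "formal_plot V n W (\<lambda>_. x) ?ts"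
  proof -
    have "plot (total_sp V) n W (\<lambda>_. v) \<and> prj V v = x" if "z \<in> set zs" "v \<in> set (letters z)" for z v
    proof -
      have "v \<in> carrier (fib V x)" using a that zs by (auto simp: carrier_free_alg)
      then show ?thesis using total.plot_const[OF W] by (simp add: in_fib_iff[OF x])
    qed
    then show ?thesis
      by (intro formal_plotI base.plot_const[OF W x]) (auto simp: Cinf_on_const)
  qed
  moreover have "formal_sum ?ts w = a" for w
  proof -
    have "formal_sum ?ts w = (\<Sum>z\<leftarrow>zs. Poly_Mapping.single z (Poly_Mapping.lookup a z))"
      unfolding formal_sum_def by (simp add: comp_def)
    also have "\<dots> = a" using zs by (simp add: sum_list_distinct_conv_sum_set poly_mapping_sum_single)
    finally show ?thesis .
  qed
  moreover have "\<exists>z\<in>Poly_Mapping.keys a. length vs = length (letters z)" if "(c, vs) \<in> set ?ts" for c :: "(nat \<Rightarrow> real) \<Rightarrow> real" and vs :: "((nat \<Rightarrow> real) \<Rightarrow> 'v) list"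
    using that zs by auto
  ultimately show ?thesis using that by blast
qed

lemma formal_class_plot_comp:
  assumes p: "formal_class_plot V Q K n U p" and W: "openin (Euclidean_space m) W" and F: "Cinf_map m W n U F"
  shows "formal_class_plot V Q K m W (\<lambda>w. p (F w))"
proof (rule formal_class_plot_local[OF W])
  fix w assume w: "w \<in> W"
  then have Fw: "F w \<in> U" using F by (auto simp: Cinf_map_def)
  obtain U' x ts where U': "openin (Euclidean_space n) U'" "F w \<in> U'" "U' \<subseteq> U" "formal_plot V n U' x ts"
    and Q: "\<And>c vs. (c, vs) \<in> set ts \<Longrightarrow> Q (length vs)"
    and eq: "\<And>u. u \<in> U' \<Longrightarrow> p u = (x u, K (x u) (formal_sum ts u))"
    by (rule formal_class_plotE[OF p Fw]) blast
  let ?W = "{w \<in> W. F w \<in> U'}"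
  have W': "openin (Euclidean_space m) ?W"
    using W formal_class_plot_open[OF p] F U'(1) by (rule openin_vimage_Cinf_map)
  have "Cinf_map m ?W n U' F"
    using F Cinf_on_subset[of m W _ ?W] unfolding Cinf_map_def by auto
  from formal_plot_comp[OF U'(4) W' this]
  have "formal_class_plot V Q K m ?W (\<lambda>w. p (F w))"
    by (rule formal_class_plotI[OF W']) (use Q eq in \<open>auto simp: formal_sum_map\<close>)
  then show "\<exists>W'. openin (Euclidean_space m) W' \<and> w \<in> W' \<and> W' \<subseteq> W \<and> formal_class_plot V Q K m W' (\<lambda>w. p (F w))"
    using W' w U'(2) by (intro exI[of _ ?W]) auto
qed

lemma formal_class_plot_base:
  assumes p: "formal_class_plot V Q K n U p"
  shows "plot (base_sp V) n U (\<lambda>u. fst (p u))"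
proof (rule base.plot_local[OF formal_class_plot_open[OF p]])
  fix u assume u: "u \<in> U"
  obtain W x ts where W: "openin (Euclidean_space n) W" "u \<in> W" "W \<subseteq> U" "formal_plot V n W x ts"
    "\<And>w. w \<in> W \<Longrightarrow> p w = (x w, K (x w) (formal_sum ts w))"
    by (rule formal_class_plotE[OF p u]) blast
  have "plot (base_sp V) n W (\<lambda>u. fst (p u))"
    using formal_plotD(1)[OF W(4)] by (rule base.plot_cong) (simp add: W)
  then show "\<exists>W. openin (Euclidean_space n) W \<and> u \<in> W \<and> W \<subseteq> U \<and> plot (base_sp V) n W (\<lambda>u. fst (p u))"
    using W by blast
qed

text \<open>After restriction to an intersection the two base plots coincide, because both are the
  first component. Over this common base plot the two lists can be concatenated, which is how sums
  of plots are formed.\<close>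

lemma formal_class_plot_pair:
  assumes p: "formal_class_plot V Q K n U p" and q: "formal_class_plot V Q K' n U q"
    and pq: "\<And>u. u \<in> U \<Longrightarrow> fst (p u) = fst (q u)" and u: "u \<in> U"
  obtains W x ts ts' where "openin (Euclidean_space n) W" "u \<in> W" "W \<subseteq> U"
    "formal_plot V n W x ts" "formal_plot V n W x ts'"
    "\<And>c vs. (c, vs) \<in> set (ts @ ts') \<Longrightarrow> Q (length vs)"
    "\<And>w. w \<in> W \<Longrightarrow> p w = (x w, K (x w) (formal_sum ts w))"
    "\<And>w. w \<in> W \<Longrightarrow> q w = (x w, K' (x w) (formal_sum ts' w))"
proof -
  obtain W x ts where W: "openin (Euclidean_space n) W" "u \<in> W" "W \<subseteq> U" "formal_plot V n W x ts"
    "\<And>c vs. (c, vs) \<in> set ts \<Longrightarrow> Q (length vs)" "\<And>w. w \<in> W \<Longrightarrow> p w = (x w, K (x w) (formal_sum ts w))"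
    by (rule formal_class_plotE[OF p u]) blast
  obtain W' x' ts' where W': "openin (Euclidean_space n) W'" "u \<in> W'" "W' \<subseteq> U" "formal_plot V n W' x' ts'"
    "\<And>c vs. (c, vs) \<in> set ts' \<Longrightarrow> Q (length vs)" "\<And>w. w \<in> W' \<Longrightarrow> q w = (x' w, K' (x' w) (formal_sum ts' w))"
    by (rule formal_class_plotE[OF q u]) blast
  let ?W = "W \<inter> W'"
  have o: "openin (Euclidean_space n) ?W" using W(1) W'(1) by (rule openin_Int)
  have xx: "x w = x' w" if "w \<in> ?W" for w 
  proof -
    have "w \<in> U" "w \<in> W" "w \<in> W'" using that W(3) by auto
    then show ?thesis using pq[of w] W(6)[of w] W'(6)[of w] by simp
  qed
  have "formal_plot V n ?W x ts" using W(4) o by (rule formal_plot_restrict) simp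
  moreover have "formal_plot V n ?W x' ts'" using W'(4) o by (rule formal_plot_restrict) simp
  then have "formal_plot V n ?W x ts'" by (rule formal_plot_cong) (rule xx)
  moreover have "Q (length vs)" if "(c, vs) \<in> set (ts @ ts')" for c vs using that W(5) W'(5) by auto
  moreover have "w \<in> ?W \<Longrightarrow> q w = (x w, K' (x w) (formal_sum ts' w))" for w using W'(6)[of w] xx[of w] by simp
  ultimately show ?thesis using that[OF o] W(2,3,6) W'(2) by blast
qed

end

section \<open>Tensor powers of a family\<close>

abbreviation homogeneous :: "(real, 'v) module \<Rightarrow> nat \<Rightarrow> ('v tword \<Rightarrow>\<^sub>0 real) set" where
  "homogeneous M r \<equiv> {a \<in> carrier (free_alg (carrier M)). \<forall>w\<in>Poly_Mapping.keys a. length (letters w) = r}"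

lemma homogeneous_closed:
  "0 \<in> homogeneous M r"
  "a \<in> homogeneous M r \<Longrightarrow> b \<in> homogeneous M r \<Longrightarrow> a + b \<in> homogeneous M r"
  "a \<in> homogeneous M r \<Longrightarrow> Poly_Mapping.single 0 s * a \<in> homogeneous M r"
proof -
  assume a: "a \<in> homogeneous M r"
  show "a + b \<in> homogeneous M r" if "b \<in> homogeneous M r"
    using a that keys_add[of a b] by (auto simp: free_alg_closed)
  have "Poly_Mapping.keys (Poly_Mapping.single 0 s * a) \<subseteq> Poly_Mapping.keys a"
    using keys_mult[of "Poly_Mapping.single 0 s" a] by (auto split: if_splits)
  then show "Poly_Mapping.single 0 s * a \<in> homogeneous M r"
    using a by (auto simp: free_alg_closed single_in_free_alg zero_tword_def)
qed (simp add: free_alg_closed)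

lemma homogeneous_single: "set vs \<subseteq> carrier M \<Longrightarrow> length vs = r \<Longrightarrow> Poly_Mapping.single (Word vs) c \<in> homogeneous M r"
  by (simp add: single_in_free_alg)

lemma tensor_power_simps:
  "carrier (tensor_power M r) = tensor_class M ` homogeneous M r"
  "add (tensor_power M r) = add (tensor_algebra M)"
  "smult (tensor_power M r) = smult (tensor_algebra M)"
  "zero (tensor_power M r) = zero (tensor_algebra M)"
  by (simp_all add: tensor_power_def)

lemma vectorspace_tensor_power:
  assumes M: "vectorspace class_ring M"
  shows "vectorspace class_ring (tensor_power M r)"
  unfolding tensor_power_def
proof (rule vectorspace_subspace)
  show "vectorspace class_ring (tensor_algebra M)"
    using real_algebra_tensor_algebra[OF M] by (rule real_algebra.vectorspace)
  show "tensor_class M ` homogeneous M r \<subseteq> carrier (tensor_algebra M)"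
    by (auto simp: carrier_tensor_algebra[OF M])
  show "\<zero>\<^bsub>tensor_algebra M\<^esub> \<in> tensor_class M ` homogeneous M r"
    unfolding tensor_class_zero[OF M] using homogeneous_closed(1) by (rule imageI)
  fix v assume "v \<in> tensor_class M ` homogeneous M r"
  then obtain a where a: "a \<in> homogeneous M r" "v = tensor_class M a" by (rule imageE)
  show "s \<odot>\<^bsub>tensor_algebra M\<^esub> v \<in> tensor_class M ` homogeneous M r" for s
    using a tensor_class_smult[OF M, of a s] homogeneous_closed(3)[OF a(1), of s] by blast
  fix w assume "w \<in> tensor_class M ` homogeneous M r"
  then obtain b where b: "b \<in> homogeneous M r" "w = tensor_class M b" by (rule imageE)
  show "v \<oplus>\<^bsub>tensor_algebra M\<^esub> w \<in> tensor_class M ` homogeneous M r"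
    using a b tensor_class_add[OF M, of a b] homogeneous_closed(2)[OF a(1) b(1)] by blast
qed

lemma finsum_tensor_class:
  assumes M: "vectorspace class_ring M" and "finite A" and g: "\<And>r. r \<in> A \<Longrightarrow> g r \<in> carrier (free_alg (carrier M))"
  shows "finsum (tensor_algebra M) (\<lambda>r. tensor_class M (g r)) A = tensor_class M (sum g A)"
proof -
  interpret ring "tensor_algebra M" using M by (rule ring_tensor_algebra)
  \<comment> \<open>Membership is carried through the induction because the rules for classes apply
    to elements of the free algebra on the fibre only.\<close>
  have "sum g A \<in> carrier (free_alg (carrier M)) \<and>
      finsum (tensor_algebra M) (\<lambda>r. tensor_class M (g r)) A = tensor_class M (sum g A)"
    using assms(2) g
  proof (induction A rule: finite_induct)
    case (insert r A)
    then show ?case by (simp add: free_alg_closed tensor_class_add[OF M] tensor_class_closed[OF M] Pi_def)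
  qed (simp add: free_alg_closed tensor_class_zero[OF M])
  then show ?thesis ..
qed

context vector_family
begin

text \<open>The candidate for the finest diffeology. It is shown to be one of those intersected in
  \<open>tensor_power_diff\<close> and to be contained in each of them.\<close>

definition explicit_tensor_diff :: "nat \<Rightarrow> ('x \<times> ('v tword \<Rightarrow>\<^sub>0 real) set) diffsp" where
  "explicit_tensor_diff r =
     \<lparr>points = {(x, t). x \<in> points (base_sp V) \<and> t \<in> carrier (tensor_power (fib V x) r)},
      plot = formal_class_plot V (\<lambda>l. l = r) (\<lambda>x. tensor_class (fib V x))\<rparr>"

lemma explicit_tensor_pointI:
  assumes "x \<in> points (base_sp V)" "a \<in> homogeneous (fib V x) r"
  shows "(x, tensor_class (fib V x) a) \<in> points (explicit_tensor_diff r)"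
  unfolding explicit_tensor_diff_def diffsp.simps tensor_power_simps
  using assms(1) imageI[OF assms(2)] by blast

lemma explicit_tensor_pointE:
  assumes "y \<in> points (explicit_tensor_diff r)"
  obtains x a where "x \<in> points (base_sp V)" "a \<in> homogeneous (fib V x) r" "y = (x, tensor_class (fib V x) a)"
proof -
  have "fst y \<in> points (base_sp V)" "snd y \<in> tensor_class (fib V (fst y)) ` homogeneous (fib V (fst y)) r"
    using assms by (auto simp: explicit_tensor_diff_def tensor_power_simps)
  from this(2) obtain a where a: "a \<in> homogeneous (fib V (fst y)) r" and s: "snd y = tensor_class (fib V (fst y)) a"
    by (rule imageE)
  show thesis
  proof (rule that)
    show "y = (fst y, tensor_class (fib V (fst y)) a)" using s by (simp add: prod_eq_iff)
  qed fact+
qed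

lemma formal_sum_homogeneous:
  assumes ts: "formal_plot V n W x ts" and w: "w \<in> W" and r: "\<And>c vs. (c, vs) \<in> set ts \<Longrightarrow> length vs = r"
  shows "formal_sum ts w \<in> homogeneous (fib V (x w)) r"
proof -
  have "\<forall>(c, vs)\<in>set ts. set (map (\<lambda>v. v w) vs) \<subseteq> carrier (fib V (x w)) \<and> length (map (\<lambda>v. v w) vs) = r"
    using formal_letters[OF ts _ w] r by auto
  then show ?thesis
  proof (induction ts)
    case (Cons t ts)
    obtain c vs where t: "t = (c, vs)" by (cases t)
    have "set (map (\<lambda>v. v w) vs) \<subseteq> carrier (fib V (x w))" "length (map (\<lambda>v. v w) vs) = r"
      using Cons.prems t by simp_all
    moreover have "formal_sum ts w \<in> homogeneous (fib V (x w)) r" using Cons by simp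
    ultimately show ?case unfolding t formal_sum_simps by (intro homogeneous_closed(2) homogeneous_single)
  next
    case Nil
    show ?case unfolding formal_sum_simps by (rule homogeneous_closed)
  qed
qed

lemma diffeological_space_explicit_tensor: "diffeological_space (explicit_tensor_diff r)"
proof
  fix n m U W p q F x
  let ?D = "explicit_tensor_diff r"
  have pl: "plot ?D = formal_class_plot V (\<lambda>l. l = r) (\<lambda>x. tensor_class (fib V x))"
    by (simp add: explicit_tensor_diff_def)
  show "openin (Euclidean_space n) U" if "plot ?D n U p"
    using that unfolding pl by (rule formal_class_plot_open)
  show "p ` U \<subseteq> points ?D" if p: "plot ?D n U p"
  proof
    fix y assume "y \<in> p ` U"
    then obtain u where u: "u \<in> U" "y = p u" by blast
    obtain W x ts where W: "u \<in> W" "formal_plot V n W x ts" "\<And>c vs. (c, vs) \<in> set ts \<Longrightarrow> length vs = r"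
      "\<And>w. w \<in> W \<Longrightarrow> p w = (x w, tensor_class (fib V (x w)) (formal_sum ts w))"
      by (rule formal_class_plotE[OF p[unfolded pl] u(1)]) blast
    show "y \<in> points ?D"
      using formal_sum_homogeneous[OF W(2,1,3)] base.plot_in_points[OF formal_plotD(1)[OF W(2)] W(1)] W(4)[OF W(1)] u(2)
      by (simp add: explicit_tensor_diff_def tensor_power_simps)
  qed
  show "plot ?D n U q" if "plot ?D n U p" "\<And>u. u \<in> U \<Longrightarrow> q u = p u"
    using that unfolding pl by (rule formal_class_plot_cong)
  show "plot ?D n U (\<lambda>_. x)" if U: "openin (Euclidean_space n) U" and x: "x \<in> points ?D"
  proof -
    obtain y a where y: "y \<in> points (base_sp V)" "a \<in> homogeneous (fib V y) r" "x = (y, tensor_class (fib V y) a)"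
      using x by (auto simp: explicit_tensor_diff_def tensor_power_simps)
    have a: "a \<in> carrier (free_alg (carrier (fib V y)))" using y(2) by simp
    obtain ts where ts: "formal_plot V n U (\<lambda>_. y) ts" "\<And>w. formal_sum ts w = a"
      "\<And>c vs. (c, vs) \<in> set ts \<Longrightarrow> \<exists>z\<in>Poly_Mapping.keys a. length vs = length (letters z)"
      by (rule formal_plot_const[OF U y(1) a]) blast
    show ?thesis unfolding pl by (rule formal_class_plotI[OF U ts(1)]) (use ts y in auto)
  qed
  show "plot ?D n U p" if "openin (Euclidean_space n) U"
    "\<And>u. u \<in> U \<Longrightarrow> \<exists>W. openin (Euclidean_space n) W \<and> u \<in> W \<and> W \<subseteq> U \<and> plot ?D n W p"
    using that unfolding pl by (rule formal_class_plot_local)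
  show "plot ?D m W (\<lambda>w. p (F w))" if "plot ?D n U p" "openin (Euclidean_space m) W" "Cinf_map m W n U F"
    using that unfolding pl by (rule formal_class_plot_comp)
qed

lemma fib_tensor_power_simps:
  assumes "x \<in> points (base_sp V)"
  shows "\<zero>\<^bsub>fib (tensor_power_with V r D) x\<^esub> = (x, tensor_class (fib V x) 0)"
    "a \<in> homogeneous (fib V x) r \<Longrightarrow> b \<in> homogeneous (fib V x) r \<Longrightarrow>
      (x, tensor_class (fib V x) a) \<oplus>\<^bsub>fib (tensor_power_with V r D) x\<^esub> (x, tensor_class (fib V x) b) =
      (x, tensor_class (fib V x) (a + b))"
    "a \<in> homogeneous (fib V x) r \<Longrightarrow>
      s \<odot>\<^bsub>fib (tensor_power_with V r D) x\<^esub> (x, tensor_class (fib V x) a) =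
      (x, tensor_class (fib V x) (Poly_Mapping.single 0 s * a))"
proof -
  note M = fib_vectorspace[OF assms]
  have f: "fib (tensor_power_with V r D) x = transport (Pair x) (tensor_power (fib V x) r)"
    by (simp add: tensor_power_with_def)
  have inj: "inj_on (Pair x) (carrier (tensor_power (fib V x) r))" by (simp add: inj_on_def)
  note t = transport_simps[OF inj, folded f, unfolded tensor_power_simps]
  show "\<zero>\<^bsub>fib (tensor_power_with V r D) x\<^esub> = (x, tensor_class (fib V x) 0)"
    using t(2) by (simp add: tensor_class_zero[OF M])
  show "(x, tensor_class (fib V x) a) \<oplus>\<^bsub>fib (tensor_power_with V r D) x\<^esub> (x, tensor_class (fib V x) b) =
      (x, tensor_class (fib V x) (a + b))" if "a \<in> homogeneous (fib V x) r" "b \<in> homogeneous (fib V x) r"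
    using t(3)[OF imageI[OF that(1)] imageI[OF that(2)]] that by (simp add: tensor_class_add[OF M])
  show "s \<odot>\<^bsub>fib (tensor_power_with V r D) x\<^esub> (x, tensor_class (fib V x) a) =
      (x, tensor_class (fib V x) (Poly_Mapping.single 0 s * a))" if "a \<in> homogeneous (fib V x) r"
    using t(4)[OF imageI[OF that]] that by (simp add: tensor_class_smult[OF M])
qed

text \<open>Addition concatenates lists of terms, scaling multiplies the coefficients by a smooth
  function, and the zero section is the empty list. All three operations thus lead from formal plots
  to formal plots.\<close>

lemma pseudo_bundle_explicit_tensor:
  "pseudo_bundle (tensor_power_with V r (explicit_tensor_diff r))"
proof (rule pseudo_bundle.intro)
  let ?D = "explicit_tensor_diff r" and ?B = "tensor_power_with V r (explicit_tensor_diff r)"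
  have B: "base_sp ?B = base_sp V" "total_sp ?B = ?D" "prj ?B = fst"
    by (simp_all add: tensor_power_with_def)
  have pl: "plot ?D = formal_class_plot V (\<lambda>l. l = r) (\<lambda>x. tensor_class (fib V x))"
    and pt: "points ?D = {(x, t). x \<in> points (base_sp V) \<and> t \<in> carrier (tensor_power (fib V x) r)}"
    by (simp_all add: explicit_tensor_diff_def)
  show "diffeological_space (base_sp ?B)" unfolding B by (rule base_diffeology)
  show "diffeological_space (total_sp ?B)" unfolding B by (rule diffeological_space_explicit_tensor)
  show "smooth_map (total_sp ?B) (base_sp ?B) (prj ?B)"
    unfolding B smooth_map_def pl by (auto simp: pt intro: formal_class_plot_base)
  have z: "(x, tensor_class (fib V x) 0) \<in> points ?D" if "x \<in> points (base_sp V)" for x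
    using that homogeneous_closed(1) by (rule explicit_tensor_pointI)
  show "prj ?B ` points (total_sp ?B) = points (base_sp ?B)"
    unfolding B using z by (force simp: pt)
  show "carrier (fib ?B x) = over ?B {x}" if "x \<in> points (base_sp ?B)" for x
    using that by (auto simp: tensor_power_with_def over_def pt transport_simps(1) inj_on_def)
  show "vectorspace class_ring (fib ?B x)" if "x \<in> points (base_sp ?B)" for x
    using that vectorspace_tensor_power[OF fib_vectorspace]
    by (simp add: tensor_power_with_def vectorspace_transport inj_on_def)
  have x_in: "x w \<in> points (base_sp V)" if "formal_plot V n W x ts" "w \<in> W" for n W x and ts :: "'v formal_terms" and w
    using base.plot_in_points formal_plotD(1) that by blast
  show "smooth_map (sub_diff (prod_diff (total_sp ?B) (total_sp ?B)) {(v, w). prj ?B v = prj ?B w})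
         (total_sp ?B) (\<lambda>(v, w). v \<oplus>\<^bsub>fib ?B (prj ?B v)\<^esub> w)" (is "smooth_map ?P _ ?f")
    unfolding smooth_map_def
  proof (intro conjI allI impI)
    have pt_f: "?f y \<in> points ?D" if "y \<in> points ?P" for y
    proof -
      obtain x a b where x: "x \<in> points (base_sp V)" and ab: "a \<in> homogeneous (fib V x) r" "b \<in> homogeneous (fib V x) r"
        and y: "y = ((x, tensor_class (fib V x) a), (x, tensor_class (fib V x) b))"
      proof -
        have y: "fst y \<in> points ?D" "snd y \<in> points ?D" and eq: "fst (fst y) = fst (snd y)"
          using \<open>y \<in> points ?P\<close> by (auto simp: sub_diff_def prod_diff_def B)
        obtain x a where a: "x \<in> points (base_sp V)" "a \<in> homogeneous (fib V x) r" "fst y = (x, tensor_class (fib V x) a)"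
          by (rule explicit_tensor_pointE[OF y(1)])
        obtain x' b where b: "b \<in> homogeneous (fib V x') r" "snd y = (x', tensor_class (fib V x') b)"
          by (rule explicit_tensor_pointE[OF y(2)])
        have "x' = x" using eq a(3) b(2) by simp
        then show thesis using that[OF a(1,2), of b] a(3) b by (simp add: prod_eq_iff)
      qed
      have "?f y = (x, tensor_class (fib V x) (a + b))"
        using fib_tensor_power_simps(2)[OF x ab] by (simp add: y B)
      then show ?thesis using explicit_tensor_pointI[OF x homogeneous_closed(2)[OF ab]] by simp
    qed
    then show "?f ` points ?P \<subseteq> points (total_sp ?B)" unfolding B by blast
    fix n U y assume "plot ?P n U y"
    then have p: "formal_class_plot V (\<lambda>l. l = r) (\<lambda>x. tensor_class (fib V x)) n U (\<lambda>u. fst (y u))"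
      and q: "formal_class_plot V (\<lambda>l. l = r) (\<lambda>x. tensor_class (fib V x)) n U (\<lambda>u. snd (y u))"
      and pq: "\<And>u. u \<in> U \<Longrightarrow> fst (fst (y u)) = fst (snd (y u))"
      by (auto simp: sub_diff_def prod_diff_def B pl)
    have "formal_class_plot V (\<lambda>l. l = r) (\<lambda>x. tensor_class (fib V x)) n U (\<lambda>u. ?f (y u))"
    proof (rule formal_class_plot_local[OF formal_class_plot_open[OF p]])
      fix u assume u: "u \<in> U"
      obtain W x ts ts' where W: "openin (Euclidean_space n) W" "u \<in> W" "W \<subseteq> U"
        and ts: "formal_plot V n W x ts" "formal_plot V n W x ts'"
        and l: "\<And>c vs. (c, vs) \<in> set (ts @ ts') \<Longrightarrow> length vs = r"
        and pe: "\<And>w. w \<in> W \<Longrightarrow> fst (y w) = (x w, tensor_class (fib V (x w)) (formal_sum ts w))"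
        and qe: "\<And>w. w \<in> W \<Longrightarrow> snd (y w) = (x w, tensor_class (fib V (x w)) (formal_sum ts' w))"
        by (rule formal_class_plot_pair[OF p q _ u], erule pq) (rule that)
      have "formal_class_plot V (\<lambda>l. l = r) (\<lambda>x. tensor_class (fib V x)) n W (\<lambda>u. ?f (y u))"
      proof (rule formal_class_plotI[OF W(1)])
        show "formal_plot V n W x (ts @ ts')" using ts by (simp add: formal_plot_append)
        fix w assume w: "w \<in> W"
        have "length vs = r" if "(c, vs) \<in> set ts" for c vs using l[of c vs] that by simp
        then have 1: "formal_sum ts w \<in> homogeneous (fib V (x w)) r" by (rule formal_sum_homogeneous[OF ts(1) w])
        have "length vs = r" if "(c, vs) \<in> set ts'" for c vs using l[of c vs] that by simp
        then have 2: "formal_sum ts' w \<in> homogeneous (fib V (x w)) r" by (rule formal_sum_homogeneous[OF ts(2) w])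
        from fib_tensor_power_simps(2)[OF x_in[OF ts(1) w] 1 2]
        show "?f (y w) = (x w, tensor_class (fib V (x w)) (formal_sum (ts @ ts') w))"
          using pe[OF w] qe[OF w] by (simp add: case_prod_beta B)
      qed (rule l)
      then show "\<exists>W. openin (Euclidean_space n) W \<and> u \<in> W \<and> W \<subseteq> U \<and>
          formal_class_plot V (\<lambda>l. l = r) (\<lambda>x. tensor_class (fib V x)) n W (\<lambda>u. ?f (y u))"
        using W by blast
    qed
    then show "plot (total_sp ?B) n U (\<lambda>u. ?f (y u))" by (simp only: B(2) pl)
  qed
  show "smooth_map (prod_diff real_diff (total_sp ?B)) (total_sp ?B) (\<lambda>(s, v). s \<odot>\<^bsub>fib ?B (prj ?B v)\<^esub> v)"
    (is "smooth_map ?P _ ?f")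
    unfolding smooth_map_def
  proof (intro conjI allI impI)
    have pt_f: "?f y \<in> points ?D" if "y \<in> points ?P" for y
    proof -
      obtain s x a where x: "x \<in> points (base_sp V)" and a: "a \<in> homogeneous (fib V x) r"
        and y: "y = (s, (x, tensor_class (fib V x) a))"
      proof -
        have y: "snd y \<in> points ?D" using \<open>y \<in> points ?P\<close> by (auto simp: prod_diff_def B)
        obtain x a where a: "x \<in> points (base_sp V)" "a \<in> homogeneous (fib V x) r" "snd y = (x, tensor_class (fib V x) a)"
          by (rule explicit_tensor_pointE[OF y])
        then show thesis using that[OF a(1,2), of "fst y"] by (simp add: prod_eq_iff)
      qed
      have "?f y = (x, tensor_class (fib V x) (Poly_Mapping.single 0 s * a))"
        using fib_tensor_power_simps(3)[OF x a] by (simp add: y B)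
      then show ?thesis using explicit_tensor_pointI[OF x homogeneous_closed(3)[OF a]] by simp
    qed
    then show "?f ` points ?P \<subseteq> points (total_sp ?B)" unfolding B by blast
    fix n U y assume "plot ?P n U y"
    then have s: "Cinf_on n U (\<lambda>u. fst (y u))"
      and q: "formal_class_plot V (\<lambda>l. l = r) (\<lambda>x. tensor_class (fib V x)) n U (\<lambda>u. snd (y u))"
      by (auto simp: real_diff_def prod_diff_def B pl)
    have "formal_class_plot V (\<lambda>l. l = r) (\<lambda>x. tensor_class (fib V x)) n U (\<lambda>u. ?f (y u))"
    proof (rule formal_class_plot_local[OF formal_class_plot_open[OF q]])
      fix u assume u: "u \<in> U"
      obtain W x ts where W: "openin (Euclidean_space n) W" "u \<in> W" "W \<subseteq> U"
        and ts: "formal_plot V n W x ts" and l: "\<And>c vs. (c, vs) \<in> set ts \<Longrightarrow> length vs = r"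
        and e: "\<And>w. w \<in> W \<Longrightarrow> snd (y w) = (x w, tensor_class (fib V (x w)) (formal_sum ts w))"
        by (rule formal_class_plotE[OF q u]) blast
      let ?ts = "map (\<lambda>(c, vs). (\<lambda>u. fst (y u) * c u, vs)) ts"
      have "formal_class_plot V (\<lambda>l. l = r) (\<lambda>x. tensor_class (fib V x)) n W (\<lambda>u. ?f (y u))"
      proof (rule formal_class_plotI[OF W(1)])
        note ts' = formal_plotD[OF ts]
        show "formal_plot V n W x ?ts"
        proof (rule formal_plotI[OF ts'(1)])
          fix c' vs assume "(c', vs) \<in> set ?ts"
          then obtain c where c: "(c, vs) \<in> set ts" "c' = (\<lambda>u. fst (y u) * c u)" by auto
          show "Cinf_on n W c'"
            unfolding c(2) using openin_subset[OF W(1)] Cinf_on_subset[OF s W(3)] ts'(2)[OF c(1)] by (rule Cinf_on_mult)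
          fix v assume v: "v \<in> set vs"
          show "plot (total_sp V) n W v" using c(1) v by (rule ts')
          show "prj V (v w) = x w" if "w \<in> W" for w using c(1) v that by (rule ts')
        qed
        fix w assume w: "w \<in> W"
        have "formal_sum ts w \<in> homogeneous (fib V (x w)) r"
          using l by (rule formal_sum_homogeneous[OF ts w])
        from fib_tensor_power_simps(3)[OF x_in[OF ts w] this]
        show "?f (y w) = (x w, tensor_class (fib V (x w)) (formal_sum ?ts w))"
          using e[OF w] by (simp add: case_prod_beta B formal_sum_smult[of "\<lambda>u. fst (y u)", symmetric] del: formal_sum_simps)
      next
        show "length vs = r" if "(c, vs) \<in> set ?ts" for c vs using that l by auto
      qed
      then show "\<exists>W. openin (Euclidean_space n) W \<and> u \<in> W \<and> W \<subseteq> U \<and>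
          formal_class_plot V (\<lambda>l. l = r) (\<lambda>x. tensor_class (fib V x)) n W (\<lambda>u. ?f (y u))"
        using W by blast
    qed
    then show "plot (total_sp ?B) n U (\<lambda>u. ?f (y u))" by (simp only: B(2) pl)
  qed
  show "smooth_map (base_sp ?B) (total_sp ?B) (\<lambda>x. \<zero>\<^bsub>fib ?B x\<^esub>)"
    unfolding smooth_map_def
  proof (intro conjI allI impI)
    show "(\<lambda>x. \<zero>\<^bsub>fib ?B x\<^esub>) ` points (base_sp ?B) \<subseteq> points (total_sp ?B)"
      using z by (auto simp: B fib_tensor_power_simps)
    fix n U x assume x: "plot (base_sp ?B) n U x"
    then have x: "plot (base_sp V) n U x" by (simp add: B)
    show "plot (total_sp ?B) n U (\<lambda>u. \<zero>\<^bsub>fib ?B (x u)\<^esub>)"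
      unfolding B pl
    proof (rule formal_class_plotI[OF base.plot_open[OF x]])
      show "formal_plot V n U x []" using x by (simp add: formal_plot_def)
      show "\<zero>\<^bsub>fib ?B (x w)\<^esub> = (x w, tensor_class (fib V (x w)) (formal_sum [] w))" if "w \<in> U" for w
        using base.plot_in_points[OF x that] by (simp add: fib_tensor_power_simps)
    qed simp
  qed
qed

lemma smooth_tensor_explicit:
  "smooth_map (fibre_power V r) (explicit_tensor_diff r) (\<lambda>(x, vs). (x, tensor_of (fib V x) vs))"
  unfolding smooth_map_def
proof (intro conjI allI impI)
  show "(\<lambda>(x, vs). (x, tensor_of (fib V x) vs)) ` points (fibre_power V r) \<subseteq> points (explicit_tensor_diff r)"
  proof
    fix y assume "y \<in> (\<lambda>(x, vs). (x, tensor_of (fib V x) vs)) ` points (fibre_power V r)"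
    then obtain x vs where x: "x \<in> points (base_sp V)" and vs: "length vs = r" "set vs \<subseteq> carrier (fib V x)"
      and y: "y = (x, tensor_of (fib V x) vs)"
      by (auto simp: fibre_power_def fib_carrier)
    show "y \<in> points (explicit_tensor_diff r)"
      unfolding y explicit_tensor_diff_def using x homogeneous_single[OF vs(2,1), of 1]
      by (simp add: tensor_power_simps tensor_of_def)
  qed
  fix n U p assume p: "plot (fibre_power V r) n U p"
  then have x: "plot (base_sp V) n U (\<lambda>u. fst (p u))" and l: "\<And>u. u \<in> U \<Longrightarrow> length (snd (p u)) = r"
    and pr: "\<And>u. u \<in> U \<Longrightarrow> set (snd (p u)) \<subseteq> over V {fst (p u)}"
    and v: "\<And>i. i < r \<Longrightarrow> plot (total_sp V) n U (\<lambda>u. snd (p u) ! i)"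
    by (simp_all add: fibre_power_def)
  \<comment> \<open>A single term with coefficient 1, whose letters are the components of the fibre
    product. For \<open>r = 0\<close> it is the empty word, that is, the unit over the base
    point.\<close>
  let ?ts = "[(\<lambda>_. 1, map (\<lambda>i u. snd (p u) ! i) [0..<r])]"
  show "plot (explicit_tensor_diff r) n U (\<lambda>u. (\<lambda>(x, vs). (x, tensor_of (fib V x) vs)) (p u))"
    unfolding explicit_tensor_diff_def diffsp.simps
  proof (rule formal_class_plotI[OF base.plot_open[OF x]])
    have "prj V (snd (p w) ! i) = fst (p w)" if "w \<in> U" "i < r" for w i
      using pr[OF that(1)] l[OF that(1)] that(2) by (auto simp: over_def dest: nth_mem)
    then show "formal_plot V n U (\<lambda>u. fst (p u)) ?ts"
      using x v by (intro formal_plotI) (auto simp: Cinf_on_const)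
    fix w assume w: "w \<in> U"
    have "map (\<lambda>v. v w) (map (\<lambda>i u. snd (p u) ! i) [0..<r]) = snd (p w)"
      using map_nth[of "snd (p w)"] l[OF w] by (simp add: comp_def)
    then show "(\<lambda>(x, vs). (x, tensor_of (fib V x) vs)) (p w) =
        (fst (p w), tensor_class (fib V (fst (p w))) (formal_sum ?ts w))"
      by (simp add: case_prod_beta tensor_of_def)
  qed simp
qed

text \<open>Conversely, such a sum is a plot for every competing diffeology, by smoothness of the operations.\<close>

lemma formal_plot_in_tensor_power:
  assumes D: "pseudo_bundle (tensor_power_with V r D)"
    and univ: "smooth_map (fibre_power V r) D (\<lambda>(x, vs). (x, tensor_of (fib V x) vs))"
    and ts: "formal_plot V n W x ts" and l: "\<And>c vs. (c, vs) \<in> set ts \<Longrightarrow> length vs = r"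
  shows "plot D n W (\<lambda>w. (x w, tensor_class (fib V (x w)) (formal_sum ts w)))"
proof -
  let ?B = "tensor_power_with V r D"
  interpret D: pseudo_bundle ?B by (rule D)
  have B: "base_sp ?B = base_sp V" "total_sp ?B = D" "prj ?B = fst"
    by (simp_all add: tensor_power_with_def)
  have dD: "diffeological_space D" using D.total_diffeology by (simp add: B)
  interpret total': diffeological_space D by (rule dD)
  have x: "plot (base_sp V) n W x" using formal_plotD(1)[OF ts] .
  note x_in = base.plot_in_points[OF x]
  show ?thesis
    using ts l
  proof (induction ts)
    case Nil
    show ?case
      by (rule total'.plot_cong[OF D.zero_plot[of n W x, unfolded B, OF x]])
        (simp add: fib_tensor_power_simps x_in)
  next
    case (Cons t ts)
    obtain c vs where t: "t = (c, vs)" by (cases t)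
    have tts: "formal_plot V n W x [(c, vs)]" "formal_plot V n W x ts"
      using Cons.prems(1) formal_plot_append[of n W x "[(c, vs)]" ts] by (simp_all add: t)
    note tD = formal_plotD[OF tts(1)]
    have vs: "length vs = r" using Cons.prems(2)[of c vs] by (simp add: t)
    have lts: "length vs = r" if "(c, vs) \<in> set ts" for c vs using Cons.prems(2)[of c vs] that by simp
    have letters: "set (map (\<lambda>v. v w) vs) \<subseteq> carrier (fib V (x w))" if "w \<in> W" for w
      using formal_letters[OF tts(1) _ that] by simp
    \<comment> \<open>The letters of one term form a plot of the fibre product, so their
      decomposable tensor is a plot of \<open>D\<close>. The coefficient then enters by scaling and
      the remaining terms by addition, both smooth for \<open>D\<close>.\<close>
    have "plot (fibre_power V r) n W (\<lambda>w. (x w, map (\<lambda>v. v w) vs))"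
      using x tD(3) vs letters fib_carrier[OF x_in] by (auto simp: fibre_power_def)
    from smooth_mapD[OF univ this]
    have "plot D n W (\<lambda>w. (x w, tensor_of (fib V (x w)) (map (\<lambda>v. v w) vs)))" by simp
    from D.smult_plot[unfolded B, OF this tD(2)[of c vs]]
    have 1: "plot D n W (\<lambda>w. c w \<odot>\<^bsub>fib ?B (x w)\<^esub> (x w, tensor_of (fib V (x w)) (map (\<lambda>v. v w) vs)))"
      by simp
    have hom: "Poly_Mapping.single (Word (map (\<lambda>v. v w) vs)) s \<in> homogeneous (fib V (x w)) r" if "w \<in> W" for w s
      using letters[OF that] vs by (intro homogeneous_single) auto
    have eq1: "c w \<odot>\<^bsub>fib ?B (x w)\<^esub> (x w, tensor_of (fib V (x w)) (map (\<lambda>v. v w) vs)) =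
        (x w, tensor_class (fib V (x w)) (Poly_Mapping.single (Word (map (\<lambda>v. v w) vs)) (c w)))" if "w \<in> W" for w
      unfolding tensor_of_def fib_tensor_power_simps(3)[OF x_in[OF that] hom[OF that]]
      by (simp add: mult_single)
    have 2: "plot D n W (\<lambda>w. (x w, tensor_class (fib V (x w)) (Poly_Mapping.single (Word (map (\<lambda>v. v w) vs)) (c w))))"
      by (rule total'.plot_cong[OF 1]) (simp add: eq1)
    have 3: "plot D n W (\<lambda>w. (x w, tensor_class (fib V (x w)) (formal_sum ts w)))"
      using tts(2) lts by (rule Cons.IH)
    from D.add_plot[unfolded B, OF 2 3]
    have 4: "plot D n W (\<lambda>w. (x w, tensor_class (fib V (x w)) (Poly_Mapping.single (Word (map (\<lambda>v. v w) vs)) (c w)))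
        \<oplus>\<^bsub>fib ?B (x w)\<^esub> (x w, tensor_class (fib V (x w)) (formal_sum ts w)))" by simp
    show ?case
    proof (rule total'.plot_cong[OF 4])
      fix w assume w: "w \<in> W"
      have "formal_sum ts w \<in> homogeneous (fib V (x w)) r" using lts by (rule formal_sum_homogeneous[OF tts(2) w])
      from fib_tensor_power_simps(2)[OF x_in[OF w] hom[OF w] this]
      show "(x w, tensor_class (fib V (x w)) (formal_sum (t # ts) w)) =
          (x w, tensor_class (fib V (x w)) (Poly_Mapping.single (Word (map (\<lambda>v. v w) vs)) (c w)))
          \<oplus>\<^bsub>fib ?B (x w)\<^esub> (x w, tensor_class (fib V (x w)) (formal_sum ts w))"
        by (simp add: t)
    qed
  qed
qed

text \<open>From left to right, the explicit diffeology is one of the competitors. From right to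
  left, every competitor contains its plots locally and is itself local.\<close>

lemma plot_tensor_power_iff:
  "plot (total_sp (tensor_power_bundle V r)) n U p \<longleftrightarrow>
     formal_class_plot V (\<lambda>l. l = r) (\<lambda>x. tensor_class (fib V x)) n U p"
proof -
  have tp: "plot (total_sp (tensor_power_bundle V r)) n U p \<longleftrightarrow>
    (\<forall>D. pseudo_bundle (tensor_power_with V r D) \<and>
        smooth_map (fibre_power V r) D (\<lambda>(x, vs). (x, tensor_of (fib V x) vs)) \<longrightarrow> plot D n U p)"
    by (simp add: tensor_power_bundle_def tensor_power_with_def tensor_power_diff_def)
  show ?thesis
  proof
    assume "plot (total_sp (tensor_power_bundle V r)) n U p"
    then have "plot (explicit_tensor_diff r) n U p"
      unfolding tp using pseudo_bundle_explicit_tensor smooth_tensor_explicit by blast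
    then show "formal_class_plot V (\<lambda>l. l = r) (\<lambda>x. tensor_class (fib V x)) n U p"
      by (simp add: explicit_tensor_diff_def)
  next
    assume p: "formal_class_plot V (\<lambda>l. l = r) (\<lambda>x. tensor_class (fib V x)) n U p"
    show "plot (total_sp (tensor_power_bundle V r)) n U p"
      unfolding tp
    proof (intro allI impI)
      fix D assume D: "pseudo_bundle (tensor_power_with V r D) \<and>
        smooth_map (fibre_power V r) D (\<lambda>(x, vs). (x, tensor_of (fib V x) vs))"
      then have "diffeological_space D"
        using pseudo_bundle.total_diffeology[of "tensor_power_with V r D"] by (simp add: tensor_power_with_def)
      then interpret total': diffeological_space D .
      show "plot D n U p"
      proof (rule total'.plot_local[OF formal_class_plot_open[OF p]])
        fix u assume u: "u \<in> U"
        obtain W x ts where W: "openin (Euclidean_space n) W" "u \<in> W" "W \<subseteq> U"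
          and ts: "formal_plot V n W x ts" and l: "\<And>c vs. (c, vs) \<in> set ts \<Longrightarrow> length vs = r"
          and e: "\<And>w. w \<in> W \<Longrightarrow> p w = (x w, tensor_class (fib V (x w)) (formal_sum ts w))"
          by (rule formal_class_plotE[OF p u]) blast
        have "plot D n W (\<lambda>w. (x w, tensor_class (fib V (x w)) (formal_sum ts w)))"
          by (rule formal_plot_in_tensor_power[OF conjunct1[OF D] conjunct2[OF D] ts l])
        then have "plot D n W p" using e by (rule total'.plot_cong)
        with W show "\<exists>W. openin (Euclidean_space n) W \<and> u \<in> W \<and> W \<subseteq> U \<and> plot D n W p" by blast
      qed
    qed
  qed
qed

text \<open>Finitely many homogeneous lists are concatenated into one; conversely a list is split by
  the lengths of its words.\<close>

lemma plot_tensor_algebra_iff: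
  "plot (total_sp (tensor_algebra_bundle V)) n U p \<longleftrightarrow>
     formal_class_plot V (\<lambda>_. True) (\<lambda>x. tensor_class (fib V x)) n U p"
proof -
  let ?T = "\<lambda>n W q r. plot (total_sp (tensor_power_bundle V r)) n W (q r)"
  have ta: "plot (total_sp (tensor_algebra_bundle V)) n U p \<longleftrightarrow> openin (Euclidean_space n) U \<and>
           (\<forall>u\<in>U. \<exists>W N q. openin (Euclidean_space n) W \<and> u \<in> W \<and> W \<subseteq> U \<and>
              (\<forall>r\<le>N. ?T n W q r) \<and>
              (\<forall>w\<in>W. (\<forall>r\<le>N. fst (q r w) = fst (p w)) \<and>
                 snd (p w) = finsum (tensor_algebra (fib V (fst (p w)))) (\<lambda>r. snd (q r w)) {..N}))"
    by (simp add: tensor_algebra_bundle_def)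
  show ?thesis
  proof
    assume p: "plot (total_sp (tensor_algebra_bundle V)) n U p"
    show "formal_class_plot V (\<lambda>_. True) (\<lambda>x. tensor_class (fib V x)) n U p"
    proof (rule formal_class_plot_local)
      show "openin (Euclidean_space n) U" using p ta by blast
      fix u assume "u \<in> U"
      then obtain W N q where W: "openin (Euclidean_space n) W" "u \<in> W" "W \<subseteq> U"
        and q: "\<And>r. r \<le> N \<Longrightarrow> ?T n W q r"
        and qp: "\<And>w r. w \<in> W \<Longrightarrow> r \<le> N \<Longrightarrow> fst (q r w) = fst (p w)"
        and s: "\<And>w. w \<in> W \<Longrightarrow> snd (p w) = finsum (tensor_algebra (fib V (fst (p w)))) (\<lambda>r. snd (q r w)) {..N}"
        using p unfolding ta by metis
      have "\<exists>W' x ts. openin (Euclidean_space n) W' \<and> u \<in> W' \<and> W' \<subseteq> W \<and> formal_plot V n W' x ts \<and>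
          (\<forall>w\<in>W'. q r w = (x w, tensor_class (fib V (x w)) (formal_sum ts w)))" if "r \<in> {..N}" for r
      proof -
        have r: "r \<le> N" using that by simp
        show ?thesis
          by (rule formal_class_plotE[OF q[OF r, unfolded plot_tensor_power_iff] W(2)]) blast
      qed
      \<comment> \<open>Neighbourhood, base plot and terms are chosen for each degree by three
        successive uses of choice.\<close>
      then have "\<forall>r\<in>{..N}. \<exists>W' x ts. openin (Euclidean_space n) W' \<and> u \<in> W' \<and> W' \<subseteq> W \<and> formal_plot V n W' x ts \<and>
          (\<forall>w\<in>W'. q r w = (x w, tensor_class (fib V (x w)) (formal_sum ts w)))" by blast
      then obtain W' where "\<forall>r\<in>{..N}. \<exists>x ts. openin (Euclidean_space n) (W' r) \<and> u \<in> W' r \<and> W' r \<subseteq> W \<and> formal_plot V n (W' r) x ts \<and>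
          (\<forall>w\<in>W' r. q r w = (x w, tensor_class (fib V (x w)) (formal_sum ts w)))"
        by (rule bchoice[THEN exE])
      then obtain x where "\<forall>r\<in>{..N}. \<exists>ts. openin (Euclidean_space n) (W' r) \<and> u \<in> W' r \<and> W' r \<subseteq> W \<and> formal_plot V n (W' r) (x r) ts \<and>
          (\<forall>w\<in>W' r. q r w = (x r w, tensor_class (fib V (x r w)) (formal_sum ts w)))"
        by (rule bchoice[THEN exE])
      then obtain ts where "\<forall>r\<in>{..N}. openin (Euclidean_space n) (W' r) \<and> u \<in> W' r \<and> W' r \<subseteq> W \<and> formal_plot V n (W' r) (x r) (ts r) \<and>
          (\<forall>w\<in>W' r. q r w = (x r w, tensor_class (fib V (x r w)) (formal_sum (ts r) w)))"
        by (rule bchoice[THEN exE])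
      then have W': "\<And>r. r \<le> N \<Longrightarrow> openin (Euclidean_space n) (W' r)" "\<And>r. r \<le> N \<Longrightarrow> u \<in> W' r"
        "\<And>r. r \<le> N \<Longrightarrow> W' r \<subseteq> W" "\<And>r. r \<le> N \<Longrightarrow> formal_plot V n (W' r) (x r) (ts r)"
        "\<And>r w. r \<le> N \<Longrightarrow> w \<in> W' r \<Longrightarrow> q r w = (x r w, tensor_class (fib V (x r w)) (formal_sum (ts r) w))"
        by simp_all
      \<comment> \<open>A finite intersection remains open. Degree 0 is present for every
        \<open>N\<close>, and its base plot serves all degrees: on \<open>?W\<close> each of them
        equals the first component of \<open>p\<close>.\<close>
      let ?W = "\<Inter>r\<in>{..N}. W' r"
      let ?ts = "concat (map ts [0..<Suc N])"
      have o: "openin (Euclidean_space n) ?W"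
        by (rule openin_INT2) (use W'(1) in auto)
      have in_W: "w \<in> W" if "w \<in> ?W" for w using W'(3)[of 0] that by auto
      have xp: "x r w = fst (p w)" if "r \<le> N" "w \<in> ?W" for r w
        using W'(5)[OF that(1), of w] qp[OF in_W[OF that(2)] that(1)] that by auto
      have fp: "formal_plot V n ?W (x 0) (ts r)" if r: "r \<le> N" for r
      proof (rule formal_plot_cong)
        show "formal_plot V n ?W (x r) (ts r)" using W'(4)[OF r] o by (rule formal_plot_restrict) (use r in auto)
        show "x 0 w = x r w" if "w \<in> ?W" for w using xp[OF r that] xp[of 0, OF _ that] by simp
      qed
      have "formal_class_plot V (\<lambda>_. True) (\<lambda>x. tensor_class (fib V x)) n ?W p"
      proof (rule formal_class_plotI[OF o])
        have "formal_plot V n ?W (x 0) (concat (map ts [0..<k]))" if "k \<le> Suc N" for k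
          using that
        proof (induction k)
          case 0
          show ?case using formal_plotD(1)[OF fp[of 0]] by (simp add: formal_plot_def)
        next
          case (Suc k)
          then show ?case using fp[of k] by (simp add: formal_plot_append)
        qed
        then show fpc: "formal_plot V n ?W (x 0) ?ts" by blast
        fix w assume w: "w \<in> ?W"
        have x0: "fst (p w) = x 0 w" using xp[of 0, OF _ w] by simp
        have "x 0 w \<in> points (base_sp V)" using formal_plotD(1)[OF fpc] w by (rule base.plot_in_points)
        then have M: "vectorspace class_ring (fib V (x 0 w))" by (rule fib_vectorspace)
        have cl: "formal_sum (ts r) w \<in> carrier (free_alg (carrier (fib V (x 0 w))))" if "r \<le> N" for r
          using fp[OF that] w by (rule formal_sum_closed)
        have sq: "snd (q r w) = tensor_class (fib V (x 0 w)) (formal_sum (ts r) w)" if "r \<le> N" for r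
          using W'(5)[OF that, of w] w that xp[OF that w] x0 by simp
        have "snd (p w) = finsum (tensor_algebra (fib V (x 0 w))) (\<lambda>r. snd (q r w)) {..N}"
          using s[OF in_W[OF w]] x0 by simp
        also have "\<dots> = finsum (tensor_algebra (fib V (x 0 w))) (\<lambda>r. tensor_class (fib V (x 0 w)) (formal_sum (ts r) w)) {..N}"
        proof -
          interpret T: ring "tensor_algebra (fib V (x 0 w))" using M by (rule ring_tensor_algebra)
          show ?thesis
            by (rule T.finsum_cong') (use sq cl tensor_class_closed[OF M] in auto)
        qed
        also have "\<dots> = tensor_class (fib V (x 0 w)) (\<Sum>r\<le>N. formal_sum (ts r) w)"
          by (rule finsum_tensor_class[OF M]) (use cl in auto)
        also have "(\<Sum>r\<le>N. formal_sum (ts r) w) = formal_sum ?ts w"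
          by (simp only: formal_sum_concat map_map comp_def interv_sum_list_conv_sum_set_nat
            lessThan_Suc_atMost[symmetric] atLeast0LessThan set_upt)
        finally show "p w = (x 0 w, tensor_class (fib V (x 0 w)) (formal_sum ?ts w))"
          using x0 by (simp add: prod_eq_iff)
      qed simp
      moreover have "u \<in> ?W" using W'(2) by auto
      moreover have "?W \<subseteq> U" using in_W W(3) by blast
      ultimately show "\<exists>W. openin (Euclidean_space n) W \<and> u \<in> W \<and> W \<subseteq> U \<and>
          formal_class_plot V (\<lambda>_. True) (\<lambda>x. tensor_class (fib V x)) n W p" using o by blast
    qed
  next
    assume p: "formal_class_plot V (\<lambda>_. True) (\<lambda>x. tensor_class (fib V x)) n U p"
    show "plot (total_sp (tensor_algebra_bundle V)) n U p"
      unfolding ta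
    proof (intro conjI ballI formal_class_plot_open[OF p])
      fix u assume u: "u \<in> U"
      obtain W x ts where W: "openin (Euclidean_space n) W" "u \<in> W" "W \<subseteq> U"
        and ts: "formal_plot V n W x ts"
        and e: "\<And>w. w \<in> W \<Longrightarrow> p w = (x w, tensor_class (fib V (x w)) (formal_sum ts w))"
        by (rule formal_class_plotE[OF p u]) blast
      \<comment> \<open>The greatest word length; inserting 0 covers the empty list, for which the
        set of lengths has no maximum.\<close>
      let ?N = "Max (insert 0 ((\<lambda>(c, vs). length vs) ` set ts))"
      let ?ts = "\<lambda>r. filter (\<lambda>(c, vs). length vs = r) ts"
      let ?q = "\<lambda>r w. (x w, tensor_class (fib V (x w)) (formal_sum (?ts r) w))"
      have N: "length vs \<le> ?N" if "(c, vs) \<in> set ts" for c vs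
        by (rule Max_ge) (use that in force)+
      note ts' = formal_plotD[OF ts]
      have fp: "formal_plot V n W x (?ts r)" for r
        by (rule formal_plotI) (use ts' in auto)
      have "?T n W ?q r" for r
        unfolding plot_tensor_power_iff by (rule formal_class_plotI[OF W(1) fp]) auto
      moreover have "snd (p w) = finsum (tensor_algebra (fib V (fst (p w)))) (\<lambda>r. snd (?q r w)) {..?N}"
        if w: "w \<in> W" for w
      proof -
        have M: "vectorspace class_ring (fib V (x w))"
          by (rule fib_vectorspace[OF base.plot_in_points[OF ts'(1) w]])
        have "finsum (tensor_algebra (fib V (x w))) (\<lambda>r. tensor_class (fib V (x w)) (formal_sum (?ts r) w)) {..?N} =
            tensor_class (fib V (x w)) (\<Sum>r\<le>?N. formal_sum (?ts r) w)"
          by (rule finsum_tensor_class[OF M]) (use formal_sum_closed[OF fp w] in auto)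
        also have "(\<Sum>r\<le>?N. formal_sum (?ts r) w) = formal_sum ts w" using N by (rule formal_sum_filter)
        finally show ?thesis using e[OF w] by simp
      qed
      moreover have "fst (?q r w) = fst (p w)" if "w \<in> W" for r w using e[OF that] by simp
      ultimately show "\<exists>W N q. openin (Euclidean_space n) W \<and> u \<in> W \<and> W \<subseteq> U \<and>
              (\<forall>r\<le>N. ?T n W q r) \<and>
              (\<forall>w\<in>W. (\<forall>r\<le>N. fst (q r w) = fst (p w)) \<and>
                 snd (p w) = finsum (tensor_algebra (fib V (fst (p w)))) (\<lambda>r. snd (q r w)) {..N})"
        using W by (intro exI[of _ W] exI[of _ ?N] exI[of _ ?q]) simp
    qed
  qed
qed

text \<open>Pushing forward along the quotient map leaves the lists of terms as they are and
  replaces the tensor class by the Clifford class.\<close>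

lemma plot_clifford_iff:
  "plot (total_sp (clifford_bundle V b)) n U p \<longleftrightarrow>
     formal_class_plot V (\<lambda>_. True) (\<lambda>x. clifford_of (fib V x) (b x)) n U p"
proof -
  let ?h = "\<lambda>(x, t). (x, clifford_class (fib V x) (b x) t)"
  have cb: "plot (total_sp (clifford_bundle V b)) n U p \<longleftrightarrow> openin (Euclidean_space n) U \<and>
        (\<forall>u\<in>U. \<exists>W q. openin (Euclidean_space n) W \<and> u \<in> W \<and> W \<subseteq> U \<and>
           formal_class_plot V (\<lambda>_. True) (\<lambda>x. tensor_class (fib V x)) n W q \<and> (\<forall>w\<in>W. p w = ?h (q w)))"
    by (simp add: clifford_bundle_def quot_diff_def plot_tensor_algebra_iff)
  show ?thesis
  proof
    assume p: "plot (total_sp (clifford_bundle V b)) n U p"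
    show "formal_class_plot V (\<lambda>_. True) (\<lambda>x. clifford_of (fib V x) (b x)) n U p"
    proof (rule formal_class_plot_local)
      show "openin (Euclidean_space n) U" using p cb by blast
      fix u assume "u \<in> U"
      then obtain W q where W: "openin (Euclidean_space n) W" "u \<in> W" "W \<subseteq> U"
        and q: "formal_class_plot V (\<lambda>_. True) (\<lambda>x. tensor_class (fib V x)) n W q"
        and pq: "\<And>w. w \<in> W \<Longrightarrow> p w = ?h (q w)"
        using p unfolding cb by blast
      obtain W' x ts where W': "openin (Euclidean_space n) W'" "u \<in> W'" "W' \<subseteq> W"
        and ts: "formal_plot V n W' x ts"
        and e: "\<And>w. w \<in> W' \<Longrightarrow> q w = (x w, tensor_class (fib V (x w)) (formal_sum ts w))"
        by (rule formal_class_plotE[OF q W(2)]) blast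
      have "formal_class_plot V (\<lambda>_. True) (\<lambda>x. clifford_of (fib V x) (b x)) n W' p"
      proof (rule formal_class_plotI[OF W'(1) ts])
        show "p w = (x w, clifford_of (fib V (x w)) (b (x w)) (formal_sum ts w))" if "w \<in> W'" for w
          using pq[of w] e[OF that] W'(3) that by (auto simp: clifford_of_def)
      qed simp
      with W W' show "\<exists>W. openin (Euclidean_space n) W \<and> u \<in> W \<and> W \<subseteq> U \<and>
          formal_class_plot V (\<lambda>_. True) (\<lambda>x. clifford_of (fib V x) (b x)) n W p" by blast
    qed
  next
    assume p: "formal_class_plot V (\<lambda>_. True) (\<lambda>x. clifford_of (fib V x) (b x)) n U p"
    show "plot (total_sp (clifford_bundle V b)) n U p"
      unfolding cb
    proof (intro conjI ballI formal_class_plot_open[OF p])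
      fix u assume u: "u \<in> U"
      obtain W x ts where W: "openin (Euclidean_space n) W" "u \<in> W" "W \<subseteq> U"
        and ts: "formal_plot V n W x ts"
        and e: "\<And>w. w \<in> W \<Longrightarrow> p w = (x w, clifford_of (fib V (x w)) (b (x w)) (formal_sum ts w))"
        by (rule formal_class_plotE[OF p u]) blast
      have "formal_class_plot V (\<lambda>_. True) (\<lambda>x. tensor_class (fib V x)) n W
          (\<lambda>w. (x w, tensor_class (fib V (x w)) (formal_sum ts w)))"
        by (rule formal_class_plotI[OF W(1) ts]) auto
      moreover have "p w = ?h (x w, tensor_class (fib V (x w)) (formal_sum ts w))" if "w \<in> W" for w
        using e[OF that] by (simp add: clifford_of_def)
      ultimately show "\<exists>W q. openin (Euclidean_space n) W \<and> u \<in> W \<and> W \<subseteq> U \<and>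
           formal_class_plot V (\<lambda>_. True) (\<lambda>x. tensor_class (fib V x)) n W q \<and> (\<forall>w\<in>W. p w = ?h (q w))"
        using W by (intro exI[of _ W] exI[of _ "\<lambda>w. (x w, tensor_class (fib V (x w)) (formal_sum ts w))"]) simp
    qed
  qed
qed

lemma clifford_pointI:
  assumes "x \<in> points (base_sp V)" "a \<in> carrier (free_alg (carrier (fib V x)))"
  shows "(x, clifford_of (fib V x) (b x) a) \<in> points (total_sp (clifford_bundle V b))"
proof -
  have "(x, tensor_class (fib V x) a) \<in> points (total_sp (tensor_algebra_bundle V))"
    using assms tensor_class_closed[OF fib_vectorspace] by (simp add: tensor_algebra_bundle_def)
  then show ?thesis
    by (force simp: clifford_bundle_def quot_diff_def clifford_of_def)
qed

lemma clifford_pointE: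
  assumes "y \<in> points (total_sp (clifford_bundle V b))"
  obtains x a where "x \<in> points (base_sp V)" "a \<in> carrier (free_alg (carrier (fib V x)))"
    "y = (x, clifford_of (fib V x) (b x) a)"
proof -
  obtain x t where x: "x \<in> points (base_sp V)" and t: "t \<in> carrier (tensor_algebra (fib V x))"
    and y: "y = (x, clifford_class (fib V x) (b x) t)"
    using assms by (auto simp: clifford_bundle_def quot_diff_def tensor_algebra_bundle_def)
  obtain a where "a \<in> carrier (free_alg (carrier (fib V x)))" "t = tensor_class (fib V x) a"
    using t unfolding carrier_tensor_algebra[OF fib_vectorspace[OF x]] by (rule imageE)
  then show thesis using that[OF x] y by (simp add: clifford_of_def)
qed

end

section \<open>Gluing\<close>

text \<open>The normal form of a point of the disjoint union, for the relation generated by \<open>z \<sim> h z\<close>.\<close>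

definition glue_rep :: "'a set \<Rightarrow> ('a \<Rightarrow> 'b) \<Rightarrow> 'a + 'b \<Rightarrow> 'a + 'b" where
  "glue_rep A h z = (case z of Inl y \<Rightarrow> if y \<in> A then Inr (h y) else Inl y | Inr x \<Rightarrow> Inr x)"

lemma glue_rep_simps [simp]:
  "y \<in> A \<Longrightarrow> glue_rep A h (Inl y) = Inr (h y)" "y \<notin> A \<Longrightarrow> glue_rep A h (Inl y) = Inl y"
  "glue_rep A h (Inr x) = Inr x"
  by (simp_all add: glue_rep_def)

text \<open>The normal form is constant along the generating relation, and every point is related to
  its normal form.\<close>

lemma equivclp_glue_iff:
  "equivclp (\<lambda>a b. \<exists>y\<in>A. a = Inl y \<and> b = Inr (h y)) z z' \<longleftrightarrow> glue_rep A h z = glue_rep A h z'"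
proof
  let ?R = "\<lambda>a b. \<exists>y\<in>A. a = Inl y \<and> b = Inr (h y)"
  assume "equivclp ?R z z'"
  then show "glue_rep A h z = glue_rep A h z'"
    by (induction rule: equivclp_induct) auto
next
  let ?R = "\<lambda>a b. \<exists>y\<in>A. a = Inl y \<and> b = Inr (h y)"
  have rep: "equivclp ?R z (glue_rep A h z)" for z
    by (cases z) (auto simp: glue_rep_def intro: r_into_equivclp)
  assume eq: "glue_rep A h z = glue_rep A h z'"
  show "equivclp ?R z z'"
    by (rule equivclp_trans[OF rep[of z, unfolded eq] equivclp_sym[OF rep[of z']]])
qed

lemma glue_class_eq: "glue_class D1 D2 A h z = {z' \<in> Sum_Type.Plus (points D1) (points D2). glue_rep A h z = glue_rep A h z'}"
  by (simp add: glue_class_def equivclp_glue_iff)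

text \<open>Membership of one representative suffices: it lies in its own class, hence in the equal
  one.\<close>

lemma glue_class_eq_iff:
  "z \<in> Sum_Type.Plus (points D1) (points D2) \<Longrightarrow> glue_class D1 D2 A h z = glue_class D1 D2 A h z' \<longleftrightarrow> glue_rep A h z = glue_rep A h z'"
proof
  assume "z \<in> Sum_Type.Plus (points D1) (points D2)" "glue_class D1 D2 A h z = glue_class D1 D2 A h z'"
  then have "z \<in> glue_class D1 D2 A h z'" unfolding glue_class_eq by blast
  then show "glue_rep A h z = glue_rep A h z'" unfolding glue_class_eq by simp
qed (simp add: glue_class_eq)

lemma glue_class_congI:
  "glue_rep A h z = glue_rep A h z' \<Longrightarrow> glue_class D1 D2 A h z = glue_class D1 D2 A h z'"
  unfolding glue_class_eq by auto

section \<open>Points of a glued space\<close>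

lemma incl1_eq_incl2: "y \<in> A \<Longrightarrow> incl1 D1 D2 A h y = incl2 D1 D2 A h (h y)"
  unfolding incl1_def incl2_def by (rule glue_class_congI) simp

lemma incl2_eq_iff: "x \<in> points D2 \<Longrightarrow> incl2 D1 D2 A h x = incl2 D1 D2 A h x' \<longleftrightarrow> x = x'"
  unfolding incl2_def by (subst glue_class_eq_iff) auto

lemma incl1_eq_incl2_iff:
  "y \<in> points D1 \<Longrightarrow> incl1 D1 D2 A h y = incl2 D1 D2 A h x \<longleftrightarrow> y \<in> A \<and> h y = x"
  unfolding incl1_def incl2_def by (subst glue_class_eq_iff) (auto simp: glue_rep_def)

lemma incl1_eq_iff:
  "y \<in> points D1 \<Longrightarrow> incl1 D1 D2 A h y = incl1 D1 D2 A h y' \<longleftrightarrow> y = y' \<or> y \<in> A \<and> y' \<in> A \<and> h y = h y'"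
  unfolding incl1_def by (subst glue_class_eq_iff) (auto simp: glue_rep_def)

lemma inj_on_incl1: "inj_on (incl1 D1 D2 A h) (points D1 - A)"
  by (rule inj_onI) (auto simp: incl1_eq_iff)

lemma inj_on_incl2: "inj_on (incl2 D1 D2 A h) (points D2)"
  by (rule inj_onI) (auto simp: incl2_eq_iff)

lemma incl1_inv_incl1: "y \<in> points D1 - A \<Longrightarrow> incl1_inv D1 D2 A h (incl1 D1 D2 A h y) = y"
  unfolding incl1_inv_def by (rule inv_into_f_f[OF inj_on_incl1])

lemma incl2_inv_incl2: "x \<in> points D2 \<Longrightarrow> incl2_inv D1 D2 A h (incl2 D1 D2 A h x) = x"
  unfolding incl2_inv_def by (rule inv_into_f_f[OF inj_on_incl2])

lemma points_glue: "points (glue_diff D1 D2 A h) = incl1 D1 D2 A h ` points D1 \<union> incl2 D1 D2 A h ` points D2"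
  by (auto simp: glue_diff_def quot_diff_def sum_diff_def incl1_def incl2_def Plus_def image_Un image_image)

text \<open>A left-hand point of \<open>A\<close> is identified with its image on the right, so the
  left case may be taken off \<open>A\<close>.\<close>

lemma points_glue_cases:
  assumes "c \<in> points (glue_diff D1 D2 A h)" "h ` A \<subseteq> points D2"
  obtains y where "y \<in> points D1 - A" "c = incl1 D1 D2 A h y" | x where "x \<in> points D2" "c = incl2 D1 D2 A h x"
proof -
  from assms(1)[unfolded points_glue] show thesis
  proof (elim UnE imageE)
    fix y assume y: "y \<in> points D1" "c = incl1 D1 D2 A h y"
    show thesis
    proof (cases "y \<in> A")
      case True
      have "h y \<in> points D2" using assms(2) True by blast
      then show ?thesis by (rule that(2)) (use y(2) incl1_eq_incl2[OF True] in simp)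
    next
      case False
      then show ?thesis using y that(1)[of y] by simp
    qed
  next
    fix x assume "x \<in> points D2" "c = incl2 D1 D2 A h x"
    then show thesis by (rule that(2))
  qed
qed

text \<open>Isolated from \<open>plot_system\<close> because it is immediate for the total spaces of
  Clifford bundles, whose plots are described by \<open>plot_clifford_iff\<close>.\<close>

definition open_plots :: "'a diffsp \<Rightarrow> bool" where
  "open_plots D \<longleftrightarrow> (\<forall>n U p. plot D n U p \<longrightarrow> openin (Euclidean_space n) U)"

lemma (in plot_system) open_plots: "open_plots D"
  unfolding open_plots_def using plot_open by blast

text \<open>The quotient and the disjoint union both impose local conditions, so the two successive
  neighbourhoods can be merged into one on which the plot lifts to a single side.\<close>

lemma plot_glue_iff:
  assumes "open_plots D1" "open_plots D2"
  shows "plot (glue_diff D1 D2 A h) n U p \<longleftrightarrow> openin (Euclidean_space n) U \<and>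
    (\<forall>u\<in>U. \<exists>W. openin (Euclidean_space n) W \<and> u \<in> W \<and> W \<subseteq> U \<and>
      ((\<exists>q. plot D1 n W q \<and> (\<forall>w\<in>W. p w = incl1 D1 D2 A h (q w))) \<or>
       (\<exists>q. plot D2 n W q \<and> (\<forall>w\<in>W. p w = incl2 D1 D2 A h (q w)))))"
  (is "_ \<longleftrightarrow> _ \<and> (\<forall>u\<in>U. \<exists>W. ?L u W)")
proof -
  have g: "plot (glue_diff D1 D2 A h) n U p \<longleftrightarrow> openin (Euclidean_space n) U \<and>
    (\<forall>u\<in>U. \<exists>W q. openin (Euclidean_space n) W \<and> u \<in> W \<and> W \<subseteq> U \<and> plot (sum_diff D1 D2) n W q \<and>
      (\<forall>w\<in>W. p w = glue_class D1 D2 A h (q w)))"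
    by (simp add: glue_diff_def quot_diff_def)
  have "(\<exists>W q. openin (Euclidean_space n) W \<and> u \<in> W \<and> W \<subseteq> U \<and> plot (sum_diff D1 D2) n W q \<and>
      (\<forall>w\<in>W. p w = glue_class D1 D2 A h (q w))) \<longleftrightarrow> (\<exists>W. ?L u W)" for u
  proof
    assume "\<exists>W q. openin (Euclidean_space n) W \<and> u \<in> W \<and> W \<subseteq> U \<and> plot (sum_diff D1 D2) n W q \<and>
      (\<forall>w\<in>W. p w = glue_class D1 D2 A h (q w))"
    then obtain W q where W: "u \<in> W" "W \<subseteq> U" and q: "plot (sum_diff D1 D2) n W q"
      and e: "\<And>w. w \<in> W \<Longrightarrow> p w = glue_class D1 D2 A h (q w)" by blast
    from q W(1) obtain W' where W': "openin (Euclidean_space n) W'" "u \<in> W'" "W' \<subseteq> W"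
      and c: "(\<exists>r. plot D1 n W' r \<and> (\<forall>w\<in>W'. q w = Inl (r w))) \<or> (\<exists>r. plot D2 n W' r \<and> (\<forall>w\<in>W'. q w = Inr (r w)))"
      unfolding sum_diff_def diffsp.simps by blast
    have e': "p w = glue_class D1 D2 A h (q w)" if "w \<in> W'" for w using e W'(3) that by blast
    from c have "(\<exists>q. plot D1 n W' q \<and> (\<forall>w\<in>W'. p w = incl1 D1 D2 A h (q w))) \<or>
       (\<exists>q. plot D2 n W' q \<and> (\<forall>w\<in>W'. p w = incl2 D1 D2 A h (q w)))"
    proof
      assume "\<exists>r. plot D1 n W' r \<and> (\<forall>w\<in>W'. q w = Inl (r w))"
      then obtain r where "plot D1 n W' r" "\<forall>w\<in>W'. q w = Inl (r w)" by blast
      then show ?thesis using e' by (intro disjI1 exI[of _ r]) (simp add: incl1_def)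
    next
      assume "\<exists>r. plot D2 n W' r \<and> (\<forall>w\<in>W'. q w = Inr (r w))"
      then obtain r where "plot D2 n W' r" "\<forall>w\<in>W'. q w = Inr (r w)" by blast
      then show ?thesis using e' by (intro disjI2 exI[of _ r]) (simp add: incl2_def)
    qed
    then show "\<exists>W. ?L u W" using W W' by (intro exI[of _ W']) blast
  next
    assume "\<exists>W. ?L u W"
    then obtain W where W: "openin (Euclidean_space n) W" "u \<in> W" "W \<subseteq> U"
      and c: "(\<exists>q. plot D1 n W q \<and> (\<forall>w\<in>W. p w = incl1 D1 D2 A h (q w))) \<or>
       (\<exists>q. plot D2 n W q \<and> (\<forall>w\<in>W. p w = incl2 D1 D2 A h (q w)))" by blast
    from c have "\<exists>q. plot (sum_diff D1 D2) n W q \<and> (\<forall>w\<in>W. p w = glue_class D1 D2 A h (q w))"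
    proof
      assume "\<exists>q. plot D1 n W q \<and> (\<forall>w\<in>W. p w = incl1 D1 D2 A h (q w))"
      then obtain q where "plot D1 n W q" "\<forall>w\<in>W. p w = incl1 D1 D2 A h (q w)" by blast
      then show ?thesis using W(1)
        by (intro exI[of _ "\<lambda>w. Inl (q w)"]) (auto simp: sum_diff_def incl1_def)
    next
      assume "\<exists>q. plot D2 n W q \<and> (\<forall>w\<in>W. p w = incl2 D1 D2 A h (q w))"
      then obtain q where "plot D2 n W q" "\<forall>w\<in>W. p w = incl2 D1 D2 A h (q w)" by blast
      then show ?thesis using W(1)
        by (intro exI[of _ "\<lambda>w. Inr (q w)"]) (auto simp: sum_diff_def incl2_def)
    qed
    then show "\<exists>W q. openin (Euclidean_space n) W \<and> u \<in> W \<and> W \<subseteq> U \<and> plot (sum_diff D1 D2) n W q \<and>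
      (\<forall>w\<in>W. p w = glue_class D1 D2 A h (q w))" using W by blast
  qed
  then show ?thesis unfolding g by simp
qed

text \<open>Locality comes from the local description of the plots of a gluing, so \<open>D1\<close>
  and \<open>D2\<close> may be mere plot systems. In this way the total space of glued dual families
  is a genuine diffeological space.\<close>

lemma diffeological_space_glue:
  assumes "plot_system D1" "plot_system D2"
  shows "diffeological_space (glue_diff D1 D2 A h)"
proof -
  interpret D1: plot_system D1 by fact
  interpret D2: plot_system D2 by fact
  note pl = plot_glue_iff[OF D1.open_plots D2.open_plots]
  let ?D = "glue_diff D1 D2 A h"
  have glue_local: "plot ?D n U p" if U: "openin (Euclidean_space n) U"
    and loc: "\<And>u. u \<in> U \<Longrightarrow> \<exists>W. openin (Euclidean_space n) W \<and> u \<in> W \<and> W \<subseteq> U \<and> plot ?D n W p" for n U p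
    unfolding pl
  proof (intro conjI ballI U)
    fix u assume "u \<in> U"
    then obtain W where W: "u \<in> W" "W \<subseteq> U" "plot ?D n W p" using loc by blast
    then show "\<exists>W. openin (Euclidean_space n) W \<and> u \<in> W \<and> W \<subseteq> U \<and>
      ((\<exists>q. plot D1 n W q \<and> (\<forall>w\<in>W. p w = incl1 D1 D2 A h (q w))) \<or>
       (\<exists>q. plot D2 n W q \<and> (\<forall>w\<in>W. p w = incl2 D1 D2 A h (q w))))"
      unfolding pl by (meson order_trans)
  qed
  have glue1: "plot ?D n W (\<lambda>w. incl1 D1 D2 A h (q w))" if "plot D1 n W q" for n W q
    unfolding pl using that D1.plot_open[OF that] by blast
  have glue2: "plot ?D n W (\<lambda>w. incl2 D1 D2 A h (q w))" if "plot D2 n W q" for n W q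
    unfolding pl using that D2.plot_open[OF that] by blast
  have glue_cong: "plot ?D n U q" if "plot ?D n U p" "\<And>u. u \<in> U \<Longrightarrow> q u = p u" for n U p q
    unfolding pl
  proof (intro conjI ballI)
    show "openin (Euclidean_space n) U" using that(1) unfolding pl by blast
    fix u assume "u \<in> U"
    with that(1) obtain W where W: "openin (Euclidean_space n) W" "u \<in> W" "W \<subseteq> U"
      and c: "(\<exists>q. plot D1 n W q \<and> (\<forall>w\<in>W. p w = incl1 D1 D2 A h (q w))) \<or>
       (\<exists>q. plot D2 n W q \<and> (\<forall>w\<in>W. p w = incl2 D1 D2 A h (q w)))" unfolding pl by blast
    have "q w = p w" if "w \<in> W" for w using that W(3) \<open>\<And>u. u \<in> U \<Longrightarrow> q u = p u\<close> by blast
    with c have "(\<exists>r. plot D1 n W r \<and> (\<forall>w\<in>W. q w = incl1 D1 D2 A h (r w))) \<or>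
       (\<exists>r. plot D2 n W r \<and> (\<forall>w\<in>W. q w = incl2 D1 D2 A h (r w)))" by simp
    then show "\<exists>W. openin (Euclidean_space n) W \<and> u \<in> W \<and> W \<subseteq> U \<and>
      ((\<exists>r. plot D1 n W r \<and> (\<forall>w\<in>W. q w = incl1 D1 D2 A h (r w))) \<or>
       (\<exists>r. plot D2 n W r \<and> (\<forall>w\<in>W. q w = incl2 D1 D2 A h (r w))))" using W by blast
  qed
  show ?thesis
  proof
    fix n m U W p q F x
    show op: "openin (Euclidean_space n) U" if "plot ?D n U p"
      using that unfolding pl by blast
    show "p ` U \<subseteq> points ?D" if p: "plot ?D n U p"
    proof
      fix y assume "y \<in> p ` U"
      then obtain u where u: "u \<in> U" "y = p u" by blast
      with p obtain W where W: "u \<in> W"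
        and c: "(\<exists>q. plot D1 n W q \<and> (\<forall>w\<in>W. p w = incl1 D1 D2 A h (q w))) \<or>
         (\<exists>q. plot D2 n W q \<and> (\<forall>w\<in>W. p w = incl2 D1 D2 A h (q w)))" unfolding pl by blast
      from c show "y \<in> points ?D"
      proof
        assume "\<exists>q. plot D1 n W q \<and> (\<forall>w\<in>W. p w = incl1 D1 D2 A h (q w))"
        then obtain q where q: "plot D1 n W q" "p u = incl1 D1 D2 A h (q u)" using W by blast
        then show ?thesis using D1.plot_in_points[OF q(1) W] u(2) unfolding points_glue by blast
      next
        assume "\<exists>q. plot D2 n W q \<and> (\<forall>w\<in>W. p w = incl2 D1 D2 A h (q w))"
        then obtain q where q: "plot D2 n W q" "p u = incl2 D1 D2 A h (q u)" using W by blast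
        then show ?thesis using D2.plot_in_points[OF q(1) W] u(2) unfolding points_glue by blast
      qed
    qed
    show "plot ?D n U q" if "plot ?D n U p" "\<And>u. u \<in> U \<Longrightarrow> q u = p u"
      using that by (rule glue_cong)
    show "plot ?D n U (\<lambda>_. x)" if U: "openin (Euclidean_space n) U" and x: "x \<in> points ?D"
      using x glue1[OF D1.plot_const[OF U]] glue2[OF D2.plot_const[OF U]] unfolding points_glue by blast
    show "plot ?D n U p" if "openin (Euclidean_space n) U"
      "\<And>u. u \<in> U \<Longrightarrow> \<exists>W. openin (Euclidean_space n) W \<and> u \<in> W \<and> W \<subseteq> U \<and> plot ?D n W p"
      using that by (rule glue_local)
    show "plot ?D m W (\<lambda>w. p (F w))"
      if p: "plot ?D n U p" and W: "openin (Euclidean_space m) W" and F: "Cinf_map m W n U F"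
    proof (rule glue_local[OF W])
      fix w assume w: "w \<in> W"
      then have "F w \<in> U" using F by (auto simp: Cinf_map_def)
      with p obtain U' where U': "openin (Euclidean_space n) U'" "F w \<in> U'" "U' \<subseteq> U"
        and c: "(\<exists>q. plot D1 n U' q \<and> (\<forall>w\<in>U'. p w = incl1 D1 D2 A h (q w))) \<or>
         (\<exists>q. plot D2 n U' q \<and> (\<forall>w\<in>U'. p w = incl2 D1 D2 A h (q w)))" unfolding pl by blast
      let ?W = "{w \<in> W. F w \<in> U'}"
      have "openin (Euclidean_space n) U" using p unfolding pl by blast
      then have W': "openin (Euclidean_space m) ?W"
        using W F U'(1) by (intro openin_vimage_Cinf_map)
      have F': "Cinf_map m ?W n U' F"
        using F Cinf_on_subset[of m W _ ?W] unfolding Cinf_map_def by auto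
      from c have "plot ?D m ?W (\<lambda>w. p (F w))"
      proof
        assume "\<exists>q. plot D1 n U' q \<and> (\<forall>w\<in>U'. p w = incl1 D1 D2 A h (q w))"
        then obtain q where q: "plot D1 n U' q" "\<forall>w\<in>U'. p w = incl1 D1 D2 A h (q w)" by blast
        show ?thesis by (rule glue_cong[OF glue1[OF D1.plot_comp[OF q(1) W' F']]]) (use q(2) in auto)
      next
        assume "\<exists>q. plot D2 n U' q \<and> (\<forall>w\<in>U'. p w = incl2 D1 D2 A h (q w))"
        then obtain q where q: "plot D2 n U' q" "\<forall>w\<in>U'. p w = incl2 D1 D2 A h (q w)" by blast
        show ?thesis by (rule glue_cong[OF glue2[OF D2.plot_comp[OF q(1) W' F']]]) (use q(2) in auto)
      qed
      then show "\<exists>W'. openin (Euclidean_space m) W' \<and> w \<in> W' \<and> W' \<subseteq> W \<and> plot ?D m W' (\<lambda>w. p (F w))"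
        using W' w U'(2) by blast
    qed
  qed
qed

text \<open>As \<open>F\<close> covers \<open>f\<close>, taking normal forms commutes with the
  projections. The projection is therefore constant on classes, and \<open>the_elem\<close> in its
  definition is meaningful.\<close>

lemma prj_glue_bundle:
  assumes pr1: "\<And>v. v \<in> points (total_sp V1) \<Longrightarrow> prj V1 v \<in> points (base_sp V1)"
    and F: "\<And>v. v \<in> over V1 Y \<Longrightarrow> prj V2 (F v) = f (prj V1 v)"
  shows "v \<in> points (total_sp V1) \<Longrightarrow> prj (glue_bundle V1 V2 Y f F) (tot1 V1 V2 Y F v) = bas1 V1 V2 Y f (prj V1 v)"
    and "w \<in> points (total_sp V2) \<Longrightarrow> prj (glue_bundle V1 V2 Y f F) (tot2 V1 V2 Y F w) = bas2 V1 V2 Y f (prj V2 w)"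
proof -
  let ?P = "Sum_Type.Plus (points (total_sp V1)) (points (total_sp V2))"
  let ?m = "map_sum (prj V1) (prj V2)"
  let ?t = "glue_class (total_sp V1) (total_sp V2) (over V1 Y) F"
  let ?b = "glue_class (base_sp V1) (base_sp V2) Y f"
  have rep: "glue_rep Y f (?m z) = ?m (glue_rep (over V1 Y) F z)" if "z \<in> ?P" for z
    using that F by (auto simp: glue_rep_def over_def split: sum.splits)
  have *: "prj (glue_bundle V1 V2 Y f F) (?t z) = ?b (?m z)" if z: "z \<in> ?P" for z
  proof -
    have "?b (?m z') = ?b (?m z)" if "z' \<in> ?t z" for z'
      using that z rep by (intro glue_class_congI) (simp add: glue_class_eq)
    moreover have "z \<in> ?t z" using z by (simp add: glue_class_eq)
    ultimately have "(\<lambda>z. ?b (?m z)) ` ?t z = {?b (?m z)}" by blast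
    then show ?thesis by (simp add: glue_bundle_def)
  qed
  show "v \<in> points (total_sp V1) \<Longrightarrow> prj (glue_bundle V1 V2 Y f F) (tot1 V1 V2 Y F v) = bas1 V1 V2 Y f (prj V1 v)"
    using *[of "Inl v"] by (simp add: incl1_def InlI)
  show "w \<in> points (total_sp V2) \<Longrightarrow> prj (glue_bundle V1 V2 Y f F) (tot2 V1 V2 Y F w) = bas2 V1 V2 Y f (prj V2 w)"
    using *[of "Inr w"] by (simp add: incl2_def InrI)
qed

section \<open>Gluing of families of vector spaces\<close>

locale vector_family_gluing =
  V1: vector_family V1 + V2: vector_family V2
  for V1 :: "('x1, 'v1) bundle_data" and V2 :: "('x2, 'v2) bundle_data" +
  fixes Y :: "'x1 set" and f :: "'x1 \<Rightarrow> 'x2" and F :: "'v1 \<Rightarrow> 'v2"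
  assumes Y_subset: "Y \<subseteq> points (base_sp V1)"
    and f_image: "f ` Y \<subseteq> points (base_sp V2)"
    and f_inj: "inj_on f Y"
    and lift_points: "v \<in> over V1 Y \<Longrightarrow> F v \<in> points (total_sp V2)"
    and lift_prj: "v \<in> over V1 Y \<Longrightarrow> prj V2 (F v) = f (prj V1 v)"
    and lift_plot: "plot (total_sp V1) n U p \<Longrightarrow> p ` U \<subseteq> over V1 Y \<Longrightarrow> plot (total_sp V2) n U (\<lambda>u. F (p u))"
    and lift_linear: "y \<in> Y \<Longrightarrow> linear_map class_ring (fib V1 y) (fib V2 (f y)) F"
begin

abbreviation "G \<equiv> glue_bundle V1 V2 Y f F"
abbreviation "j1 \<equiv> tot1 V1 V2 Y F"
abbreviation "j2 \<equiv> tot2 V1 V2 Y F"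
abbreviation "i1 \<equiv> bas1 V1 V2 Y f"
abbreviation "i2 \<equiv> bas2 V1 V2 Y f"

lemma base_G: "base_sp G = glue_diff (base_sp V1) (base_sp V2) Y f"
  and total_G: "total_sp G = glue_diff (total_sp V1) (total_sp V2) (over V1 Y) F"
  by (simp_all add: glue_bundle_def)

text \<open>In general \<open>incl1\<close> identifies points of \<open>Y\<close> with the same
  image. Injectivity of \<open>f\<close> excludes this, so \<open>i1\<close> is injective on the
  whole left base and not only off \<open>Y\<close>.\<close>

lemma i1_inj: "y \<in> points (base_sp V1) \<Longrightarrow> y' \<in> points (base_sp V1) \<Longrightarrow> i1 y = i1 y' \<Longrightarrow> y = y'"
  using f_inj by (auto simp: incl1_eq_iff inj_on_def)

lemma i1_eq_i2: "y \<in> Y \<Longrightarrow> i1 y = i2 (f y)"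
  by (rule incl1_eq_incl2)

lemma j1_eq_j2: "v \<in> over V1 Y \<Longrightarrow> j1 v = j2 (F v)"
  by (rule incl1_eq_incl2)

lemmas plot_base_G_iff = plot_glue_iff[OF V1.base.open_plots V2.base.open_plots, where A = Y and h = f, folded base_G]
lemmas plot_total_G_iff = plot_glue_iff[OF V1.total.open_plots V2.total.open_plots, where A = "over V1 Y" and h = F, folded total_G]

lemma prj_G:
  "v \<in> points (total_sp V1) \<Longrightarrow> prj G (j1 v) = i1 (prj V1 v)"
  "w \<in> points (total_sp V2) \<Longrightarrow> prj G (j2 w) = i2 (prj V2 w)"
  by (rule prj_glue_bundle; (rule V1.prj_in_base V2.prj_in_base lift_prj)?; assumption)+

lemma fib_G1: "y \<in> points (base_sp V1) - Y \<Longrightarrow> fib G (i1 y) = transport j1 (fib V1 y)"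
  by (simp add: glue_bundle_def incl1_inv_incl1)

text \<open>Decides the case distinction in \<open>glue_bundle\<close>, \<open>glue_form\<close> and
  \<open>clifford_comparison\<close>; in particular points over \<open>Y\<close>, being images under
  \<open>i2\<close> too, fall under the right-hand branch.\<close>

lemma i2_not_in: "x \<in> points (base_sp V2) \<Longrightarrow> i2 x \<notin> i1 ` (points (base_sp V1) - Y)"
proof
  assume "i2 x \<in> i1 ` (points (base_sp V1) - Y)"
  then obtain y where y: "y \<in> points (base_sp V1) - Y" "i1 y = i2 x" by (elim imageE) simp
  then show False using incl1_eq_incl2_iff[of y "base_sp V1" "base_sp V2" Y f x] by simp
qed

lemma fib_G2: "x \<in> points (base_sp V2) \<Longrightarrow> fib G (i2 x) = transport j2 (fib V2 x)"
  using i2_not_in by (simp add: glue_bundle_def incl2_inv_incl2)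

lemma fib1_not_over: "y \<in> points (base_sp V1) - Y \<Longrightarrow> carrier (fib V1 y) \<subseteq> points (total_sp V1) - over V1 Y"
  by (auto simp: V1.fib_carrier over_def)

lemma fib2_points: "x \<in> points (base_sp V2) \<Longrightarrow> carrier (fib V2 x) \<subseteq> points (total_sp V2)"
  by (auto simp: V2.fib_carrier over_def)

lemma inj_on_j1: "y \<in> points (base_sp V1) - Y \<Longrightarrow> inj_on j1 (carrier (fib V1 y))"
  using inj_on_incl1 fib1_not_over by (rule inj_on_subset)

lemma inj_on_j2: "x \<in> points (base_sp V2) \<Longrightarrow> inj_on j2 (carrier (fib V2 x))"
  using inj_on_incl2 fib2_points by (rule inj_on_subset)

lemma F_image: "F ` over V1 Y \<subseteq> points (total_sp V2)"
  using lift_points by blast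

lemma base_G_cases:
  assumes "x \<in> points (base_sp G)"
  obtains y where "y \<in> points (base_sp V1) - Y" "x = i1 y" | y where "y \<in> points (base_sp V2)" "x = i2 y"
proof (rule points_glue_cases[OF assms[unfolded base_G] f_image])
  fix y assume "y \<in> points (base_sp V1) - Y" "x = i1 y"
  then show thesis by (rule that(1))
next
  fix y assume "y \<in> points (base_sp V2)" "x = i2 y"
  then show thesis by (rule that(2))
qed

lemma carrier_G1:
  assumes y: "y \<in> points (base_sp V1) - Y"
  shows "carrier (fib G (i1 y)) = j1 ` carrier (fib V1 y)" "carrier (fib G (i1 y)) = over G {i1 y}"
proof -
  show *: "carrier (fib G (i1 y)) = j1 ` carrier (fib V1 y)"
    unfolding fib_G1[OF y] by (rule transport_simps(1)[OF inj_on_j1[OF y]])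
  have yV: "y \<in> points (base_sp V1)" using y by blast
  have "v \<in> j1 ` carrier (fib V1 y)" if v: "v \<in> over G {i1 y}" for v
  proof -
    have "v \<in> points (total_sp G)" and p: "prj G v = i1 y" using v by (auto simp: over_def)
    from this(1) show ?thesis unfolding total_G
    proof (rule points_glue_cases[OF _ F_image])
      fix w assume w: "w \<in> points (total_sp V1) - over V1 Y" "v = j1 w"
      then have "i1 (prj V1 w) = i1 y" using p prj_G(1) by simp
      then have "prj V1 w = y" using i1_inj V1.prj_in_base w(1) yV by blast
      then show ?thesis using w V1.in_fib_iff[OF yV] by blast
    next
      fix w assume w: "w \<in> points (total_sp V2)" "v = j2 w"
      then have "i1 y = i2 (prj V2 w)" using p prj_G(2) by simp
      then show ?thesis using i2_not_in[OF V2.prj_in_base[OF w(1)]] imageI[OF y, of i1] by simp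
    qed
  qed
  moreover have "j1 v \<in> over G {i1 y}" if "v \<in> carrier (fib V1 y)" for v
  proof -
    have "v \<in> points (total_sp V1)" "prj V1 v = y" using that V1.in_fib_iff[OF yV] by auto
    then show ?thesis using prj_G(1)[of v] unfolding over_def total_G points_glue by simp
  qed
  ultimately show "carrier (fib G (i1 y)) = over G {i1 y}" unfolding * by blast
qed

lemma carrier_G2:
  assumes x: "x \<in> points (base_sp V2)"
  shows "carrier (fib G (i2 x)) = j2 ` carrier (fib V2 x)" "carrier (fib G (i2 x)) = over G {i2 x}"
proof -
  show *: "carrier (fib G (i2 x)) = j2 ` carrier (fib V2 x)"
    unfolding fib_G2[OF x] by (rule transport_simps(1)[OF inj_on_j2[OF x]])
  have "v \<in> j2 ` carrier (fib V2 x)" if v: "v \<in> over G {i2 x}" for v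
  proof -
    have "v \<in> points (total_sp G)" and p: "prj G v = i2 x" using v by (auto simp: over_def)
    from this(1) show ?thesis unfolding total_G
    proof (rule points_glue_cases[OF _ F_image])
      fix w assume w: "w \<in> points (total_sp V1) - over V1 Y" "v = j1 w"
      then have "i1 (prj V1 w) = i2 x" using p prj_G(1) by simp
      moreover have "prj V1 w \<in> points (base_sp V1) - Y" using w(1) V1.prj_in_base by (auto simp: over_def)
      then have "i1 (prj V1 w) \<in> i1 ` (points (base_sp V1) - Y)" by (rule imageI)
      ultimately show ?thesis using i2_not_in[OF x] by simp
    next
      fix w assume w: "w \<in> points (total_sp V2)" "v = j2 w"
      then have "i2 (prj V2 w) = i2 x" using p prj_G(2) by simp
      then have "prj V2 w = x" using incl2_eq_iff[OF V2.prj_in_base[OF w(1)]] by blast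
      then show ?thesis using w V2.in_fib_iff[OF x] by blast
    qed
  qed
  moreover have "j2 v \<in> over G {i2 x}" if "v \<in> carrier (fib V2 x)" for v
  proof -
    have "v \<in> points (total_sp V2)" "prj V2 v = x" using that V2.in_fib_iff[OF x] by auto
    then show ?thesis using prj_G(2)[of v] unfolding over_def total_G points_glue by simp
  qed
  ultimately show "carrier (fib G (i2 x)) = over G {i2 x}" unfolding * by blast
qed

lemma vectorspace_G1: "y \<in> points (base_sp V1) - Y \<Longrightarrow> vectorspace class_ring (fib G (i1 y))"
  using vectorspace_transport[OF V1.fib_vectorspace inj_on_j1] by (simp add: fib_G1)

lemma vectorspace_G2: "x \<in> points (base_sp V2) \<Longrightarrow> vectorspace class_ring (fib G (i2 x))"
  using vectorspace_transport[OF V2.fib_vectorspace inj_on_j2] by (simp add: fib_G2)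

lemma plot_j1: "plot (total_sp V1) n U p \<Longrightarrow> plot (total_sp G) n U (\<lambda>u. j1 (p u))"
  unfolding plot_total_G_iff using V1.total.plot_open by blast

lemma plot_j2: "plot (total_sp V2) n U p \<Longrightarrow> plot (total_sp G) n U (\<lambda>u. j2 (p u))"
  unfolding plot_total_G_iff using V2.total.plot_open by blast

lemma plot_i1: "plot (base_sp V1) n U p \<Longrightarrow> plot (base_sp G) n U (\<lambda>u. i1 (p u))"
  unfolding plot_base_G_iff using V1.base.plot_open by blast

lemma plot_i2: "plot (base_sp V2) n U p \<Longrightarrow> plot (base_sp G) n U (\<lambda>u. i2 (p u))"
  unfolding plot_base_G_iff using V2.base.plot_open by blast

lemma vector_family_G: "vector_family G"
proof (rule vector_family.intro)
  show base: "diffeological_space (base_sp G)"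
    unfolding base_G by (rule diffeological_space_glue[OF V1.base.plot_system V2.base.plot_system])
  then interpret base: diffeological_space "base_sp G" .
  have total: "diffeological_space (total_sp G)"
    unfolding total_G by (rule diffeological_space_glue[OF V1.total_plots V2.total_plots])
  then show "plot_system (total_sp G)" by (rule diffeological_space.plot_system)
  show "smooth_map (total_sp G) (base_sp G) (prj G)"
    unfolding smooth_map_def
  proof (intro conjI allI impI)
    show "prj G ` points (total_sp G) \<subseteq> points (base_sp G)"
      unfolding total_G base_G points_glue using prj_G V1.prj_in_base V2.prj_in_base by auto
    fix n U p assume p: "plot (total_sp G) n U p"
    show "plot (base_sp G) n U (\<lambda>u. prj G (p u))"
    proof (rule base.plot_local)
      show "openin (Euclidean_space n) U" using p unfolding plot_total_G_iff by blast
      fix u assume "u \<in> U"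
      with p obtain W where W: "openin (Euclidean_space n) W" "u \<in> W" "W \<subseteq> U"
        and c: "(\<exists>q. plot (total_sp V1) n W q \<and> (\<forall>w\<in>W. p w = j1 (q w))) \<or>
          (\<exists>q. plot (total_sp V2) n W q \<and> (\<forall>w\<in>W. p w = j2 (q w)))"
        unfolding plot_total_G_iff by blast
      from c have "plot (base_sp G) n W (\<lambda>u. prj G (p u))"
      proof
        assume "\<exists>q. plot (total_sp V1) n W q \<and> (\<forall>w\<in>W. p w = j1 (q w))"
        then obtain q where q: "plot (total_sp V1) n W q" "\<forall>w\<in>W. p w = j1 (q w)" by blast
        have "plot (base_sp G) n W (\<lambda>w. i1 (prj V1 (q w)))"
          using smooth_mapD[OF V1.prj_smooth q(1)] by (rule plot_i1)
        then show ?thesis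
          by (rule base.plot_cong) (use q V1.total.plot_in_points[OF q(1)] prj_G(1) in simp)
      next
        assume "\<exists>q. plot (total_sp V2) n W q \<and> (\<forall>w\<in>W. p w = j2 (q w))"
        then obtain q where q: "plot (total_sp V2) n W q" "\<forall>w\<in>W. p w = j2 (q w)" by blast
        have "plot (base_sp G) n W (\<lambda>w. i2 (prj V2 (q w)))"
          using smooth_mapD[OF V2.prj_smooth q(1)] by (rule plot_i2)
        then show ?thesis
          by (rule base.plot_cong) (use q V2.total.plot_in_points[OF q(1)] prj_G(2) in simp)
      qed
      with W show "\<exists>W. openin (Euclidean_space n) W \<and> u \<in> W \<and> W \<subseteq> U \<and> plot (base_sp G) n W (\<lambda>u. prj G (p u))"
        by blast
    qed
  qed
  show "carrier (fib G x) = over G {x}" "vectorspace class_ring (fib G x)" if "x \<in> points (base_sp G)" for x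
    by (rule base_G_cases[OF that]; simp add: carrier_G1(2) carrier_G2(2) vectorspace_G1 vectorspace_G2)+
qed

lemma linear_j2: "x \<in> points (base_sp V2) \<Longrightarrow> linear_map class_ring (fib V2 x) (fib G (i2 x)) j2"
  using linear_map_transport[OF V2.fib_vectorspace inj_on_j2] by (simp add: fib_G2)

lemma fib_over: "y \<in> Y \<Longrightarrow> v \<in> carrier (fib V1 y) \<Longrightarrow> v \<in> over V1 Y"
  using V1.in_fib_iff Y_subset by (auto simp: over_def)

text \<open>Off \<open>Y\<close> the glued fibre is the transport of the left fibre. Over
  \<open>Y\<close> it is the transport of the right fibre, and \<open>j1\<close> is
  \<open>j2\<close> after the linear map \<open>F\<close>.\<close>

lemma linear_j1:
  assumes y: "y \<in> points (base_sp V1)"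
  shows "linear_map class_ring (fib V1 y) (fib G (i1 y)) j1"
proof (cases "y \<in> Y")
  case True
  have fy: "f y \<in> points (base_sp V2)" using True f_image by blast
  note F = linear_map_class_ringD[OF lift_linear[OF True]]
  note j2 = linear_map_class_ringD[OF linear_j2[OF fy]]
  have e: "j1 v = j2 (F v)" if "v \<in> carrier (fib V1 y)" for v
    using j1_eq_j2 fib_over[OF True that] by blast
  show ?thesis
    unfolding i1_eq_i2[OF True]
  proof (rule linear_map_class_ringI[OF F(1) j2(2)])
    fix v w r assume v: "v \<in> carrier (fib V1 y)"
    show "j1 v \<in> carrier (fib G (i2 (f y)))" using e[OF v] F(3)[OF v] j2(3) by simp
    show "j1 (r \<odot>\<^bsub>fib V1 y\<^esub> v) = r \<odot>\<^bsub>fib G (i2 (f y))\<^esub> j1 v"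
      using v e vectorspace_smult_closed[OF F(1)] by (simp add: F(3,5) j2(5))
    assume w: "w \<in> carrier (fib V1 y)"
    show "j1 (v \<oplus>\<^bsub>fib V1 y\<^esub> w) = j1 v \<oplus>\<^bsub>fib G (i2 (f y))\<^esub> j1 w"
      using v w e vectorspace_add_closed[OF F(1)] by (simp add: F(3,4) j2(4))
  qed
next
  case False
  then show ?thesis
    using y linear_map_transport[OF V1.fib_vectorspace inj_on_j1] by (simp add: fib_G1)
qed

end

section \<open>Gluing of Clifford algebras\<close>

text \<open>A preimage is obtained by choosing a preimage of every letter.\<close>

lemma free_alg_map_surj:
  assumes "G ` E = E'" "a \<in> carrier (free_alg E')"
  obtains c where "c \<in> carrier (free_alg E)" "free_alg_map G c = a"
proof
  show "free_alg_map (inv_into E G) a \<in> carrier (free_alg E)"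
    using assms(2) by (rule free_alg_map_closed) (use assms(1) in \<open>auto intro: inv_into_into\<close>)
  have "free_alg_map (\<lambda>v. G (inv_into E G v)) a = free_alg_map (\<lambda>v. v) a"
    using assms(2) by (rule free_alg_map_cong) (use assms(1) in \<open>auto intro: f_inv_into_f\<close>)
  then show "free_alg_map G (free_alg_map (inv_into E G) a) = a"
    by (simp add: free_alg_map_compose free_alg_map_ident)
qed

lemma clifford_ext_apply: "clifford_ext W b f F (x, c) = (f x, clifford_algebra_map (fib W (f x)) (b (f x)) F c)"
  by (simp add: clifford_ext_def)

text \<open>The lift \<open>q\<close> acts on letter functions and leaves the coefficients alone, so
  lifting the letters lifts the whole sum.\<close>

lemma free_alg_map_formal_sum_lift:
  assumes "\<And>c vs v. (c, vs) \<in> set ts \<Longrightarrow> v \<in> set vs \<Longrightarrow> K (q v w) = v w"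
  shows "free_alg_map K (formal_sum (map (\<lambda>(c, vs). (c, map q vs)) ts) w) = formal_sum ts w"
  using assms
proof (induction ts)
  case (Cons t ts)
  obtain c vs where t: "t = (c, vs)" by (cases t)
  have "K (q v w) = v w" if "v \<in> set vs" for v using Cons.prems[of c vs v] that t by simp
  then have m: "map (\<lambda>v. K (q v w)) vs = map (\<lambda>v. v w) vs" by simp
  have IH: "free_alg_map K (formal_sum (map (\<lambda>(c, vs). (c, map q vs)) ts) w) = formal_sum ts w"
    using Cons.prems by (intro Cons.IH) (meson list.set_intros(2))
  show ?case
    by (simp only: t list.map case_prod_conv formal_sum_simps free_alg_map_add free_alg_map_single
      tword.sel map_map comp_def m IH)
qed (simp add: free_alg_map_zero)

lemma formal_plot_map:
  assumes x: "plot (base_sp V') n W x" and ts: "formal_plot V n W y ts"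
    and q: "\<And>c vs v. (c, vs) \<in> set ts \<Longrightarrow> v \<in> set vs \<Longrightarrow>
      plot (total_sp V') n W (q v) \<and> (\<forall>w\<in>W. prj V' (q v w) = x w)"
  shows "formal_plot V' n W x (map (\<lambda>(c, vs). (c, map q vs)) ts)"
proof (rule formal_plotI[OF x])
  fix c vs' assume "(c, vs') \<in> set (map (\<lambda>(c, vs). (c, map q vs)) ts)"
  then obtain vs where vs: "(c, vs) \<in> set ts" "vs' = map q vs" by auto
  show "Cinf_on n W c" using formal_plotD(2)[OF ts vs(1)] .
  fix v' assume "v' \<in> set vs'"
  then obtain v where v: "v \<in> set vs" "v' = q v" using vs(2) by auto
  show "plot (total_sp V') n W v'" "w \<in> W \<Longrightarrow> prj V' (v' w) = x w" for w
    using q[OF vs(1) v(1)] v(2) by auto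
qed

context vector_family_gluing
begin

text \<open>Each letter lifts near \<open>u\<close> to one of the two sides, possibly a different
  one for each letter. Since the letters are finitely many, one neighbourhood serves them
  all.\<close>

lemma finite_plot_lift:
  assumes "finite L" "\<And>v. v \<in> L \<Longrightarrow> plot (total_sp G) n W v" "openin (Euclidean_space n) W" "u \<in> W"
  shows "\<exists>W'. openin (Euclidean_space n) W' \<and> u \<in> W' \<and> W' \<subseteq> W \<and>
    (\<forall>v\<in>L. (\<exists>q. plot (total_sp V1) n W' q \<and> (\<forall>w\<in>W'. v w = j1 (q w))) \<or>
          (\<exists>q. plot (total_sp V2) n W' q \<and> (\<forall>w\<in>W'. v w = j2 (q w))))"
  using assms(1,2)
proof (induction L rule: finite_induct)
  case empty
  show ?case using assms(3,4) by (intro exI[of _ W]) simp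
next
  case (insert v L)
  obtain W1 where W1: "openin (Euclidean_space n) W1" "u \<in> W1" "W1 \<subseteq> W"
    and L: "\<And>v. v \<in> L \<Longrightarrow> (\<exists>q. plot (total_sp V1) n W1 q \<and> (\<forall>w\<in>W1. v w = j1 (q w))) \<or>
          (\<exists>q. plot (total_sp V2) n W1 q \<and> (\<forall>w\<in>W1. v w = j2 (q w)))"
    using insert.IH insert.prems by auto
  have "plot (total_sp G) n W v" using insert.prems by simp
  then obtain W2 where W2: "openin (Euclidean_space n) W2" "u \<in> W2" "W2 \<subseteq> W"
    and v: "(\<exists>q. plot (total_sp V1) n W2 q \<and> (\<forall>w\<in>W2. v w = j1 (q w))) \<or>
          (\<exists>q. plot (total_sp V2) n W2 q \<and> (\<forall>w\<in>W2. v w = j2 (q w)))"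
    using assms(4) unfolding plot_total_G_iff by blast
  let ?W = "W1 \<inter> W2"
  have o: "openin (Euclidean_space n) ?W" using W1(1) W2(1) by (rule openin_Int)
  have res: "(\<exists>q. plot (total_sp V1) n ?W q \<and> (\<forall>w\<in>?W. v w = j1 (q w))) \<or>
          (\<exists>q. plot (total_sp V2) n ?W q \<and> (\<forall>w\<in>?W. v w = j2 (q w)))"
    if "(\<exists>q. plot (total_sp V1) n W0 q \<and> (\<forall>w\<in>W0. v w = j1 (q w))) \<or>
          (\<exists>q. plot (total_sp V2) n W0 q \<and> (\<forall>w\<in>W0. v w = j2 (q w)))" "?W \<subseteq> W0" for W0 and v :: "(nat \<Rightarrow> real) \<Rightarrow> ('v1 + 'v2) set"
    using that(1)
  proof
    assume "\<exists>q. plot (total_sp V1) n W0 q \<and> (\<forall>w\<in>W0. v w = j1 (q w))"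
    then obtain q where "plot (total_sp V1) n W0 q" "\<forall>w\<in>W0. v w = j1 (q w)" by blast
    then show ?thesis using V1.total.plot_restrict[OF _ o that(2)] that(2) by blast
  next
    assume "\<exists>q. plot (total_sp V2) n W0 q \<and> (\<forall>w\<in>W0. v w = j2 (q w))"
    then obtain q where "plot (total_sp V2) n W0 q" "\<forall>w\<in>W0. v w = j2 (q w)" by blast
    then show ?thesis using V2.total.plot_restrict[OF _ o that(2)] that(2) by blast
  qed
  have lifts: "\<forall>v\<in>insert v L. (\<exists>q. plot (total_sp V1) n ?W q \<and> (\<forall>w\<in>?W. v w = j1 (q w))) \<or>
          (\<exists>q. plot (total_sp V2) n ?W q \<and> (\<forall>w\<in>?W. v w = j2 (q w)))"
    using res[OF v] res[OF L] by simp
  show ?case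
  proof (intro exI[of _ ?W] conjI lifts o)
    show "u \<in> ?W" using W1(2) W2(2) by simp
    show "?W \<subseteq> W" using W1(3) by blast
  qed
qed

text \<open>The letters of a formal plot of the glued family, and its base point, lift simultaneously to
  one of the two sides: whatever meets the right-hand side is moved there by the gluing maps.\<close>

lemma formal_plot_lift:
  assumes ts: "formal_plot G n W x ts" and u: "u \<in> W"
  obtains (left) W' x' q where "openin (Euclidean_space n) W'" "u \<in> W'" "W' \<subseteq> W" "plot (base_sp V1) n W' x'"
      "\<And>w. w \<in> W' \<Longrightarrow> x w = i1 (x' w)"
      "\<And>c vs v. (c, vs) \<in> set ts \<Longrightarrow> v \<in> set vs \<Longrightarrow>
        plot (total_sp V1) n W' (q v) \<and> (\<forall>w\<in>W'. prj V1 (q v w) = x' w \<and> j1 (q v w) = v w)"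
  | (right) W' x' q where "openin (Euclidean_space n) W'" "u \<in> W'" "W' \<subseteq> W" "plot (base_sp V2) n W' x'"
      "\<And>w. w \<in> W' \<Longrightarrow> x w = i2 (x' w)"
      "\<And>c vs v. (c, vs) \<in> set ts \<Longrightarrow> v \<in> set vs \<Longrightarrow>
        plot (total_sp V2) n W' (q v) \<and> (\<forall>w\<in>W'. prj V2 (q v w) = x' w \<and> j2 (q v w) = v w)"
proof -
  interpret G: vector_family G by (rule vector_family_G)
  note tsD = formal_plotD[OF ts]
  define L where "L = \<Union> ((\<lambda>(c, vs). set vs) ` set ts)"
  have L: "plot (total_sp G) n W v \<and> (\<forall>w\<in>W. prj G (v w) = x w)" if "v \<in> L" for v
    using that tsD(3,4) unfolding L_def by auto
  have inL: "v \<in> L" if "(c, vs) \<in> set ts" "v \<in> set vs" for c vs v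
    using that unfolding L_def by auto
  obtain W0 where W0: "openin (Euclidean_space n) W0" "u \<in> W0" "W0 \<subseteq> W"
    and x0: "(\<exists>q. plot (base_sp V1) n W0 q \<and> (\<forall>w\<in>W0. x w = i1 (q w))) \<or>
       (\<exists>q. plot (base_sp V2) n W0 q \<and> (\<forall>w\<in>W0. x w = i2 (q w)))"
    using tsD(1) u unfolding plot_base_G_iff by blast
  have "finite L" unfolding L_def by auto
  moreover have "plot (total_sp G) n W0 v" if "v \<in> L" for v
    using L[OF that] G.total.plot_restrict[OF _ W0(1,3)] by blast
  ultimately obtain W' where W': "openin (Euclidean_space n) W'" "u \<in> W'" "W' \<subseteq> W0"
    and lift: "\<And>v. v \<in> L \<Longrightarrow> (\<exists>q. plot (total_sp V1) n W' q \<and> (\<forall>w\<in>W'. v w = j1 (q w))) \<or>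
          (\<exists>q. plot (total_sp V2) n W' q \<and> (\<forall>w\<in>W'. v w = j2 (q w)))"
    using finite_plot_lift[OF _ _ W0(1,2), of L] by metis
  have W'W: "W' \<subseteq> W" using W'(3) W0(3) by blast
  have prj: "prj G (v w) = x w" if "v \<in> L" "w \<in> W'" for v w using L[OF that(1)] that(2) W'W by blast
  have x': "(\<exists>q. plot (base_sp V1) n W' q \<and> (\<forall>w\<in>W'. x w = i1 (q w))) \<or>
       (\<exists>q. plot (base_sp V2) n W' q \<and> (\<forall>w\<in>W'. x w = i2 (q w)))"
    using x0
  proof
    assume "\<exists>q. plot (base_sp V1) n W0 q \<and> (\<forall>w\<in>W0. x w = i1 (q w))"
    then obtain q where "plot (base_sp V1) n W0 q" "\<forall>w\<in>W0. x w = i1 (q w)" by blast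
    then show ?thesis using V1.base.plot_restrict[OF _ W'(1,3)] W'(3) by blast
  next
    assume "\<exists>q. plot (base_sp V2) n W0 q \<and> (\<forall>w\<in>W0. x w = i2 (q w))"
    then obtain q where "plot (base_sp V2) n W0 q" "\<forall>w\<in>W0. x w = i2 (q w)" by blast
    then show ?thesis using V2.base.plot_restrict[OF _ W'(1,3)] W'(3) by blast
  qed
  show thesis
  \<comment> \<open>The distinction is made on the base plot alone: if it lifts to the right over
    \<open>W'\<close>, all letters are brought there, and otherwise they are all found on the
    left.\<close>
  proof (cases "\<exists>z. plot (base_sp V2) n W' z \<and> (\<forall>w\<in>W'. x w = i2 (z w))")
    case True
    then obtain z where z: "plot (base_sp V2) n W' z" and xz: "\<And>w. w \<in> W' \<Longrightarrow> x w = i2 (z w)" by blast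
    have zin: "z w \<in> points (base_sp V2)" if "w \<in> W'" for w using V2.base.plot_in_points[OF z that] .
    have "\<exists>q. plot (total_sp V2) n W' q \<and> (\<forall>w\<in>W'. prj V2 (q w) = z w \<and> j2 (q w) = v w)" if v: "v \<in> L" for v
      using lift[OF v]
    proof
      assume "\<exists>q. plot (total_sp V1) n W' q \<and> (\<forall>w\<in>W'. v w = j1 (q w))"
      then obtain q where q: "plot (total_sp V1) n W' q" "\<And>w. w \<in> W' \<Longrightarrow> v w = j1 (q w)" by blast
      \<comment> \<open>The letter is given on the left while its base point lies on the right. In
        the glued base this happens only over \<open>Y\<close>, where \<open>F\<close> carries the
        letter across.\<close>
      have qY: "q w \<in> over V1 Y \<and> f (prj V1 (q w)) = z w" if w: "w \<in> W'" for w
      proof -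
        have qp: "q w \<in> points (total_sp V1)" using V1.total.plot_in_points[OF q(1) w] .
        have "i1 (prj V1 (q w)) = i2 (z w)" using prj[OF v w] q(2)[OF w] prj_G(1)[OF qp] xz[OF w] by simp
        then have "prj V1 (q w) \<in> Y \<and> f (prj V1 (q w)) = z w"
          unfolding incl1_eq_incl2_iff[OF V1.prj_in_base[OF qp]] .
        then show ?thesis using qp by (simp add: over_def)
      qed
      have "plot (total_sp V2) n W' (\<lambda>w. F (q w))" using q(1) by (rule lift_plot) (use qY in blast)
      moreover have "prj V2 (F (q w)) = z w" "j2 (F (q w)) = v w" if "w \<in> W'" for w
        using qY[OF that] lift_prj[of "q w"] j1_eq_j2[of "q w"] q(2)[OF that] by simp_all
      ultimately show ?thesis by (intro exI[of _ "\<lambda>w. F (q w)"]) simp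
    next
      assume "\<exists>q. plot (total_sp V2) n W' q \<and> (\<forall>w\<in>W'. v w = j2 (q w))"
      then obtain q where q: "plot (total_sp V2) n W' q" "\<And>w. w \<in> W' \<Longrightarrow> v w = j2 (q w)" by blast
      have "prj V2 (q w) = z w" if w: "w \<in> W'" for w
      proof -
        have qp: "q w \<in> points (total_sp V2)" using V2.total.plot_in_points[OF q(1) w] .
        have "i2 (prj V2 (q w)) = i2 (z w)" using prj[OF v w] q(2)[OF w] prj_G(2)[OF qp] xz[OF w] by simp
        then show ?thesis unfolding incl2_eq_iff[OF V2.prj_in_base[OF qp]] .
      qed
      then show ?thesis using q by (intro exI[of _ q]) simp
    qed
    then obtain q where q: "\<forall>v\<in>L. plot (total_sp V2) n W' (q v) \<and> (\<forall>w\<in>W'. prj V2 (q v w) = z w \<and> j2 (q v w) = v w)"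
      using bchoice[of L "\<lambda>v q. plot (total_sp V2) n W' q \<and> (\<forall>w\<in>W'. prj V2 (q w) = z w \<and> j2 (q w) = v w)"] by blast
    show thesis
    proof (rule right[OF W'(1,2) W'W z])
      show "plot (total_sp V2) n W' (q v) \<and> (\<forall>w\<in>W'. prj V2 (q v w) = z w \<and> j2 (q v w) = v w)"
        if "(c, vs) \<in> set ts" "v \<in> set vs" for c vs v using bspec[OF q inL[OF that]] .
    qed (rule xz)
  next
    case False
    then obtain z where z: "plot (base_sp V1) n W' z" and xz: "\<And>w. w \<in> W' \<Longrightarrow> x w = i1 (z w)"
      using x' by blast
    have zin: "z w \<in> points (base_sp V1)" if "w \<in> W'" for w using V1.base.plot_in_points[OF z that] .
    have "\<exists>q. plot (total_sp V1) n W' q \<and> (\<forall>w\<in>W'. prj V1 (q w) = z w \<and> j1 (q w) = v w)" if v: "v \<in> L" for v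
      using lift[OF v]
    proof
      assume "\<exists>q. plot (total_sp V1) n W' q \<and> (\<forall>w\<in>W'. v w = j1 (q w))"
      then obtain q where q: "plot (total_sp V1) n W' q" "\<And>w. w \<in> W' \<Longrightarrow> v w = j1 (q w)" by blast
      have "prj V1 (q w) = z w" if w: "w \<in> W'" for w
      proof -
        have qp: "q w \<in> points (total_sp V1)" using V1.total.plot_in_points[OF q(1) w] .
        have "i1 (prj V1 (q w)) = i1 (z w)" using prj[OF v w] q(2)[OF w] prj_G(1)[OF qp] xz[OF w] by simp
        then show ?thesis by (rule i1_inj[OF V1.prj_in_base[OF qp] zin[OF w]])
      qed
      then show ?thesis using q by (intro exI[of _ q]) simp
    next
      assume "\<exists>q. plot (total_sp V2) n W' q \<and> (\<forall>w\<in>W'. v w = j2 (q w))"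
      then obtain q where q: "plot (total_sp V2) n W' q" "\<And>w. w \<in> W' \<Longrightarrow> v w = j2 (q w)" by blast
      \<comment> \<open>The projection of a letter on the right would lift the base plot to the
        right, which this case excludes.\<close>
      have "x w = i2 (prj V2 (q w))" if w: "w \<in> W'" for w
        using prj[OF v w] q(2)[OF w] prj_G(2)[OF V2.total.plot_in_points[OF q(1) w]] by simp
      then have False using False smooth_mapD[OF V2.prj_smooth q(1)] by blast
      then show ?thesis ..
    qed
    then obtain q where q: "\<forall>v\<in>L. plot (total_sp V1) n W' (q v) \<and> (\<forall>w\<in>W'. prj V1 (q v w) = z w \<and> j1 (q v w) = v w)"
      using bchoice[of L "\<lambda>v q. plot (total_sp V1) n W' q \<and> (\<forall>w\<in>W'. prj V1 (q w) = z w \<and> j1 (q w) = v w)"] by blast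
    show thesis
    proof (rule left[OF W'(1,2) W'W z])
      show "plot (total_sp V1) n W' (q v) \<and> (\<forall>w\<in>W'. prj V1 (q v w) = z w \<and> j1 (q v w) = v w)"
        if "(c, vs) \<in> set ts" "v \<in> set vs" for c vs v using bspec[OF q inL[OF that]] .
    qed (rule xz)
  qed
qed

end

section \<open>The comparison map between the two Clifford families\<close>

locale clifford_gluing = vector_family_gluing +
  fixes b1 b2
  assumes compat: "compatible V1 Y f F b1 b2"
begin

abbreviation "b \<equiv> glue_form V1 V2 Y f F b1 b2"
abbreviation "C1 \<equiv> clifford_bundle V1 b1"
abbreviation "C2 \<equiv> clifford_bundle V2 b2"
abbreviation "FC \<equiv> clifford_ext V2 b2 f F"
abbreviation "k1 \<equiv> tot1 C1 C2 Y FC"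
abbreviation "k2 \<equiv> tot2 C1 C2 Y FC"
abbreviation "\<Phi> \<equiv> clifford_comparison V1 V2 Y f F b1 b2"
abbreviation "cl1 y \<equiv> clifford_of (fib V1 y) (b1 y)"
abbreviation "cl2 x \<equiv> clifford_of (fib V2 x) (b2 x)"
abbreviation "clG x \<equiv> clifford_of (fib G x) (b x)"
abbreviation "fa1 y \<equiv> carrier (free_alg (carrier (fib V1 y)))"
abbreviation "fa2 x \<equiv> carrier (free_alg (carrier (fib V2 x)))"

sublocale G: vector_family G
  by (rule vector_family_G)

lemma form_j2:
  assumes x: "x \<in> points (base_sp V2)" and vw: "v \<in> carrier (fib V2 x)" "w \<in> carrier (fib V2 x)"
  shows "b2 x v w = b (i2 x) (j2 v) (j2 w)"
proof -
  have "v \<in> points (total_sp V2)" "w \<in> points (total_sp V2)" using vw fib2_points[OF x] by auto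
  then show ?thesis using x i2_not_in[OF x] by (simp add: glue_form_def incl2_inv_incl2)
qed

text \<open>Over \<open>Y\<close> the glued form is read from the right-hand side, and compatibility
  says that \<open>b2\<close> after \<open>F\<close> returns \<open>b1\<close>.\<close>

lemma form_j1:
  assumes y: "y \<in> points (base_sp V1)" and vw: "v \<in> carrier (fib V1 y)" "w \<in> carrier (fib V1 y)"
  shows "b1 y v w = b (i1 y) (j1 v) (j1 w)"
proof (cases "y \<in> Y")
  case True
  have fy: "f y \<in> points (base_sp V2)" using True f_image by blast
  have "b1 y v w = b2 (f y) (F v) (F w)" using compat True vw by (simp add: compatible_def)
  also have "\<dots> = b (i2 (f y)) (j2 (F v)) (j2 (F w))"
    using linear_map_class_ringD(3)[OF lift_linear[OF True]] vw by (intro form_j2[OF fy])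
  finally show ?thesis
    using i1_eq_i2[OF True] j1_eq_j2 fib_over[OF True] vw by simp
next
  case False
  then have "v \<in> points (total_sp V1) - over V1 Y" "w \<in> points (total_sp V1) - over V1 Y"
    using fib1_not_over[of y] y vw by blast+
  then show ?thesis using False y by (simp add: glue_form_def incl1_inv_incl1)
qed

lemma base_C: "base_sp C1 = base_sp V1" "base_sp C2 = base_sp V2" "prj C1 = fst" "prj C2 = fst"
  by (simp_all add: clifford_bundle_def)

lemma FC_eq:
  assumes y: "y \<in> Y" and a: "a \<in> fa1 y"
  shows "FC (y, cl1 y a) = (f y, cl2 (f y) (free_alg_map F a))"
proof -
  have "clifford_algebra_map (fib V2 (f y)) (b2 (f y)) F (cl1 y a) = cl2 (f y) (free_alg_map F a)"
    using lift_linear[OF y] _ a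
  proof (rule clifford_algebra_map_of)
    show "b1 y v w = b2 (f y) (F v) (F w)" if "v \<in> carrier (fib V1 y)" "w \<in> carrier (fib V1 y)" for v w
      using compat y that by (simp add: compatible_def)
  qed
  then show ?thesis by (simp add: clifford_ext_def)
qed

lemma fam_closed:
  shows "y \<in> Y \<Longrightarrow> a \<in> fa1 y \<Longrightarrow> free_alg_map F a \<in> fa2 (f y)"
    and "y \<in> points (base_sp V1) \<Longrightarrow> a \<in> fa1 y \<Longrightarrow> free_alg_map j1 a \<in> carrier (free_alg (carrier (fib G (i1 y))))"
    and "x \<in> points (base_sp V2) \<Longrightarrow> c \<in> fa2 x \<Longrightarrow> free_alg_map j2 c \<in> carrier (free_alg (carrier (fib G (i2 x))))"
  using linear_map_class_ringD(3)[OF lift_linear] linear_map_class_ringD(3)[OF linear_j1]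
    linear_map_class_ringD(3)[OF linear_j2] by (auto intro: free_alg_map_closed)

lemma over_C1: "over C1 Y = {c \<in> points (total_sp C1). fst c \<in> Y}"
  by (simp add: over_def base_C)

lemma FC_points:
  assumes "c \<in> over C1 Y"
  shows "FC c \<in> points (total_sp C2)" "fst (FC c) = f (fst c)"
proof -
  obtain y a where y: "y \<in> points (base_sp V1)" "a \<in> fa1 y" "c = (y, cl1 y a)"
    by (rule V1.clifford_pointE[of c b1]) (use assms over_C1 in auto)
  have yY: "y \<in> Y" using assms y(3) over_C1 by simp
  have fy: "f y \<in> points (base_sp V2)" using yY f_image by blast
  show "FC c \<in> points (total_sp C2)"
    unfolding y(3) FC_eq[OF yY y(2)] using fy fam_closed(1)[OF yY y(2)] by (rule V2.clifford_pointI)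
  show "fst (FC c) = f (fst c)" unfolding y(3) FC_eq[OF yY y(2)] by simp
qed

lemma points_C: "c \<in> points (total_sp C1) \<Longrightarrow> fst c \<in> points (base_sp V1)"
  "c' \<in> points (total_sp C2) \<Longrightarrow> fst c' \<in> points (base_sp V2)"
proof -
  assume "c \<in> points (total_sp C1)"
  then show "fst c \<in> points (base_sp V1)" by (rule V1.clifford_pointE) simp
next
  assume "c' \<in> points (total_sp C2)"
  then show "fst c' \<in> points (base_sp V2)" by (rule V2.clifford_pointE) simp
qed

lemma prj_glued_clifford:
  "c \<in> points (total_sp C1) \<Longrightarrow> prj (glued_clifford V1 V2 Y f F b1 b2) (k1 c) = i1 (fst c)"
  "c' \<in> points (total_sp C2) \<Longrightarrow> prj (glued_clifford V1 V2 Y f F b1 b2) (k2 c') = i2 (fst c')"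
  using prj_glue_bundle[where ?V1.0 = C1 and ?V2.0 = C2 and Y = Y and F = FC and f = f] points_C FC_points(2)
  by (simp_all add: glued_clifford_def base_C)

lemma total_glued_clifford:
  "total_sp (glued_clifford V1 V2 Y f F b1 b2) = glue_diff (total_sp C1) (total_sp C2) (over C1 Y) FC"
  by (simp add: glued_clifford_def glue_bundle_def)

lemma comparison_k2:
  assumes x: "x \<in> points (base_sp V2)" and a: "a \<in> fa2 x"
  shows "\<Phi> (k2 (x, cl2 x a)) = (i2 x, clG (i2 x) (free_alg_map j2 a))"
proof -
  have c: "(x, cl2 x a) \<in> points (total_sp C2)" using x a by (rule V2.clifford_pointI)
  have "clifford_algebra_map (fib G (i2 x)) (b (i2 x)) j2 (cl2 x a) = clG (i2 x) (free_alg_map j2 a)"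
    using linear_j2[OF x] form_j2[OF x] a by (rule clifford_algebra_map_of)
  moreover have "tot2_inv C1 C2 Y FC (k2 (x, cl2 x a)) = (x, cl2 x a)" using c by (rule incl2_inv_incl2)
  ultimately show ?thesis
    using prj_glued_clifford(2)[OF c] i2_not_in[OF x]
    by (simp add: clifford_comparison_def Let_def clifford_ext_apply)
qed

text \<open>Over \<open>Y\<close> the comparison map uses its right-hand branch; there
  \<open>k1\<close> is \<open>k2\<close> after \<open>FC\<close> and \<open>j1\<close> is
  \<open>j2\<close> after \<open>F\<close>, so both routes change the letters in the same way. Hence
  one formula covers the whole left side, including plots that meet \<open>Y\<close>.\<close>

lemma comparison_k1:
  assumes y: "y \<in> points (base_sp V1)" and a: "a \<in> fa1 y"
  shows "\<Phi> (k1 (y, cl1 y a)) = (i1 y, clG (i1 y) (free_alg_map j1 a))"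
proof -
  have c: "(y, cl1 y a) \<in> points (total_sp C1)" using y a by (rule V1.clifford_pointI)
  show ?thesis
  proof (cases "y \<in> Y")
    case True
    have fy: "f y \<in> points (base_sp V2)" using True f_image by blast
    have "k1 (y, cl1 y a) = k2 (FC (y, cl1 y a))" using c True by (intro incl1_eq_incl2) (simp add: over_C1)
    then have "\<Phi> (k1 (y, cl1 y a)) = (i2 (f y), clG (i2 (f y)) (free_alg_map j2 (free_alg_map F a)))"
      using comparison_k2[OF fy fam_closed(1)[OF True a]] by (simp add: FC_eq[OF True a])
    moreover have "free_alg_map (\<lambda>v. j2 (F v)) a = free_alg_map j1 a"
      using a by (rule free_alg_map_cong) (use j1_eq_j2 fib_over[OF True] in simp)
    ultimately show ?thesis by (simp add: free_alg_map_compose i1_eq_i2[OF True])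
  next
    case False
    then have "(y, cl1 y a) \<in> points (total_sp C1) - over C1 Y" using c by (simp add: over_C1)
    then have "tot1_inv C1 C2 Y FC (k1 (y, cl1 y a)) = (y, cl1 y a)" by (rule incl1_inv_incl1)
    moreover have "clifford_algebra_map (fib G (i1 y)) (b (i1 y)) j1 (cl1 y a) = clG (i1 y) (free_alg_map j1 a)"
      using linear_j1[OF y] form_j1[OF y] a by (rule clifford_algebra_map_of)
    ultimately show ?thesis
      using prj_glued_clifford(1)[OF c] False y
      by (simp add: clifford_comparison_def Let_def clifford_ext_apply)
  qed
qed

lemma total_clifford_glued: "total_sp (clifford_glued V1 V2 Y f F b1 b2) = total_sp (clifford_bundle G b)"
  by (simp add: clifford_glued_def)

lemma glued_clifford_cases:
  assumes "c \<in> points (total_sp (glued_clifford V1 V2 Y f F b1 b2))"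
  obtains (left) y a where "y \<in> points (base_sp V1) - Y" "a \<in> fa1 y" "c = k1 (y, cl1 y a)"
  | (right) x a where "x \<in> points (base_sp V2)" "a \<in> fa2 x" "c = k2 (x, cl2 x a)"
proof (rule points_glue_cases[OF assms[unfolded total_glued_clifford]])
  show "FC ` over C1 Y \<subseteq> points (total_sp C2)" using FC_points(1) by blast
next
  fix d assume d: "d \<in> points (total_sp C1) - over C1 Y" "c = k1 d"
  obtain y a where "y \<in> points (base_sp V1)" "a \<in> fa1 y" "d = (y, cl1 y a)"
    by (rule V1.clifford_pointE[of d b1]) (use d in auto)
  then show thesis using left[of y a] d by (simp add: over_C1)
next
  fix d assume d: "d \<in> points (total_sp C2)" "c = k2 d"
  obtain x a where "x \<in> points (base_sp V2)" "a \<in> fa2 x" "d = (x, cl2 x a)"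
    by (rule V2.clifford_pointE[of d b2]) (use d in auto)
  then show thesis using right[of x a] d by simp
qed

lemma i1_points: "y \<in> points (base_sp V1) \<Longrightarrow> i1 y \<in> points (base_sp G)"
  and i2_points: "x \<in> points (base_sp V2) \<Longrightarrow> i2 x \<in> points (base_sp G)"
  by (simp_all add: base_G points_glue)

lemma k_points:
  "c \<in> points (total_sp C1) \<Longrightarrow> k1 c \<in> points (total_sp (glued_clifford V1 V2 Y f F b1 b2))"
  "c' \<in> points (total_sp C2) \<Longrightarrow> k2 c' \<in> points (total_sp (glued_clifford V1 V2 Y f F b1 b2))"
  by (simp_all add: total_glued_clifford points_glue)

text \<open>The map covers the identity of the glued base, so it can be examined over one base point
  at a time. There \<open>j1\<close> or \<open>j2\<close> is a linear bijection of fibres preserving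
  the forms: injectivity follows from the induced inverse, surjectivity from lifting
  letters.\<close>

lemma comparison_bij:
  "bij_betw \<Phi> (points (total_sp (glued_clifford V1 V2 Y f F b1 b2)))
     (points (total_sp (clifford_glued V1 V2 Y f F b1 b2)))"
  unfolding bij_betw_def
proof
  show "inj_on \<Phi> (points (total_sp (glued_clifford V1 V2 Y f F b1 b2)))"
  proof (rule inj_onI)
    fix c c' assume c: "c \<in> points (total_sp (glued_clifford V1 V2 Y f F b1 b2))"
      and c': "c' \<in> points (total_sp (glued_clifford V1 V2 Y f F b1 b2))" and eq: "\<Phi> c = \<Phi> c'"
    from c show "c = c'"
    proof (cases rule: glued_clifford_cases)
      case (left y a)
      then have \<Phi>c: "\<Phi> c = (i1 y, clG (i1 y) (free_alg_map j1 a))" by (simp add: comparison_k1)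
      from c' show ?thesis
      proof (cases rule: glued_clifford_cases)
        case left': (left y' a')
        then have \<Phi>c': "\<Phi> c' = (i1 y', clG (i1 y') (free_alg_map j1 a'))" by (simp add: comparison_k1)
        have yV: "y \<in> points (base_sp V1)" using left(1) by blast
        have "y' = y" using i1_inj[of y' y] eq \<Phi>c \<Phi>c' left(1) left'(1) by simp
        then have "clG (i1 y) (free_alg_map j1 a) = clG (i1 y) (free_alg_map j1 a')" using eq \<Phi>c \<Phi>c' by simp
        then have "cl1 y a = cl1 y a'"
          using left(2) left'(2) \<open>y' = y\<close>
          by (intro clifford_of_free_alg_map_inj[where b = "b1 y" and b' = "b (i1 y)",
              OF linear_j1[OF yV] inj_on_j1[OF left(1)] carrier_G1(1)[OF left(1), symmetric] form_j1[OF yV]]) simp_all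
        then show ?thesis using left(3) left'(3) \<open>y' = y\<close> by simp
      next
        case right': (right x a')
        then have "\<Phi> c' = (i2 x, clG (i2 x) (free_alg_map j2 a'))" by (simp add: comparison_k2)
        then have "i2 x = i1 y" using eq \<Phi>c by simp
        then show ?thesis using i2_not_in[OF right'(1)] imageI[OF left(1), of i1] by simp
      qed
    next
      case (right x a)
      then have \<Phi>c: "\<Phi> c = (i2 x, clG (i2 x) (free_alg_map j2 a))" by (simp add: comparison_k2)
      from c' show ?thesis
      proof (cases rule: glued_clifford_cases)
        case left': (left y a')
        then have "\<Phi> c' = (i1 y, clG (i1 y) (free_alg_map j1 a'))" by (simp add: comparison_k1)
        then have "i2 x = i1 y" using eq \<Phi>c by simp
        then show ?thesis using i2_not_in[OF right(1)] imageI[OF left'(1), of i1] by simp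
      next
        case right': (right x' a')
        then have \<Phi>c': "\<Phi> c' = (i2 x', clG (i2 x') (free_alg_map j2 a'))" by (simp add: comparison_k2)
        have "x' = x" using incl2_eq_iff[OF right'(1), of "base_sp V1" Y f x] eq \<Phi>c \<Phi>c' by simp
        then have "clG (i2 x) (free_alg_map j2 a) = clG (i2 x) (free_alg_map j2 a')" using eq \<Phi>c \<Phi>c' by simp
        then have "cl2 x a = cl2 x a'"
          using right(2) right'(2) \<open>x' = x\<close>
          by (intro clifford_of_free_alg_map_inj[where b = "b2 x" and b' = "b (i2 x)",
              OF linear_j2[OF right(1)] inj_on_j2[OF right(1)] carrier_G2(1)[OF right(1), symmetric] form_j2[OF right(1)]]) simp_all
        then show ?thesis using right(3) right'(3) \<open>x' = x\<close> by simp
      qed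
    qed
  qed
  show "\<Phi> ` points (total_sp (glued_clifford V1 V2 Y f F b1 b2)) = points (total_sp (clifford_glued V1 V2 Y f F b1 b2))"
  proof (intro equalityI subsetI)
    fix d assume "d \<in> \<Phi> ` points (total_sp (glued_clifford V1 V2 Y f F b1 b2))"
    then obtain c where c: "c \<in> points (total_sp (glued_clifford V1 V2 Y f F b1 b2))" "d = \<Phi> c" by blast
    from c(1) show "d \<in> points (total_sp (clifford_glued V1 V2 Y f F b1 b2))"
    proof (cases rule: glued_clifford_cases)
      case (left y a)
      then show ?thesis
        using G.clifford_pointI[OF i1_points fam_closed(2)] by (simp add: c(2) comparison_k1 total_clifford_glued)
    next
      case (right x a)
      then show ?thesis
        using G.clifford_pointI[OF i2_points fam_closed(3)] by (simp add: c(2) comparison_k2 total_clifford_glued)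
    qed
  next
    fix d assume "d \<in> points (total_sp (clifford_glued V1 V2 Y f F b1 b2))"
    then obtain x a where x: "x \<in> points (base_sp G)" and a: "a \<in> carrier (free_alg (carrier (fib G x)))"
      and d: "d = (x, clG x a)"
      unfolding total_clifford_glued by (rule G.clifford_pointE)
    from x show "d \<in> \<Phi> ` points (total_sp (glued_clifford V1 V2 Y f F b1 b2))"
    proof (cases rule: base_G_cases)
      case (1 y)
      obtain c where c: "c \<in> fa1 y" "free_alg_map j1 c = a"
        by (rule free_alg_map_surj[OF carrier_G1(1)[OF 1(1), symmetric], of a]) (use a 1(2) in auto)
      have yV: "y \<in> points (base_sp V1)" using 1(1) by blast
      have "\<Phi> (k1 (y, cl1 y c)) = d" using comparison_k1[OF yV c(1)] by (simp add: d 1(2) c(2))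
      then show ?thesis using k_points(1)[OF V1.clifford_pointI[OF yV c(1)]] by (metis imageI)
    next
      case (2 y)
      obtain c where c: "c \<in> fa2 y" "free_alg_map j2 c = a"
        by (rule free_alg_map_surj[OF carrier_G2(1)[OF 2(1), symmetric], of a]) (use a 2(2) in auto)
      have "\<Phi> (k2 (y, cl2 y c)) = d" using comparison_k2[OF 2(1) c(1)] by (simp add: d 2(2) c(2))
      then show ?thesis using k_points(2)[OF V2.clifford_pointI[OF 2(1) c(1)]] by (metis imageI)
    qed
  qed
qed

lemma open_plots_C: "open_plots (total_sp C1)" "open_plots (total_sp C2)"
  unfolding open_plots_def V1.plot_clifford_iff V2.plot_clifford_iff using formal_class_plot_open by blast+

lemmas plot_glued_clifford_iff = plot_glue_iff[OF open_plots_C, where A = "over C1 Y" and h = FC, folded total_glued_clifford]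

text \<open>Lists of terms are carried over by applying \<open>j1\<close> or \<open>j2\<close> to
  the letters, the coefficients being kept. Because \<open>comparison_k1\<close> also holds over
  \<open>Y\<close>, a plot on the left need not be cut where it enters \<open>Y\<close>.\<close>

lemma comparison_smooth:
  "smooth_map (total_sp (glued_clifford V1 V2 Y f F b1 b2)) (total_sp (clifford_glued V1 V2 Y f F b1 b2)) \<Phi>"
  unfolding smooth_map_def
proof (intro conjI allI impI)
  show "\<Phi> ` points (total_sp (glued_clifford V1 V2 Y f F b1 b2)) \<subseteq> points (total_sp (clifford_glued V1 V2 Y f F b1 b2))"
    using comparison_bij by (simp add: bij_betw_def)
  fix n U p assume p: "plot (total_sp (glued_clifford V1 V2 Y f F b1 b2)) n U p"
  have "formal_class_plot G (\<lambda>_. True) clG n U (\<lambda>u. \<Phi> (p u))"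
  proof (rule formal_class_plot_local)
    show "openin (Euclidean_space n) U" using p unfolding plot_glued_clifford_iff by blast
    fix u assume "u \<in> U"
    then obtain W where W: "openin (Euclidean_space n) W" "u \<in> W" "W \<subseteq> U"
      and c: "(\<exists>q. plot (total_sp C1) n W q \<and> (\<forall>w\<in>W. p w = k1 (q w))) \<or>
        (\<exists>q. plot (total_sp C2) n W q \<and> (\<forall>w\<in>W. p w = k2 (q w)))"
      using p unfolding plot_glued_clifford_iff by blast
    from c have "\<exists>W'. openin (Euclidean_space n) W' \<and> u \<in> W' \<and> W' \<subseteq> W \<and>
      formal_class_plot G (\<lambda>_. True) clG n W' (\<lambda>u. \<Phi> (p u))"
    proof
      assume "\<exists>q. plot (total_sp C1) n W q \<and> (\<forall>w\<in>W. p w = k1 (q w))"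
      then obtain q where q: "plot (total_sp C1) n W q" "\<And>w. w \<in> W \<Longrightarrow> p w = k1 (q w)" by blast
      obtain W' x ts where W': "openin (Euclidean_space n) W'" "u \<in> W'" "W' \<subseteq> W"
        and ts: "formal_plot V1 n W' x ts" and e: "\<And>w. w \<in> W' \<Longrightarrow> q w = (x w, cl1 (x w) (formal_sum ts w))"
        by (rule formal_class_plotE[OF q(1)[unfolded V1.plot_clifford_iff] W(2)]) blast
      note tsD = formal_plotD[OF ts]
      let ?ts = "map (\<lambda>(c, vs). (c, map (\<lambda>v u. j1 (v u)) vs)) ts"
      have "formal_class_plot G (\<lambda>_. True) clG n W' (\<lambda>u. \<Phi> (p u))"
      proof (rule formal_class_plotI[OF W'(1)])
        show "formal_plot G n W' (\<lambda>w. i1 (x w)) ?ts"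
        proof (rule formal_plot_map[OF plot_i1[OF tsD(1)] ts])
          fix c vs v assume v: "(c, vs) \<in> set ts" "v \<in> set vs"
          show "plot (total_sp G) n W' (\<lambda>u. j1 (v u)) \<and> (\<forall>w\<in>W'. prj G (j1 (v w)) = i1 (x w))"
            using plot_j1[OF tsD(3)[OF v]] prj_G(1) V1.total.plot_in_points[OF tsD(3)[OF v]] tsD(4)[OF v] by simp
        qed
        fix w assume w: "w \<in> W'"
        have "p w = k1 (x w, cl1 (x w) (formal_sum ts w))" using q(2)[of w] e[OF w] w W'(3) by auto
        then show "\<Phi> (p w) = (i1 (x w), clG (i1 (x w)) (formal_sum ?ts w))"
          using comparison_k1[OF V1.base.plot_in_points[OF tsD(1) w] V1.formal_sum_closed[OF ts w]]
          by (simp add: free_alg_map_formal_sum)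
      qed simp
      then show ?thesis using W' by blast
    next
      assume "\<exists>q. plot (total_sp C2) n W q \<and> (\<forall>w\<in>W. p w = k2 (q w))"
      then obtain q where q: "plot (total_sp C2) n W q" "\<And>w. w \<in> W \<Longrightarrow> p w = k2 (q w)" by blast
      obtain W' x ts where W': "openin (Euclidean_space n) W'" "u \<in> W'" "W' \<subseteq> W"
        and ts: "formal_plot V2 n W' x ts" and e: "\<And>w. w \<in> W' \<Longrightarrow> q w = (x w, cl2 (x w) (formal_sum ts w))"
        by (rule formal_class_plotE[OF q(1)[unfolded V2.plot_clifford_iff] W(2)]) blast
      note tsD = formal_plotD[OF ts]
      let ?ts = "map (\<lambda>(c, vs). (c, map (\<lambda>v u. j2 (v u)) vs)) ts"
      have "formal_class_plot G (\<lambda>_. True) clG n W' (\<lambda>u. \<Phi> (p u))"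
      proof (rule formal_class_plotI[OF W'(1)])
        show "formal_plot G n W' (\<lambda>w. i2 (x w)) ?ts"
        proof (rule formal_plot_map[OF plot_i2[OF tsD(1)] ts])
          fix c vs v assume v: "(c, vs) \<in> set ts" "v \<in> set vs"
          show "plot (total_sp G) n W' (\<lambda>u. j2 (v u)) \<and> (\<forall>w\<in>W'. prj G (j2 (v w)) = i2 (x w))"
            using plot_j2[OF tsD(3)[OF v]] prj_G(2) V2.total.plot_in_points[OF tsD(3)[OF v]] tsD(4)[OF v] by simp
        qed
        fix w assume w: "w \<in> W'"
        have "p w = k2 (x w, cl2 (x w) (formal_sum ts w))" using q(2)[of w] e[OF w] w W'(3) by auto
        then show "\<Phi> (p w) = (i2 (x w), clG (i2 (x w)) (formal_sum ?ts w))"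
          using comparison_k2[OF V2.base.plot_in_points[OF tsD(1) w] V2.formal_sum_closed[OF ts w]]
          by (simp add: free_alg_map_formal_sum)
      qed simp
      then show ?thesis using W' by blast
    qed
    then show "\<exists>W. openin (Euclidean_space n) W \<and> u \<in> W \<and> W \<subseteq> U \<and>
      formal_class_plot G (\<lambda>_. True) clG n W (\<lambda>u. \<Phi> (p u))" using W(3) by blast
  qed
  then show "plot (total_sp (clifford_glued V1 V2 Y f F b1 b2)) n U (\<lambda>u. \<Phi> (p u))"
    unfolding total_clifford_glued G.plot_clifford_iff .
qed

text \<open>No formula for the inverse is used. A lifted list of terms defines a plot on one side
  whose image under the comparison map is \<open>p\<close>; bijectivity then identifies it with the
  inverse image of \<open>p\<close>.\<close>

lemma comparison_inverse_smooth:
  "smooth_map (total_sp (clifford_glued V1 V2 Y f F b1 b2)) (total_sp (glued_clifford V1 V2 Y f F b1 b2))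
     (inv_into (points (total_sp (glued_clifford V1 V2 Y f F b1 b2))) \<Phi>)"
  (is "smooth_map _ _ ?\<Psi>")
  unfolding smooth_map_def
proof (intro conjI allI impI)
  show "?\<Psi> ` points (total_sp (clifford_glued V1 V2 Y f F b1 b2)) \<subseteq> points (total_sp (glued_clifford V1 V2 Y f F b1 b2))"
    using bij_betw_inv_into[OF comparison_bij] by (simp add: bij_betw_def)
  have \<Psi>: "?\<Psi> (\<Phi> c) = c" if "c \<in> points (total_sp (glued_clifford V1 V2 Y f F b1 b2))" for c
    using comparison_bij that by (simp add: bij_betw_def)
  fix n U p assume p: "plot (total_sp (clifford_glued V1 V2 Y f F b1 b2)) n U p"
  have p: "formal_class_plot G (\<lambda>_. True) clG n U p"
    using p unfolding total_clifford_glued G.plot_clifford_iff .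
  show "plot (total_sp (glued_clifford V1 V2 Y f F b1 b2)) n U (\<lambda>u. ?\<Psi> (p u))"
    unfolding plot_glued_clifford_iff
  proof (intro conjI ballI formal_class_plot_open[OF p])
    fix u assume u: "u \<in> U"
    obtain W x ts where W: "openin (Euclidean_space n) W" "u \<in> W" "W \<subseteq> U"
      and ts: "formal_plot G n W x ts" and e: "\<And>w. w \<in> W \<Longrightarrow> p w = (x w, clG (x w) (formal_sum ts w))"
      by (rule formal_class_plotE[OF p u]) blast
    show "\<exists>W. openin (Euclidean_space n) W \<and> u \<in> W \<and> W \<subseteq> U \<and>
        ((\<exists>q. plot (total_sp C1) n W q \<and> (\<forall>w\<in>W. ?\<Psi> (p w) = k1 (q w))) \<or>
         (\<exists>q. plot (total_sp C2) n W q \<and> (\<forall>w\<in>W. ?\<Psi> (p w) = k2 (q w))))"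
      using ts W(2)
    proof (cases rule: formal_plot_lift)
      case (left W' x' q)
      let ?ts = "map (\<lambda>(c, vs). (c, map q vs)) ts"
      have ts': "formal_plot G n W' x ts" using ts left(1,3) by (rule G.formal_plot_restrict)
      have fp: "formal_plot V1 n W' x' ?ts"
        by (rule formal_plot_map[OF left(4) ts']) (use left(6) in blast)
      have "plot (total_sp C1) n W' (\<lambda>w. (x' w, cl1 (x' w) (formal_sum ?ts w)))"
        unfolding V1.plot_clifford_iff by (rule formal_class_plotI[OF left(1) fp]) simp_all
      moreover have "?\<Psi> (p w) = k1 (x' w, cl1 (x' w) (formal_sum ?ts w))" if w: "w \<in> W'" for w
      proof -
        have x': "x' w \<in> points (base_sp V1)" using V1.base.plot_in_points[OF left(4) w] .
        note c = V1.formal_sum_closed[OF fp w]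
        have "free_alg_map j1 (formal_sum ?ts w) = formal_sum ts w"
          by (rule free_alg_map_formal_sum_lift) (use left(6) w in blast)
        then have "\<Phi> (k1 (x' w, cl1 (x' w) (formal_sum ?ts w))) = p w"
          using comparison_k1[OF x' c] e[of w] left(3,5) w by auto
        then show ?thesis using \<Psi>[OF k_points(1)[OF V1.clifford_pointI[OF x' c]]] by simp
      qed
      ultimately show ?thesis using left(1,2,3) W(3) by blast
    next
      case (right W' x' q)
      let ?ts = "map (\<lambda>(c, vs). (c, map q vs)) ts"
      have ts': "formal_plot G n W' x ts" using ts right(1,3) by (rule G.formal_plot_restrict)
      have fp: "formal_plot V2 n W' x' ?ts"
        by (rule formal_plot_map[OF right(4) ts']) (use right(6) in blast)
      have "plot (total_sp C2) n W' (\<lambda>w. (x' w, cl2 (x' w) (formal_sum ?ts w)))"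
        unfolding V2.plot_clifford_iff by (rule formal_class_plotI[OF right(1) fp]) simp_all
      moreover have "?\<Psi> (p w) = k2 (x' w, cl2 (x' w) (formal_sum ?ts w))" if w: "w \<in> W'" for w
      proof -
        have x': "x' w \<in> points (base_sp V2)" using V2.base.plot_in_points[OF right(4) w] .
        note c = V2.formal_sum_closed[OF fp w]
        have "free_alg_map j2 (formal_sum ?ts w) = formal_sum ts w"
          by (rule free_alg_map_formal_sum_lift) (use right(6) w in blast)
        then have "\<Phi> (k2 (x' w, cl2 (x' w) (formal_sum ?ts w))) = p w"
          using comparison_k2[OF x' c] e[of w] right(3,5) w by auto
        then show ?thesis using \<Psi>[OF k_points(2)[OF V2.clifford_pointI[OF x' c]]] by simp
      qed
      ultimately show ?thesis using right(1,2,3) W(3) by blast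
    qed
  qed
qed

lemma comparison_diffeomorphism:
  "diffeomorphism (total_sp (glued_clifford V1 V2 Y f F b1 b2)) (total_sp (clifford_glued V1 V2 Y f F b1 b2)) \<Phi>"
  unfolding diffeomorphism_def using comparison_bij comparison_smooth comparison_inverse_smooth by blast

end

section \<open>Dual families\<close>

lemma submodule_class_ringI:
  fixes M :: "(real, 'a) module" (structure)
  assumes "vectorspace class_ring M" "T \<subseteq> carrier M" "\<zero> \<in> T"
    and "\<And>v w. v \<in> T \<Longrightarrow> w \<in> T \<Longrightarrow> v \<oplus> w \<in> T" "\<And>r v. v \<in> T \<Longrightarrow> r \<odot> v \<in> T"
  shows "submodule class_ring T M"
  by (rule submodule.intro) (use assms in \<open>auto simp: vectorspace_def\<close>)

lemma submodule_class_ringD: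
  fixes M :: "(real, 'a) module" (structure)
  assumes "submodule class_ring T M"
  shows "T \<subseteq> carrier M" "\<zero> \<in> T" "v \<in> T \<Longrightarrow> w \<in> T \<Longrightarrow> v \<oplus> w \<in> T" "v \<in> T \<Longrightarrow> r \<odot> v \<in> T"
proof -
  interpret submodule class_ring T M by fact
  show "T \<subseteq> carrier M" "\<zero> \<in> T" "v \<in> T \<Longrightarrow> w \<in> T \<Longrightarrow> v \<oplus> w \<in> T" "v \<in> T \<Longrightarrow> r \<odot> v \<in> T"
    using subset smult_closed[of r v] by (simp_all add: m_closed)
qed

text \<open>Induction on the number of functionals: pass to the kernel of one of them.\<close>

lemma separating_functionals_generators:
  fixes ev :: "'b \<Rightarrow> 'a \<Rightarrow> real"
  assumes "finite B"
  shows "vectorspace class_ring (M :: (real, 'a) module) \<Longrightarrow>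
    (\<And>b v w. b \<in> B \<Longrightarrow> v \<in> carrier M \<Longrightarrow> w \<in> carrier M \<Longrightarrow> ev b (v \<oplus>\<^bsub>M\<^esub> w) = ev b v + ev b w) \<Longrightarrow>
    (\<And>b r v. b \<in> B \<Longrightarrow> v \<in> carrier M \<Longrightarrow> ev b (r \<odot>\<^bsub>M\<^esub> v) = r * ev b v) \<Longrightarrow>
    (\<And>v. v \<in> carrier M \<Longrightarrow> (\<And>b. b \<in> B \<Longrightarrow> ev b v = 0) \<Longrightarrow> v = \<zero>\<^bsub>M\<^esub>) \<Longrightarrow>
    \<exists>S. finite S \<and> S \<subseteq> carrier M \<and> (\<forall>T. submodule class_ring T M \<and> S \<subseteq> T \<longrightarrow> carrier M \<subseteq> T)"
  using assms
proof (induction B arbitrary: M rule: finite_induct)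
  case empty
  have "carrier M \<subseteq> T" if "submodule class_ring T M" for T
    using empty.prems(4) submodule_class_ringD(2)[OF that] by auto
  then show ?case by (intro exI[of _ "{}"]) simp
next
  case (insert b B M)
  note M = insert.prems(1) and add = insert.prems(2) and smult = insert.prems(3)
  let ?K = "{v \<in> carrier M. ev b v = 0}"
  let ?MK = "M\<lparr>carrier := ?K\<rparr>"
  have z: "\<zero>\<^bsub>M\<^esub> \<in> ?K"
    using smult[of b "\<zero>\<^bsub>M\<^esub>" 0] vectorspace_smult_zero[OF M] vectorspace_zero_closed[OF M] by simp
  have MK: "vectorspace class_ring ?MK"
  proof (rule vectorspace_subspace[OF M _ z])
    show "v \<oplus>\<^bsub>M\<^esub> w \<in> ?K" if "v \<in> ?K" "w \<in> ?K" for v w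
      using that add vectorspace_add_closed[OF M] by simp
    show "r \<odot>\<^bsub>M\<^esub> v \<in> ?K" if "v \<in> ?K" for r v
      using that smult vectorspace_smult_closed[OF M] by simp
  qed blast
  have "\<exists>S. finite S \<and> S \<subseteq> carrier ?MK \<and> (\<forall>T. submodule class_ring T ?MK \<and> S \<subseteq> T \<longrightarrow> carrier ?MK \<subseteq> T)"
  proof (rule insert.IH[OF MK])
    fix v assume v: "v \<in> carrier ?MK" "\<And>c. c \<in> B \<Longrightarrow> ev c v = 0"
    then have "v = \<zero>\<^bsub>M\<^esub>" by (intro insert.prems(4)) auto
    then show "v = \<zero>\<^bsub>?MK\<^esub>" by simp
  qed (use add smult in auto)
  then obtain S where S': "finite S \<and> S \<subseteq> carrier ?MK \<and> (\<forall>T. submodule class_ring T ?MK \<and> S \<subseteq> T \<longrightarrow> carrier ?MK \<subseteq> T)"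
    by (rule exE)
  then have S: "finite S" "S \<subseteq> ?K" by simp_all
  have gen: "?K \<subseteq> T" if "submodule class_ring T ?MK" "S \<subseteq> T" for T
    using conjunct2[OF conjunct2[OF S']] that by simp
  have K_sub: "?K \<subseteq> T" if T: "submodule class_ring T M" "S \<subseteq> T" for T
  proof -
    note T' = submodule_class_ringD[OF T(1)]
    \<comment> \<open>Generation is expressed through submodules containing \<open>S\<close>, so it
      passes from the kernel to \<open>M\<close> by intersecting a submodule of \<open>M\<close>
      with the kernel.\<close>
    have "submodule class_ring (T \<inter> ?K) ?MK"
    proof (rule submodule_class_ringI[OF MK])
      show "\<zero>\<^bsub>?MK\<^esub> \<in> T \<inter> ?K" using z T'(2) by simp
      show "v \<oplus>\<^bsub>?MK\<^esub> w \<in> T \<inter> ?K" if "v \<in> T \<inter> ?K" "w \<in> T \<inter> ?K" for v w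
        using that T'(3) add vectorspace_add_closed[OF M] by simp
      show "r \<odot>\<^bsub>?MK\<^esub> v \<in> T \<inter> ?K" if "v \<in> T \<inter> ?K" for r v
        using that T'(4) smult vectorspace_smult_closed[OF M] by simp
    qed simp
    then show ?thesis using gen[of "T \<inter> ?K"] S(2) T(2) by blast
  qed
  show ?case
  \<comment> \<open>If \<open>ev b\<close> vanishes on \<open>M\<close>, generators of the kernel
    are enough. Otherwise the kernel has codimension one, and a single vector outside it is
    added.\<close>
  proof (cases "?K = carrier M")
    case True
    show ?thesis
    proof (intro exI[of _ S] conjI allI impI S(1))
      show "S \<subseteq> carrier M" using S(2) by blast
      show "carrier M \<subseteq> T" if "submodule class_ring T M \<and> S \<subseteq> T" for T
        using K_sub[of T] that True by simp
    qed
  next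
    case False
    then obtain m where m: "m \<in> carrier M" "ev b m \<noteq> 0" by blast
    show ?thesis
    proof (intro exI[of _ "insert m S"] conjI allI impI)
      show "finite (insert m S)" using S(1) by simp
      show "insert m S \<subseteq> carrier M" using m(1) S(2) by blast
      fix T assume T: "submodule class_ring T M \<and> insert m S \<subseteq> T"
      then have T1: "submodule class_ring T M" and mT: "m \<in> T" and KT: "?K \<subseteq> T" using K_sub by auto
      note T' = submodule_class_ringD[OF T1]
      show "carrier M \<subseteq> T"
      proof
        fix v assume v: "v \<in> carrier M"
        \<comment> \<open>Chosen so that subtracting \<open>?c\<close> times \<open>m\<close> from
          \<open>v\<close> leaves a vector of the kernel.\<close>
        let ?c = "ev b v / ev b m"
        have cm: "s \<odot>\<^bsub>M\<^esub> m \<in> carrier M" for s using vectorspace_smult_closed[OF M m(1)] .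
        have "v \<oplus>\<^bsub>M\<^esub> (- ?c) \<odot>\<^bsub>M\<^esub> m \<in> ?K"
          using v m cm add smult[of b m "- ?c"] vectorspace_add_closed[OF M] by simp
        then have "(v \<oplus>\<^bsub>M\<^esub> (- ?c) \<odot>\<^bsub>M\<^esub> m) \<oplus>\<^bsub>M\<^esub> ?c \<odot>\<^bsub>M\<^esub> m \<in> T" using KT T'(3,4) mT by blast
        also have "(v \<oplus>\<^bsub>M\<^esub> (- ?c) \<odot>\<^bsub>M\<^esub> m) \<oplus>\<^bsub>M\<^esub> ?c \<odot>\<^bsub>M\<^esub> m = v \<oplus>\<^bsub>M\<^esub> ((- ?c) \<odot>\<^bsub>M\<^esub> m \<oplus>\<^bsub>M\<^esub> ?c \<odot>\<^bsub>M\<^esub> m)"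
          using vectorspace_add(1)[OF M v cm cm] .
        also have "(- ?c) \<odot>\<^bsub>M\<^esub> m \<oplus>\<^bsub>M\<^esub> ?c \<odot>\<^bsub>M\<^esub> m = \<zero>\<^bsub>M\<^esub>"
          using vectorspace_smult_l_distr[OF M m(1), of "- ?c" ?c] vectorspace_smult_zero[OF M m(1)] by simp
        also have "v \<oplus>\<^bsub>M\<^esub> \<zero>\<^bsub>M\<^esub> = v" using vectorspace_add(4)[OF M v] .
        finally show "v \<in> T" .
      qed
    qed
  qed
qed

text \<open>Intended for dual fibres, with the evaluations at a finite spanning set as functionals.
  Applying the generation property to the span of \<open>S\<close> gives a finite spanning
  set.\<close>

lemma fin_dim_separating_functionals:
  fixes M :: "(real, 'a) module" and ev :: "'b \<Rightarrow> 'a \<Rightarrow> real"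
  assumes M: "vectorspace class_ring M" and "finite B"
    and "\<And>b v w. b \<in> B \<Longrightarrow> v \<in> carrier M \<Longrightarrow> w \<in> carrier M \<Longrightarrow> ev b (v \<oplus>\<^bsub>M\<^esub> w) = ev b v + ev b w"
    and "\<And>b r v. b \<in> B \<Longrightarrow> v \<in> carrier M \<Longrightarrow> ev b (r \<odot>\<^bsub>M\<^esub> v) = r * ev b v"
    and "\<And>v. v \<in> carrier M \<Longrightarrow> (\<And>b. b \<in> B \<Longrightarrow> ev b v = 0) \<Longrightarrow> v = \<zero>\<^bsub>M\<^esub>"
  shows "vectorspace.fin_dim class_ring M"
proof -
  interpret vectorspace class_ring M by (rule M)
  have "\<exists>S. finite S \<and> S \<subseteq> carrier M \<and> (\<forall>T. submodule class_ring T M \<and> S \<subseteq> T \<longrightarrow> carrier M \<subseteq> T)"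
    using assms(2,1,3-5) by (rule separating_functionals_generators)
  then obtain S where S': "finite S \<and> S \<subseteq> carrier M \<and> (\<forall>T. submodule class_ring T M \<and> S \<subseteq> T \<longrightarrow> carrier M \<subseteq> T)"
    by (rule exE)
  then have S: "finite S" "S \<subseteq> carrier M" by simp_all
  have gen: "carrier M \<subseteq> T" if "submodule class_ring T M" "S \<subseteq> T" for T
    using conjunct2[OF conjunct2[OF S']] that by simp
  have "carrier M \<subseteq> span S" using span_is_submodule[OF S(2)] in_own_span[OF S(2)] by (rule gen)
  then have "span S = carrier M" using span_is_subset2[OF S(2)] by blast
  then show ?thesis unfolding fin_dim_def using S by blast
qed

text \<open>A basis of the image is independent in \<open>M\<close> and has as many elements as the
  dimension of \<open>M\<close>, so it is a basis of \<open>M\<close>. In its application the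
  equality of dimensions is the rank condition of a pseudo-metric.\<close>

lemma linear_image_eq_carrier:
  fixes E :: "(real, 'a) module" and M :: "(real, 'b) module"
  assumes T: "linear_map class_ring E M T" and E: "vectorspace.fin_dim class_ring E"
    and M: "vectorspace.fin_dim class_ring M"
    and dim: "vectorspace.dim class_ring (M\<lparr>carrier := T ` carrier E\<rparr>) = vectorspace.dim class_ring M"
  shows "T ` carrier E = carrier M"
proof -
  note T' = linear_map_class_ringD[OF T]
  interpret M: vectorspace class_ring M by (rule T')
  let ?S = "T ` carrier E"
  have subset: "?S \<subseteq> carrier M" using T'(3) by blast
  have add: "v \<oplus>\<^bsub>M\<^esub> w \<in> ?S" if vw: "v \<in> ?S" "w \<in> ?S" for v w
  proof -
    obtain v' w' where "v' \<in> carrier E" "v = T v'" "w' \<in> carrier E" "w = T w'" using vw by (elim imageE)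
    then show ?thesis using T'(4)[of v' w'] vectorspace_add_closed[OF T'(1), of v' w'] by (metis imageI)
  qed
  have smult: "r \<odot>\<^bsub>M\<^esub> v \<in> ?S" if v: "v \<in> ?S" for r v
  proof -
    obtain v' where "v' \<in> carrier E" "v = T v'" using v by (elim imageE)
    then show ?thesis using T'(5)[of v' r] vectorspace_smult_closed[OF T'(1), of v' r] by (metis imageI)
  qed
  have zero: "\<zero>\<^bsub>M\<^esub> \<in> ?S"
  proof -
    note z = vectorspace_zero_closed[OF T'(1)]
    have "T (0 \<odot>\<^bsub>E\<^esub> \<zero>\<^bsub>E\<^esub>) = 0 \<odot>\<^bsub>M\<^esub> T \<zero>\<^bsub>E\<^esub>" using z by (rule T'(5))
    then have "T \<zero>\<^bsub>E\<^esub> = \<zero>\<^bsub>M\<^esub>"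
      by (simp add: vectorspace_smult_zero[OF T'(1) z] vectorspace_smult_zero[OF T'(2) T'(3)[OF z]])
    then show ?thesis using imageI[OF z, of T] by simp
  qed
  have sub: "submodule class_ring ?S M" using T'(2) subset zero add smult by (rule submodule_class_ringI)
  have vs: "vectorspace class_ring (M\<lparr>carrier := ?S\<rparr>)" using T'(2) subset zero add smult by (rule vectorspace_subspace)
  interpret S: vectorspace class_ring "M\<lparr>carrier := ?S\<rparr>" by (rule vs)
  interpret TS: linear_map class_ring E "M\<lparr>carrier := ?S\<rparr>" T
    by (rule linear_map_class_ringI[OF T'(1) vs]) (use T'(4,5) in auto)
  have "S.fin_dim" by (rule TS.surj_fin_dim[OF E]) simp
  then obtain \<beta> where \<beta>: "finite \<beta>" "S.basis \<beta>" using S.finite_basis_exists by blast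
  have \<beta>S: "\<beta> \<subseteq> ?S" "S.lin_indpt \<beta>" using \<beta>(2) by (auto simp: S.basis_def)
  have "card \<beta> = M.dim" using S.dim_basis[OF \<beta>] dim by simp
  moreover have "M.lin_indpt \<beta>" using \<beta>S(2) M.span_li_not_depend(2)[OF \<beta>S(1) sub] by blast
  moreover have "\<beta> \<subseteq> carrier M" using \<beta>S(1) subset by blast
  ultimately have "M.basis \<beta>" using M.dim_li_is_basis[OF M \<beta>(1)] by simp
  then have "M.span \<beta> = carrier M" by (simp add: M.basis_def)
  moreover have "M.span \<beta> \<subseteq> ?S" using \<beta>S(1) sub by (rule M.span_is_subset)
  ultimately show ?thesis using subset by blast
qed

section \<open>Duals of vector spaces and the dual diffeology\<close>

lemma vectorspace_real_vs: "vectorspace class_ring real_vs"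
  by (rule vectorspace_class_ringI) (simp_all add: real_vs_def algebra_simps)

lemma dual_space_memI:
  assumes E: "vectorspace class_ring E" and "\<phi> \<in> extensional (carrier E)"
    and "\<And>v w. v \<in> carrier E \<Longrightarrow> w \<in> carrier E \<Longrightarrow> \<phi> (v \<oplus>\<^bsub>E\<^esub> w) = \<phi> v + \<phi> w"
    and "\<And>r v. v \<in> carrier E \<Longrightarrow> \<phi> (r \<odot>\<^bsub>E\<^esub> v) = r * \<phi> v"
    and "\<And>n U p. plot D n U p \<Longrightarrow> p ` U \<subseteq> carrier E \<Longrightarrow> openin (Euclidean_space n) U \<and> Cinf_on n U (\<lambda>u. \<phi> (p u))"
  shows "\<phi> \<in> carrier (dual_space D E)"
proof -
  have "linear_map class_ring E real_vs \<phi>"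
    using E vectorspace_real_vs by (rule linear_map_class_ringI) (use assms in \<open>simp_all add: real_vs_def\<close>)
  moreover have "smooth_map (sub_diff D (carrier E)) real_diff \<phi>"
    using assms(5) by (auto simp: smooth_map_def sub_diff_def real_diff_def)
  ultimately show ?thesis using assms(2) by (simp add: dual_space_def)
qed

lemma dual_space_memD:
  assumes "\<phi> \<in> carrier (dual_space D E)"
  shows "\<phi> \<in> extensional (carrier E)"
    and "v \<in> carrier E \<Longrightarrow> w \<in> carrier E \<Longrightarrow> \<phi> (v \<oplus>\<^bsub>E\<^esub> w) = \<phi> v + \<phi> w"
    and "v \<in> carrier E \<Longrightarrow> \<phi> (r \<odot>\<^bsub>E\<^esub> v) = r * \<phi> v"
    and "plot D n U p \<Longrightarrow> p ` U \<subseteq> carrier E \<Longrightarrow> openin (Euclidean_space n) U"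
    and "plot D n U p \<Longrightarrow> p ` U \<subseteq> carrier E \<Longrightarrow> Cinf_on n U (\<lambda>u. \<phi> (p u))"
proof -
  have lin: "linear_map class_ring E real_vs \<phi>" and sm: "smooth_map (sub_diff D (carrier E)) real_diff \<phi>"
    and ext: "\<phi> \<in> extensional (carrier E)" using assms by (auto simp: dual_space_def)
  show "\<phi> \<in> extensional (carrier E)" by (rule ext)
  show "v \<in> carrier E \<Longrightarrow> w \<in> carrier E \<Longrightarrow> \<phi> (v \<oplus>\<^bsub>E\<^esub> w) = \<phi> v + \<phi> w"
    "v \<in> carrier E \<Longrightarrow> \<phi> (r \<odot>\<^bsub>E\<^esub> v) = r * \<phi> v"
    using linear_map_class_ringD(4,5)[OF lin] by (simp_all add: real_vs_def)
  show "plot D n U p \<Longrightarrow> p ` U \<subseteq> carrier E \<Longrightarrow> openin (Euclidean_space n) U"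
    "plot D n U p \<Longrightarrow> p ` U \<subseteq> carrier E \<Longrightarrow> Cinf_on n U (\<lambda>u. \<phi> (p u))"
    using smooth_mapD[OF sm, of n U p] by (simp_all add: sub_diff_def real_diff_def)
qed

lemma dual_space_ops:
  "\<zero>\<^bsub>dual_space D E\<^esub> = restrict (\<lambda>v. 0) (carrier E)"
  "\<phi> \<oplus>\<^bsub>dual_space D E\<^esub> \<psi> = restrict (\<lambda>v. \<phi> v + \<psi> v) (carrier E)"
  "r \<odot>\<^bsub>dual_space D E\<^esub> \<phi> = restrict (\<lambda>v. r * \<phi> v) (carrier E)"
  by (simp_all add: dual_space_def)

lemma dual_space_closed:
  assumes E: "vectorspace class_ring E"
    and D: "open_plots D"
  shows "restrict (\<lambda>v. 0) (carrier E) \<in> carrier (dual_space D E)"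
    and "\<phi> \<in> carrier (dual_space D E) \<Longrightarrow> \<psi> \<in> carrier (dual_space D E) \<Longrightarrow>
      restrict (\<lambda>v. \<phi> v + \<psi> v) (carrier E) \<in> carrier (dual_space D E)"
    and "\<phi> \<in> carrier (dual_space D E) \<Longrightarrow> restrict (\<lambda>v. r * \<phi> v) (carrier E) \<in> carrier (dual_space D E)"
proof -
  note D = D[unfolded open_plots_def, rule_format]
  note cl = vectorspace_add_closed[OF E] vectorspace_smult_closed[OF E]
  have restr: "Cinf_on n U (\<lambda>u. restrict f (carrier E) (p u))" if "Cinf_on n U (\<lambda>u. f (p u))" "p ` U \<subseteq> carrier E"
    for n U p and f :: "'a \<Rightarrow> real"
    using that(1) by (rule Cinf_on_cong) (use that(2) in auto)
  show "restrict (\<lambda>v. 0) (carrier E) \<in> carrier (dual_space D E)"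
  proof (rule dual_space_memI[OF E])
    show "openin (Euclidean_space n) U \<and> Cinf_on n U (\<lambda>u. restrict (\<lambda>v. 0) (carrier E) (p u))"
      if "plot D n U p" "p ` U \<subseteq> carrier E" for n U p
      using D[OF that(1)] restr[OF Cinf_on_const that(2)] by blast
  qed (simp_all add: cl)
  assume \<phi>: "\<phi> \<in> carrier (dual_space D E)"
  note \<phi>' = dual_space_memD[OF \<phi>]
  show "restrict (\<lambda>v. \<phi> v + \<psi> v) (carrier E) \<in> carrier (dual_space D E)" if \<psi>: "\<psi> \<in> carrier (dual_space D E)"
  proof (rule dual_space_memI[OF E])
    note \<psi>' = dual_space_memD[OF \<psi>]
    show "openin (Euclidean_space n) U \<and> Cinf_on n U (\<lambda>u. restrict (\<lambda>v. \<phi> v + \<psi> v) (carrier E) (p u))"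
      if p: "plot D n U p" "p ` U \<subseteq> carrier E" for n U p
    proof
      show "Cinf_on n U (\<lambda>u. restrict (\<lambda>v. \<phi> v + \<psi> v) (carrier E) (p u))"
        by (rule restr[OF Cinf_on_add[OF \<phi>'(5)[OF p] \<psi>'(5)[OF p]] p(2)])
    qed (rule D[OF p(1)])
  qed (simp_all add: cl dual_space_memD[OF \<phi>] dual_space_memD[OF \<psi>] algebra_simps)
  show "restrict (\<lambda>v. r * \<phi> v) (carrier E) \<in> carrier (dual_space D E)"
  proof (rule dual_space_memI[OF E])
    show "openin (Euclidean_space n) U \<and> Cinf_on n U (\<lambda>u. restrict (\<lambda>v. r * \<phi> v) (carrier E) (p u))"
      if p: "plot D n U p" "p ` U \<subseteq> carrier E" for n U p
    proof
      show "Cinf_on n U (\<lambda>u. restrict (\<lambda>v. r * \<phi> v) (carrier E) (p u))"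
        by (rule restr[OF Cinf_on_mult[OF openin_subset[OF D[OF p(1)]] Cinf_on_const \<phi>'(5)[OF p]] p(2)])
    qed (rule D[OF p(1)])
  qed (simp_all add: cl \<phi>' algebra_simps)
qed

lemma vectorspace_dual_space:
  assumes E: "vectorspace class_ring E"
    and D: "open_plots D"
  shows "vectorspace class_ring (dual_space D E)"
proof (rule vectorspace_class_ringI, unfold dual_space_ops)
  fix \<phi> assume \<phi>: "\<phi> \<in> carrier (dual_space D E)"
  have ext: "restrict \<phi> (carrier E) = \<phi>" using dual_space_memD(1)[OF \<phi>] by (simp add: extensional_restrict)
  show "restrict (\<lambda>v. \<phi> v + restrict (\<lambda>v. 0) (carrier E) v) (carrier E) = \<phi>"
    by (subst (2) ext[symmetric]) (rule restrict_ext, simp)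
  show "restrict (\<lambda>v. 1 * \<phi> v) (carrier E) = \<phi>" using ext by simp
qed (use dual_space_closed[OF E D] in \<open>auto intro!: restrict_ext simp: algebra_simps\<close>)

text \<open>Smoothness on the fibre product is tested by pairs of parametrisations, the second one
  being followed by \<open>p\<close>. As \<open>p\<close> after a smooth map is again a plot, the
  second parametrisation may be taken to be the identity, so \<open>a\<close> and \<open>p\<close>
  live on one common domain.\<close>

lemma dual_plot_iff:
  assumes V: "plot_system (total_sp V)"
  shows "plot (dual_diff V) m W q \<longleftrightarrow> q ` W \<subseteq> points (dual_diff V) \<and> plot (base_sp V) m W (\<lambda>w. fst (q w)) \<and>
    (\<forall>k T a p. openin (Euclidean_space k) T \<and> Cinf_map k T m W a \<and> plot (total_sp V) k T p \<and>
      (\<forall>t\<in>T. fst (q (a t)) = prj V (p t)) \<longrightarrow> Cinf_on k T (\<lambda>t. snd (q (a t)) (p t)))"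
  (is "_ \<longleftrightarrow> _ \<and> _ \<and> ?ev")
proof -
  interpret V: plot_system "total_sp V" by (rule V)
  let ?P = "\<lambda>n U p. sub_diff (prod_diff (euclid_diff m W) (euclid_diff n U)) {(w, u). fst (q w) = prj V (p u)}"
  have "(\<forall>n U p. plot (total_sp V) n U p \<longrightarrow> smooth_map (?P n U p) real_diff (\<lambda>(w, u). snd (q w) (p u))) \<longleftrightarrow> ?ev"
  proof (intro iffI allI impI)
    fix k T a p
    assume *: "\<forall>n U p. plot (total_sp V) n U p \<longrightarrow> smooth_map (?P n U p) real_diff (\<lambda>(w, u). snd (q w) (p u))"
      and a: "openin (Euclidean_space k) T \<and> Cinf_map k T m W a \<and> plot (total_sp V) k T p \<and>
        (\<forall>t\<in>T. fst (q (a t)) = prj V (p t))"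
    have "plot (?P k T p) k T (\<lambda>t. (a t, t))"
      using a by (auto simp: sub_diff_def prod_diff_def euclid_diff_def Cinf_map_id)
    moreover have "smooth_map (?P k T p) real_diff (\<lambda>(w, u). snd (q w) (p u))"
      using * a by blast
    ultimately have "plot real_diff k T (\<lambda>t. (\<lambda>(w, u). snd (q w) (p u)) (a t, t))"
      by (rule smooth_mapD[rotated])
    then show "Cinf_on k T (\<lambda>t. snd (q (a t)) (p t))" by (simp add: real_diff_def)
  next
    fix n U p assume ev: ?ev and p: "plot (total_sp V) n U p"
    show "smooth_map (?P n U p) real_diff (\<lambda>(w, u). snd (q w) (p u))"
      unfolding smooth_map_def
    proof (intro conjI allI impI)
      fix k T y assume y: "plot (?P n U p) k T y"
      then have T: "openin (Euclidean_space k) T" and a: "Cinf_map k T m W (\<lambda>t. fst (y t))"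
        and c: "Cinf_map k T n U (\<lambda>t. snd (y t))" and eq: "\<forall>t\<in>T. fst (q (fst (y t))) = prj V (p (snd (y t)))"
        by (auto simp: sub_diff_def prod_diff_def euclid_diff_def)
      have "plot (total_sp V) k T (\<lambda>t. p (snd (y t)))" using p T c by (rule V.plot_comp)
      then have "Cinf_on k T (\<lambda>t. snd (q (fst (y t))) (p (snd (y t))))" using ev T a eq by blast
      then show "plot real_diff k T (\<lambda>t. (\<lambda>(w, u). snd (q w) (p u)) (y t))"
        using T by (simp add: real_diff_def case_prod_beta)
    qed (simp add: real_diff_def)
  qed
  then show ?thesis by (simp add: dual_diff_def)
qed

lemma dual_points: "points (dual_diff V) = {(x, \<phi>). x \<in> points (base_sp V) \<and> \<phi> \<in> carrier (dual_space (total_sp V) (fib V x))}"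
  by (simp add: dual_diff_def)

context vector_family
begin

lemma plot_system_dual: "plot_system (dual_diff V)"
proof
  note dp = dual_plot_iff[OF total_plots]
  fix n m U W p q F x
  show op: "openin (Euclidean_space n) U" if "plot (dual_diff V) n U p"
    using that unfolding dp by (blast intro: base.plot_open)
  show "p ` U \<subseteq> points (dual_diff V)" if "plot (dual_diff V) n U p"
    using that unfolding dp by blast
  show "plot (dual_diff V) n U q" if p: "plot (dual_diff V) n U p" and qp: "\<And>u. u \<in> U \<Longrightarrow> q u = p u"
    unfolding dp
  proof (intro conjI allI impI)
    show "q ` U \<subseteq> points (dual_diff V)" using p qp unfolding dp by auto
    show "plot (base_sp V) n U (\<lambda>w. fst (q w))"
      by (rule base.plot_cong[of n U "\<lambda>w. fst (p w)"]) (use p qp in \<open>auto simp: dp\<close>)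
    fix k T a r
    assume a: "openin (Euclidean_space k) T \<and> Cinf_map k T n U a \<and> plot (total_sp V) k T r \<and>
        (\<forall>t\<in>T. fst (q (a t)) = prj V (r t))"
    then have qa: "q (a t) = p (a t)" if "t \<in> T" for t using qp that by (auto simp: Cinf_map_def)
    with a have "openin (Euclidean_space k) T \<and> Cinf_map k T n U a \<and> plot (total_sp V) k T r \<and>
        (\<forall>t\<in>T. fst (p (a t)) = prj V (r t))" by simp
    with p have "Cinf_on k T (\<lambda>t. snd (p (a t)) (r t))" unfolding dp by blast
    then show "Cinf_on k T (\<lambda>t. snd (q (a t)) (r t))" by (rule Cinf_on_cong) (simp add: qa)
  qed
  show "plot (dual_diff V) n U (\<lambda>_. y)" if U: "openin (Euclidean_space n) U" and y: "y \<in> points (dual_diff V)" for y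
    unfolding dp
  proof (intro conjI allI impI)
    have x: "fst y \<in> points (base_sp V)" and \<phi>: "snd y \<in> carrier (dual_space (total_sp V) (fib V (fst y)))"
      using y by (auto simp: dual_points)
    show "(\<lambda>_. y) ` U \<subseteq> points (dual_diff V)" using y by blast
    show "plot (base_sp V) n U (\<lambda>w. fst y)" using U x by (rule base.plot_const)
    fix k T a r
    assume a: "openin (Euclidean_space k) T \<and> Cinf_map k T n U a \<and> plot (total_sp V) k T r \<and>
        (\<forall>t\<in>T. fst y = prj V (r t))"
    \<comment> \<open>Against a constant functional the testing plot stays in one fibre, where the
      functional is smooth by definition of the dual space.\<close>
    have "r t \<in> carrier (fib V (fst y))" if "t \<in> T" for t
      unfolding in_fib_iff[OF x] using a that total.plot_in_points by metis
    then have "r ` T \<subseteq> carrier (fib V (fst y))" by blast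
    then show "Cinf_on k T (\<lambda>t. snd y (r t))" using a dual_space_memD(5)[OF \<phi>] by blast
  qed
  show "plot (dual_diff V) m W (\<lambda>w. p (F w))"
    if p: "plot (dual_diff V) n U p" and W: "openin (Euclidean_space m) W" and F: "Cinf_map m W n U F"
    unfolding dp
  proof (intro conjI allI impI)
    have U: "openin (Euclidean_space n) U" using p unfolding dp by (blast intro: base.plot_open)
    show "(\<lambda>w. p (F w)) ` W \<subseteq> points (dual_diff V)" using p F unfolding dp Cinf_map_def by auto
    show "plot (base_sp V) m W (\<lambda>w. fst (p (F w)))"
      by (rule base.plot_comp[OF _ W F]) (use p in \<open>simp add: dp\<close>)
    fix k T a r
    assume a: "openin (Euclidean_space k) T \<and> Cinf_map k T m W a \<and> plot (total_sp V) k T r \<and>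
        (\<forall>t\<in>T. fst (p (F (a t))) = prj V (r t))"
    then have "Cinf_map k T n U (\<lambda>t. F (a t))"
      using Cinf_map_compose[OF openin_subset openin_subset[OF W] _ F] by blast
    with a p show "Cinf_on k T (\<lambda>t. snd (p (F (a t))) (r t))" unfolding dp by blast
  qed
qed

lemma fib_dual: "fib (dual_bundle V) x = transport (Pair x) (dual_space (total_sp V) (fib V x))"
  by (simp add: dual_bundle_def)

lemma inj_on_Pair: "inj_on (Pair x) A"
  by (simp add: inj_on_def)

lemma fib_dual_simps:
  fixes x
  defines "M \<equiv> dual_space (total_sp V) (fib V x)"
  shows "carrier (fib (dual_bundle V) x) = Pair x ` carrier M"
    "\<zero>\<^bsub>fib (dual_bundle V) x\<^esub> = (x, \<zero>\<^bsub>M\<^esub>)"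
    "\<phi> \<in> carrier M \<Longrightarrow> \<psi> \<in> carrier M \<Longrightarrow> (x, \<phi>) \<oplus>\<^bsub>fib (dual_bundle V) x\<^esub> (x, \<psi>) = (x, \<phi> \<oplus>\<^bsub>M\<^esub> \<psi>)"
    "\<phi> \<in> carrier M \<Longrightarrow> r \<odot>\<^bsub>fib (dual_bundle V) x\<^esub> (x, \<phi>) = (x, r \<odot>\<^bsub>M\<^esub> \<phi>)"
  unfolding fib_dual M_def by (rule transport_simps[OF inj_on_Pair]; assumption)+

lemma vectorspace_dual: "x \<in> points (base_sp V) \<Longrightarrow> vectorspace class_ring (dual_space (total_sp V) (fib V x))"
  by (rule vectorspace_dual_space[OF fib_vectorspace total.open_plots])

lemma vector_family_dual: "vector_family (dual_bundle V)"
proof (rule vector_family.intro)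
  show "diffeological_space (base_sp (dual_bundle V))" by (simp add: dual_bundle_def base_diffeology)
  show "plot_system (total_sp (dual_bundle V))" by (simp add: dual_bundle_def plot_system_dual)
  show "smooth_map (total_sp (dual_bundle V)) (base_sp (dual_bundle V)) (prj (dual_bundle V))"
    unfolding smooth_map_def by (auto simp: dual_bundle_def dual_diff_def)
  fix x assume "x \<in> points (base_sp (dual_bundle V))"
  then have x: "x \<in> points (base_sp V)" by (simp add: dual_bundle_def)
  show "carrier (fib (dual_bundle V) x) = over (dual_bundle V) {x}"
    unfolding fib_dual_simps(1) using x by (auto simp: over_def dual_bundle_def dual_points)
  show "vectorspace class_ring (fib (dual_bundle V) x)"
    unfolding fib_dual using vectorspace_dual[OF x] inj_on_Pair by (rule vectorspace_transport)
qed

text \<open>Evaluations at a finite spanning set \<open>B\<close> separate functionals: the zeros of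
  a functional form a subspace, and a subspace containing \<open>B\<close> is the whole
  fibre.\<close>

lemma fin_dim_dual:
  assumes x: "x \<in> points (base_sp V)" and fd: "vectorspace.fin_dim class_ring (fib V x)"
  shows "vectorspace.fin_dim class_ring (fib (dual_bundle V) x)"
proof -
  interpret E: vectorspace class_ring "fib V x" using x by (rule fib_vectorspace)
  obtain B where B: "finite B" "B \<subseteq> carrier (fib V x)" "E.span B = carrier (fib V x)"
    using fd unfolding E.fin_dim_def by blast
  have W: "vectorspace class_ring (fib (dual_bundle V) x)"
    using vector_family.fib_vectorspace[OF vector_family_dual, of x] x by (simp add: dual_bundle_def)
  show ?thesis
  proof (rule fin_dim_separating_functionals[OF W B(1), of "\<lambda>b \<phi>. snd \<phi> b"])
    fix b \<phi> \<psi> and r :: real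
    assume b: "b \<in> B"
    assume "\<phi> \<in> carrier (fib (dual_bundle V) x)"
    then obtain \<phi>' where \<phi>: "\<phi>' \<in> carrier (dual_space (total_sp V) (fib V x))" "\<phi> = (x, \<phi>')"
      unfolding fib_dual_simps(1) by (elim imageE)
    have bc: "b \<in> carrier (fib V x)" using b B(2) by blast
    show "snd (r \<odot>\<^bsub>fib (dual_bundle V) x\<^esub> \<phi>) b = r * snd \<phi> b"
      using bc by (simp add: \<phi>(2) fib_dual_simps(4)[OF \<phi>(1)] dual_space_ops)
    assume "\<psi> \<in> carrier (fib (dual_bundle V) x)"
    then obtain \<psi>' where \<psi>: "\<psi>' \<in> carrier (dual_space (total_sp V) (fib V x))" "\<psi> = (x, \<psi>')"
      unfolding fib_dual_simps(1) by (elim imageE)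
    show "snd (\<phi> \<oplus>\<^bsub>fib (dual_bundle V) x\<^esub> \<psi>) b = snd \<phi> b + snd \<psi> b"
      using bc by (simp add: \<phi>(2) \<psi>(2) fib_dual_simps(3)[OF \<phi>(1) \<psi>(1)] dual_space_ops)
  next
    fix \<phi> assume "\<phi> \<in> carrier (fib (dual_bundle V) x)" and zero: "\<And>b. b \<in> B \<Longrightarrow> snd \<phi> b = 0"
    then obtain \<phi>' where \<phi>: "\<phi>' \<in> carrier (dual_space (total_sp V) (fib V x))" "\<phi> = (x, \<phi>')"
      unfolding fib_dual_simps(1) by (elim imageE)
    note \<phi>' = dual_space_memD[OF \<phi>(1)]
    note E = fib_vectorspace[OF x]
    have "submodule class_ring {v \<in> carrier (fib V x). \<phi>' v = 0} (fib V x)"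
    proof (rule submodule_class_ringI[OF E])
      have "\<phi>' \<zero>\<^bsub>fib V x\<^esub> = 0"
        using \<phi>'(3)[OF vectorspace_zero_closed[OF E], of 0] vectorspace_smult_zero[OF E vectorspace_zero_closed[OF E]]
        by simp
      then show "\<zero>\<^bsub>fib V x\<^esub> \<in> {v \<in> carrier (fib V x). \<phi>' v = 0}" using vectorspace_zero_closed[OF E] by simp
    qed (use \<phi>'(2,3) vectorspace_add_closed[OF E] vectorspace_smult_closed[OF E] in auto)
    moreover have "B \<subseteq> {v \<in> carrier (fib V x). \<phi>' v = 0}" using zero B(2) \<phi>(2) by auto
    ultimately have "E.span B \<subseteq> {v \<in> carrier (fib V x). \<phi>' v = 0}" by (intro E.span_is_subset)
    then have "\<phi>' v = 0" if "v \<in> carrier (fib V x)" for v using that B(3) by auto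
    then have "restrict \<phi>' (carrier (fib V x)) = restrict (\<lambda>v. 0) (carrier (fib V x))" by (rule restrict_ext)
    then show "\<phi> = \<zero>\<^bsub>fib (dual_bundle V) x\<^esub>"
      using \<phi>'(1) by (simp add: \<phi>(2) fib_dual_simps(2) dual_space_ops extensional_restrict)
  qed
qed

end

section \<open>Pseudo-metrics and dual forms\<close>

lemma bilin_eval_add: "bilin_eval (a + b) v w = bilin_eval a v w + bilin_eval b v w"
  unfolding bilin_eval_def
  by (rule setsum_keys_plus_distrib[where f = "\<lambda>z c. case letters z of [\<phi>, \<psi>] \<Rightarrow> c * snd \<phi> v * snd \<psi> w | _ \<Rightarrow> 0"])
    (auto simp: algebra_simps split: list.split)

lemma bilin_eval_zero: "bilin_eval 0 v w = 0"
  by (simp add: bilin_eval_def)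

lemma bilin_eval_diff: "bilin_eval (a - b) v w = bilin_eval a v w - bilin_eval b v w"
  using bilin_eval_add[of "a - b" b v w] by simp

lemma bilin_eval_single:
  "bilin_eval (Poly_Mapping.single z c) v w =
     (case letters z of [\<phi>, \<psi>] \<Rightarrow> c * snd \<phi> v * snd \<psi> w | _ \<Rightarrow> 0)"
  by (auto simp: bilin_eval_def split: list.split)

lemma bilin_eval_single_word2:
  "bilin_eval (Poly_Mapping.single (Word [\<phi>, \<psi>]) c) v w = c * snd \<phi> v * snd \<psi> w"
  by (simp add: bilin_eval_single)

text \<open>\<open>bilin_eval\<close> reads only words of two letters. Between two words the
  relation inserts one letter, so a nonzero value would need exactly one further letter, to the left
  or to the right. The inserted letter is then evaluated at \<open>w\<close> or at \<open>v\<close>,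
  where linearity makes the three contributions cancel.\<close>

lemma bilin_eval_relation_sandwich:
  assumes v: "snd \<rho> v = r * snd \<phi> v + s * snd \<psi> v" and w: "snd \<rho> w = r * snd \<phi> w + s * snd \<psi> w"
  shows "bilin_eval (l * (Poly_Mapping.single (Word [\<rho>]) 1 - Poly_Mapping.single (Word [\<phi>]) r
    - Poly_Mapping.single (Word [\<psi>]) s) * k) v w = 0"
proof (induction l rule: poly_mapping_single_induct)
  case (single x c)
  show ?case
  proof (induction k rule: poly_mapping_single_induct)
    case (single y d)
    have *: "Poly_Mapping.single x c * Poly_Mapping.single (Word [\<theta>]) e * Poly_Mapping.single y d =
        Poly_Mapping.single (Word (letters x @ \<theta> # letters y)) (c * e * d)" for \<theta> e
      by (simp add: mult_single plus_tword_def)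
    \<comment> \<open>The second and the fourth case give words of length two. In the last case two
      letters already precede the inserted one, so the word is too long whatever \<open>y\<close>
      is.\<close>
    consider "letters x = []" "letters y = []" | q where "letters x = []" "letters y = [q]"
      | q q' ys where "letters x = []" "letters y = q # q' # ys"
      | p where "letters x = [p]" "letters y = []" | p q ys where "letters x = [p]" "letters y = q # ys"
      | p p' xs where "letters x = p # p' # xs"
      by (metis neq_Nil_conv)
    then show ?case
      unfolding right_diff_distrib left_diff_distrib * bilin_eval_diff bilin_eval_single tword.sel
    proof cases
      case 6
      then show "(case letters x @ \<rho> # letters y of [\<phi>, \<psi>] \<Rightarrow> c * 1 * d * snd \<phi> v * snd \<psi> w | _ \<Rightarrow> 0)
        - (case letters x @ \<phi> # letters y of [\<phi>, \<psi>] \<Rightarrow> c * r * d * snd \<phi> v * snd \<psi> w | _ \<Rightarrow> 0)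
        - (case letters x @ \<psi> # letters y of [\<phi>, \<psi>] \<Rightarrow> c * s * d * snd \<phi> v * snd \<psi> w | _ \<Rightarrow> 0) = 0"
        by (simp split: list.split)
    qed (simp_all add: v w algebra_simps)
  qed (simp_all add: bilin_eval_zero bilin_eval_add distrib_left)
qed (simp_all add: bilin_eval_zero bilin_eval_add distrib_right)

lemma bilin_eval_tensor_ideal:
  assumes M: "vectorspace class_ring M"
    and v: "\<And>\<phi> \<psi> r s. \<phi> \<in> carrier M \<Longrightarrow> \<psi> \<in> carrier M \<Longrightarrow>
      snd (r \<odot>\<^bsub>M\<^esub> \<phi> \<oplus>\<^bsub>M\<^esub> s \<odot>\<^bsub>M\<^esub> \<psi>) v = r * snd \<phi> v + s * snd \<psi> v"
    and w: "\<And>\<phi> \<psi> r s. \<phi> \<in> carrier M \<Longrightarrow> \<psi> \<in> carrier M \<Longrightarrow>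
      snd (r \<odot>\<^bsub>M\<^esub> \<phi> \<oplus>\<^bsub>M\<^esub> s \<odot>\<^bsub>M\<^esub> \<psi>) w = r * snd \<phi> w + s * snd \<psi> w"
    and a: "a \<in> tensor_ideal M"
  shows "bilin_eval a v w = 0"
proof -
  let ?A = "free_alg (carrier M)"
  \<comment> \<open>The zero set of \<open>bilin_eval\<close> is not an ideal: a single letter
    evaluates to 0, but a product of two letters need not. Multiplying by arbitrary elements on both
    sides inside the condition makes it two-sided.\<close>
  let ?J = "{a \<in> carrier ?A. \<forall>l k. bilin_eval (l * a * k) v w = 0}"
  have "ideal ?J ?A"
  proof (rule idealI[OF ring_free_alg])
    have minus: "\<ominus>\<^bsub>?A\<^esub> x = - x" if "x \<in> carrier ?A" for x
    proof -
      interpret ring ?A by (rule ring_free_alg)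
      show ?thesis
        by (rule minus_equality) (use that in \<open>auto simp: free_alg_ops free_alg_closed\<close>)
    qed
    show "subgroup ?J (add_monoid ?A)"
    proof (rule group.subgroupI)
      show "Group.group (add_monoid ?A)"
        using ring_free_alg[of "carrier M"] by (simp add: ring_def abelian_group_def abelian_group_axioms_def comm_group_def)
      show "?J \<subseteq> carrier (add_monoid ?A)" by auto
      show "?J \<noteq> {}" using free_alg_closed(1)[of "carrier M"] by (auto simp: bilin_eval_zero intro: exI[of _ 0])
      show "inv\<^bsub>add_monoid ?A\<^esub> x \<in> ?J" if "x \<in> ?J" for x
        using that minus[of x] bilin_eval_diff[of 0 "_ * x * _" v w]
        by (simp add: a_inv_def free_alg_closed bilin_eval_zero)
      show "x \<otimes>\<^bsub>add_monoid ?A\<^esub> y \<in> ?J" if "x \<in> ?J" "y \<in> ?J" for x y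
        using that by (simp add: free_alg_ops free_alg_closed distrib_left distrib_right bilin_eval_add)
    qed
    show "x \<otimes>\<^bsub>?A\<^esub> a \<in> ?J" if "a \<in> ?J" "x \<in> carrier ?A" for a x
      using that by (simp add: free_alg_ops free_alg_closed) (metis mult.assoc)
    show "a \<otimes>\<^bsub>?A\<^esub> x \<in> ?J" if "a \<in> ?J" "x \<in> carrier ?A" for a x
      using that by (simp add: free_alg_ops free_alg_closed mult.assoc)
  qed
  moreover have "tensor_relations M \<subseteq> ?J"
  proof
    fix a assume a: "a \<in> tensor_relations M"
    then have "a \<in> carrier ?A" using tensor_relations_subset[OF M] by blast
    moreover obtain r s \<phi> \<psi> where \<phi>: "\<phi> \<in> carrier M" "\<psi> \<in> carrier M"
      and a': "a = Poly_Mapping.single (Word [r \<odot>\<^bsub>M\<^esub> \<phi> \<oplus>\<^bsub>M\<^esub> s \<odot>\<^bsub>M\<^esub> \<psi>]) 1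
        - Poly_Mapping.single (Word [\<phi>]) r - Poly_Mapping.single (Word [\<psi>]) s"
      using a by blast
    have "bilin_eval (l * a * k) v w = 0" for l k
      unfolding a' by (rule bilin_eval_relation_sandwich[OF v[OF \<phi>] w[OF \<phi>]])
    ultimately show "a \<in> ?J" by blast
  qed
  ultimately have "tensor_ideal M \<subseteq> ?J"
    unfolding tensor_ideal_def by (rule ring.genideal_minimal[OF ring_free_alg])
  then have "bilin_eval (1 * a * 1) v w = 0" using a by blast
  then show ?thesis by simp
qed

context vector_family
begin

lemma snd_dual_comb:
  assumes x: "x \<in> points (base_sp V)" and v: "v \<in> carrier (fib V x)"
    and \<phi>: "\<phi> \<in> carrier (fib (dual_bundle V) x)" "\<psi> \<in> carrier (fib (dual_bundle V) x)"
  shows "snd (r \<odot>\<^bsub>fib (dual_bundle V) x\<^esub> \<phi> \<oplus>\<^bsub>fib (dual_bundle V) x\<^esub> s \<odot>\<^bsub>fib (dual_bundle V) x\<^esub> \<psi>) v =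
    r * snd \<phi> v + s * snd \<psi> v"
proof -
  let ?M = "dual_space (total_sp V) (fib V x)"
  obtain \<phi>' \<psi>' where p: "\<phi>' \<in> carrier ?M" "\<phi> = (x, \<phi>')" "\<psi>' \<in> carrier ?M" "\<psi> = (x, \<psi>')"
    using \<phi> unfolding fib_dual_simps(1) by (elim imageE)
  note cl = vectorspace_smult_closed[OF vectorspace_dual[OF x]]
  have "r \<odot>\<^bsub>fib (dual_bundle V) x\<^esub> \<phi> \<oplus>\<^bsub>fib (dual_bundle V) x\<^esub> s \<odot>\<^bsub>fib (dual_bundle V) x\<^esub> \<psi> =
    (x, r \<odot>\<^bsub>?M\<^esub> \<phi>' \<oplus>\<^bsub>?M\<^esub> s \<odot>\<^bsub>?M\<^esub> \<psi>')"
    unfolding p(2,4) fib_dual_simps(4)[OF p(1)] fib_dual_simps(4)[OF p(3)] fib_dual_simps(3)[OF cl[OF p(1)] cl[OF p(3)]] ..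
  then show ?thesis using v by (simp add: dual_space_ops p(2,4))
qed

text \<open>\<open>form_of\<close> takes \<open>the_elem\<close> over a coset of the tensor ideal.
  Elements of that ideal evaluate to 0, so any representative computes the form, and one of degree
  two exists by the type of the section.\<close>

lemma pseudo_metric_representative:
  assumes g: "pseudo_metric V g" and x: "x \<in> points (base_sp V)"
  obtains a where "a \<in> homogeneous (fib (dual_bundle V) x) 2"
    "\<And>v w. v \<in> carrier (fib V x) \<Longrightarrow> w \<in> carrier (fib V x) \<Longrightarrow> form_of g x v w = bilin_eval a v w"
proof -
  let ?W = "fib (dual_bundle V) x"
  have W: "vectorspace class_ring ?W"
    using vector_family.fib_vectorspace[OF vector_family_dual, of x] x by (simp add: dual_bundle_def)
  have "g x \<in> points (total_sp (tensor_power_bundle (dual_bundle V) 2))" and gx: "fst (g x) = x"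
    using g x by (auto simp: pseudo_metric_def smooth_map_def)
  then have "snd (g x) \<in> carrier (tensor_power ?W 2)"
    by (auto simp: tensor_power_bundle_def tensor_power_with_def tensor_power_diff_def)
  then obtain a where a: "snd (g x) = tensor_class ?W a" "a \<in> homogeneous ?W 2"
    unfolding tensor_power_simps by (rule imageE)
  have "form_of g x v w = bilin_eval a v w" if v: "v \<in> carrier (fib V x)" "w \<in> carrier (fib V x)" for v w
  proof -
    have "bilin_eval b v w = bilin_eval a v w" if b: "b \<in> tensor_class ?W a" for b
    proof -
      obtain i where i: "i \<in> tensor_ideal ?W" "b = i + a"
        using b unfolding tensor_class_def a_r_coset_def' free_alg_ops by blast
      have "bilin_eval i v w = 0"
        using W snd_dual_comb[OF x v(1)] snd_dual_comb[OF x v(2)] i(1) by (rule bilin_eval_tensor_ideal)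
      then show ?thesis by (simp add: i(2) bilin_eval_add)
    qed
    moreover have "a \<in> tensor_class ?W a"
    proof -
      interpret I: ideal "tensor_ideal ?W" "free_alg (carrier ?W)" using W by (rule ideal_tensor_ideal)
      show ?thesis unfolding tensor_class_def by (rule I.a_rcos_self) (use a(2) in simp)
    qed
    ultimately have "(\<lambda>b. bilin_eval b v w) ` snd (g x) = {bilin_eval a v w}" unfolding a(1) by blast
    then show ?thesis by (simp add: form_of_def)
  qed
  with a(2) show thesis by (rule that)
qed

text \<open>Every word of \<open>a\<close> is a pair of smooth functionals on the same fibre. With
  the first argument fixed, the form is a linear combination of the second functionals; linearity in
  the first argument comes from the first ones.\<close>

lemma bilin_eval_dual:
  assumes x: "x \<in> points (base_sp V)" and a: "a \<in> homogeneous (fib (dual_bundle V) x) 2"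
  shows "restrict (bilin_eval a v) (carrier (fib V x)) \<in> carrier (dual_space (total_sp V) (fib V x))"
    and "u \<in> carrier (fib V x) \<Longrightarrow> v \<in> carrier (fib V x) \<Longrightarrow>
      bilin_eval a (u \<oplus>\<^bsub>fib V x\<^esub> v) w = bilin_eval a u w + bilin_eval a v w"
    and "v \<in> carrier (fib V x) \<Longrightarrow> bilin_eval a (r \<odot>\<^bsub>fib V x\<^esub> v) w = r * bilin_eval a v w"
proof -
  let ?E = "fib V x" and ?M = "dual_space (total_sp V) (fib V x)"
  note cl = dual_space_closed[OF fib_vectorspace[OF x] total.open_plots]
  have word: "\<exists>\<phi> \<psi>. z = Word [(x, \<phi>), (x, \<psi>)] \<and> \<phi> \<in> carrier ?M \<and> \<psi> \<in> carrier ?M"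
    if "z \<in> Poly_Mapping.keys a" for z
  proof -
    have "length (letters z) = 2" and c: "set (letters z) \<subseteq> Pair x ` carrier ?M"
      using a that by (auto simp: carrier_free_alg fib_dual_simps(1))
    then obtain p q where "letters z = [p, q]" by (auto simp: numeral_2_eq_2 length_Suc_conv)
    then have z: "z = Word [p, q]" by (cases z) simp
    with c have "p \<in> Pair x ` carrier ?M" "q \<in> Pair x ` carrier ?M" by auto
    then show ?thesis using z by auto
  qed
  show "restrict (bilin_eval a v) (carrier ?E) \<in> carrier ?M"
  proof (induction a rule: poly_mapping_single_induct)
    case zero
    show ?case using cl(1) by (simp add: bilin_eval_zero restrict_def)
  next
    case (single z c)
    then obtain \<phi> \<psi> where z: "z = Word [(x, \<phi>), (x, \<psi>)]" "\<psi> \<in> carrier ?M" using word by blast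
    have "bilin_eval (Poly_Mapping.single z c) v = (\<lambda>w. c * \<phi> v * \<psi> w)"
      by (rule ext) (simp add: z(1) bilin_eval_single_word2)
    then show ?case by (simp only:) (rule cl(3)[OF z(2)])
  next
    case (add b d)
    have "restrict (\<lambda>w. restrict (bilin_eval b v) (carrier ?E) w + restrict (bilin_eval d v) (carrier ?E) w) (carrier ?E) \<in> carrier ?M"
      using add by (rule cl(2))
    also have "restrict (\<lambda>w. restrict (bilin_eval b v) (carrier ?E) w + restrict (bilin_eval d v) (carrier ?E) w) (carrier ?E)
      = restrict (bilin_eval (b + d) v) (carrier ?E)"
      by (rule restrict_ext) (simp add: bilin_eval_add)
    finally show ?case .
  qed
  show "bilin_eval a (u \<oplus>\<^bsub>?E\<^esub> v) w = bilin_eval a u w + bilin_eval a v w" if "u \<in> carrier ?E" "v \<in> carrier ?E"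
  proof (induction a rule: poly_mapping_single_induct)
    case (single z c)
    then obtain \<phi> \<psi> where z: "z = Word [(x, \<phi>), (x, \<psi>)]" "\<phi> \<in> carrier ?M" using word by blast
    show ?case using dual_space_memD(2)[OF z(2) that] by (simp add: z(1) bilin_eval_single_word2 algebra_simps)
  qed (simp_all add: bilin_eval_zero bilin_eval_add)
  show "bilin_eval a (r \<odot>\<^bsub>?E\<^esub> v) w = r * bilin_eval a v w" if "v \<in> carrier ?E"
  proof (induction a rule: poly_mapping_single_induct)
    case (single z c)
    then obtain \<phi> \<psi> where z: "z = Word [(x, \<phi>), (x, \<psi>)]" "\<phi> \<in> carrier ?M" using word by blast
    show ?case using dual_space_memD(3)[OF z(2) that] by (simp add: z(1) bilin_eval_single_word2 algebra_simps)
  qed (simp_all add: bilin_eval_zero bilin_eval_add distrib_left)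
qed

text \<open>The rank condition concerns the image of this map, so its values must first be known to
  be smooth functionals that depend linearly on \<open>v\<close>; both are read off a representative
  of the form.\<close>

lemma form_map_linear:
  assumes g: "pseudo_metric V g" and x: "x \<in> points (base_sp V)"
  shows "linear_map class_ring (fib V x) (fib (dual_bundle V) x) (form_map V (form_of g))"
proof -
  let ?E = "fib V x" and ?M = "dual_space (total_sp V) (fib V x)"
  obtain a where a: "a \<in> homogeneous (fib (dual_bundle V) x) 2"
    and e: "\<And>v w. v \<in> carrier ?E \<Longrightarrow> w \<in> carrier ?E \<Longrightarrow> form_of g x v w = bilin_eval a v w"
    by (rule pseudo_metric_representative[OF g x]) blast
  note be = bilin_eval_dual[OF x a]
  note cl = vectorspace_add_closed[OF fib_vectorspace[OF x]] vectorspace_smult_closed[OF fib_vectorspace[OF x]]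
  have fm: "form_map V (form_of g) v = (x, restrict (bilin_eval a v) (carrier ?E))" if "v \<in> carrier ?E" for v
  proof -
    have "prj V v = x" using that in_fib_iff[OF x] by blast
    moreover have "restrict (form_of g x v) (carrier ?E) = restrict (bilin_eval a v) (carrier ?E)"
      by (rule restrict_ext) (rule e[OF that])
    ultimately show ?thesis by (simp add: form_map_def)
  qed
  have W: "vectorspace class_ring (fib (dual_bundle V) x)"
    unfolding fib_dual using vectorspace_dual[OF x] inj_on_Pair by (rule vectorspace_transport)
  show ?thesis
  proof (rule linear_map_class_ringI[OF fib_vectorspace[OF x] W])
    fix v w r assume v: "v \<in> carrier ?E"
    show "form_map V (form_of g) v \<in> carrier (fib (dual_bundle V) x)"
      unfolding fib_dual_simps(1) fm[OF v] using be(1) by (rule imageI)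
    show "form_map V (form_of g) (r \<odot>\<^bsub>?E\<^esub> v) = r \<odot>\<^bsub>fib (dual_bundle V) x\<^esub> form_map V (form_of g) v"
      unfolding fm[OF v] fm[OF cl(2)[OF v]] fib_dual_simps(4)[OF be(1)] dual_space_ops
      by (simp add: be(3)[OF v] cong: restrict_cong)
    assume w: "w \<in> carrier ?E"
    show "form_map V (form_of g) (v \<oplus>\<^bsub>?E\<^esub> w) =
        form_map V (form_of g) v \<oplus>\<^bsub>fib (dual_bundle V) x\<^esub> form_map V (form_of g) w"
      unfolding fm[OF v] fm[OF w] fm[OF cl(1)[OF v w]] fib_dual_simps(3)[OF be(1) be(1)] dual_space_ops
      by (simp add: be(2)[OF v w] cong: restrict_cong)
  qed
qed

lemma form_map_surj:
  assumes g: "pseudo_metric V g" and x: "x \<in> points (base_sp V)"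
    and fd: "vectorspace.fin_dim class_ring (fib V x)"
  shows "form_map V (form_of g) ` carrier (fib V x) = carrier (fib (dual_bundle V) x)"
proof (rule linear_image_eq_carrier[OF form_map_linear[OF g x] fd fin_dim_dual[OF x fd]])
  show "vectorspace.dim class_ring (fib (dual_bundle V) x\<lparr>carrier := form_map V (form_of g) ` carrier (fib V x)\<rparr>) =
      vectorspace.dim class_ring (fib (dual_bundle V) x)"
    using g x by (simp add: pseudo_metric_def form_rank_def)
qed

text \<open>Well-definedness of the dual form: the value depends on \<open>v\<close> and \<open>w\<close> only through their images,
  by symmetry.\<close>

lemma dual_form_eq:
  assumes x: "x \<in> points (base_sp V)"
    and sym: "\<And>v w. v \<in> carrier (fib V x) \<Longrightarrow> w \<in> carrier (fib V x) \<Longrightarrow> b x v w = b x w v"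
    and v: "v \<in> carrier (fib V x)" and w: "w \<in> carrier (fib V x)"
  shows "dual_form V b x (form_map V b v) (form_map V b w) = b x v w"
  unfolding dual_form_def
proof (rule the_equality)
  show "\<exists>v'\<in>carrier (fib V x). \<exists>w'\<in>carrier (fib V x).
      form_map V b v' = form_map V b v \<and> form_map V b w' = form_map V b w \<and> b x v w = b x v' w'"
    using v w by blast
  have eq: "b x u' z = b x u z" if u: "u \<in> carrier (fib V x)" "u' \<in> carrier (fib V x)" "z \<in> carrier (fib V x)"
    and "form_map V b u' = form_map V b u" for u u' z
  proof -
    have "prj V u = x" "prj V u' = x" using u in_fib_iff[OF x] by auto
    then have "restrict (b x u') (carrier (fib V x)) = restrict (b x u) (carrier (fib V x))"
      using that(4) by (simp add: form_map_def)
    then show ?thesis using u(3) by (metis restrict_apply')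
  qed
  fix r assume "\<exists>v'\<in>carrier (fib V x). \<exists>w'\<in>carrier (fib V x).
      form_map V b v' = form_map V b v \<and> form_map V b w' = form_map V b w \<and> r = b x v' w'"
  then obtain v' w' where v': "v' \<in> carrier (fib V x)" "form_map V b v' = form_map V b v"
    and w': "w' \<in> carrier (fib V x)" "form_map V b w' = form_map V b w" and r: "r = b x v' w'" by blast
  have "b x v' w' = b x v w'" using eq[OF v v'(1) w'(1) v'(2)] .
  also have "\<dots> = b x w' v" using sym[OF v w'(1)] .
  also have "\<dots> = b x w v" using eq[OF w w'(1) v w'(2)] .
  also have "\<dots> = b x v w" using sym[OF w v] .
  finally show "r = b x v w" using r by simp
qed

end

section \<open>The comparison theorem\<close>

context
  fixes V1 :: "('x1, 'v1) bundle_data" and V2 :: "('x2, 'v2) bundle_data"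
    and Y :: "'x1 set" and f :: "'x1 \<Rightarrow> 'x2" and F :: "'v1 \<Rightarrow> 'v2"
  assumes V1: "vector_family V1" and V2: "vector_family V2"
    and gl: "gluing V1 V2 Y f F" and f_inj: "inj_on f Y"
    and H: "diffeomorphism
           (sub_diff (total_sp (dual_bundle V2)) (over (dual_bundle V2) (f ` Y)))
           (sub_diff (total_sp (dual_bundle V1))
             (dual_lift V1 Y f F ` over (dual_bundle V2) (f ` Y)))
           (dual_lift V1 Y f F)"
begin

interpretation V1: vector_family V1 by (rule V1)
interpretation V2: vector_family V2 by (rule V2)
interpretation W1: vector_family "dual_bundle V1" by (rule V1.vector_family_dual)
interpretation W2: vector_family "dual_bundle V2" by (rule V2.vector_family_dual)

abbreviation (input) "dl \<equiv> dual_lift V1 Y f F"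
abbreviation (input) "ov \<equiv> over (dual_bundle V2) (f ` Y)"

lemma dual_base: "base_sp (dual_bundle V1) = base_sp V1" "base_sp (dual_bundle V2) = base_sp V2"
    "prj (dual_bundle V1) = fst" "prj (dual_bundle V2) = fst"
  by (simp_all add: dual_bundle_def)

lemma gluing_base: "Y \<subseteq> points (base_sp V1)" "f ` Y \<subseteq> points (base_sp V2)"
  using gl by (auto simp: gluing_def smooth_map_def sub_diff_def)

lemma gluing_fib: "y \<in> Y \<Longrightarrow> v \<in> carrier (fib V1 y) \<Longrightarrow> F v \<in> carrier (fib V2 (f y))"
  using gl linear_map_class_ringD(3) by (metis gluing_def)

lemma dual_lift_points: "\<xi> \<in> ov \<Longrightarrow> dl \<xi> \<in> points (total_sp (dual_bundle V1))"
proof -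
  have "bij_betw dl (points (sub_diff (total_sp (dual_bundle V2)) ov))
      (points (sub_diff (total_sp (dual_bundle V1)) (dl ` ov)))"
    using H by (simp add: diffeomorphism_def)
  then have "dl ` (points (total_sp (dual_bundle V2)) \<inter> ov) \<subseteq> points (total_sp (dual_bundle V1))"
    by (auto simp: bij_betw_def sub_diff_def)
  moreover assume "\<xi> \<in> ov"
  moreover from this have "\<xi> \<in> points (total_sp (dual_bundle V2))" by (simp add: over_def)
  ultimately show ?thesis by blast
qed

lemma dual_lift_inj: "inj_on dl ov"
proof -
  have "points (sub_diff (total_sp (dual_bundle V2)) ov) = ov" by (auto simp: sub_diff_def over_def)
  then show ?thesis using H by (simp add: diffeomorphism_def bij_betw_def)
qed

lemma dual_lift_apply:
  "y \<in> Y \<Longrightarrow> dl (f y, \<xi>) = (y, restrict (\<lambda>v. \<xi> (F v)) (carrier (fib V1 y)))"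
  using f_inj by (simp add: dual_lift_def Let_def)

lemma dual_fib_over: "y \<in> Y \<Longrightarrow> \<xi> \<in> carrier (fib (dual_bundle V2) (f y)) \<Longrightarrow> \<xi> \<in> ov"
  using gluing_base(2) W2.fib_carrier[of "f y"] by (auto simp: over_def dual_base)

lemma dual_lift_fib:
  assumes y: "y \<in> Y" and \<xi>: "\<xi> \<in> carrier (fib (dual_bundle V2) (f y))"
  shows "dl \<xi> \<in> carrier (fib (dual_bundle V1) y)"
proof -
  have yV: "y \<in> points (base_sp (dual_bundle V1))" using y gluing_base(1) by (auto simp: dual_base)
  obtain \<xi>' where "\<xi> = (f y, \<xi>')" using \<xi> unfolding V2.fib_dual_simps(1) by blast
  then have "fst (dl \<xi>) = y" by (simp add: dual_lift_apply[OF y])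
  then show ?thesis
    unfolding W1.in_fib_iff[OF yV] using dual_lift_points[OF dual_fib_over[OF y \<xi>]] by (simp add: dual_base)
qed

lemma dual_lift_linear:
  assumes y: "y \<in> Y"
  shows "linear_map class_ring (fib (dual_bundle V2) (f y)) (fib (dual_bundle V1) y) dl"
proof (rule linear_map_class_ringI)
  let ?M1 = "dual_space (total_sp V1) (fib V1 y)" and ?M2 = "dual_space (total_sp V2) (fib V2 (f y))"
  show "vectorspace class_ring (fib (dual_bundle V2) (f y))"
    using y gluing_base(2) by (intro W2.fib_vectorspace) (auto simp: dual_base)
  show "vectorspace class_ring (fib (dual_bundle V1) y)"
    using y gluing_base(1) by (intro W1.fib_vectorspace) (auto simp: dual_base)
  have lift: "restrict (\<lambda>v. \<xi> (F v)) (carrier (fib V1 y)) \<in> carrier ?M1" if "\<xi> \<in> carrier ?M2" for \<xi>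
    using dual_lift_fib[OF y, of "(f y, \<xi>)"] that
    unfolding V2.fib_dual_simps(1) V1.fib_dual_simps(1) dual_lift_apply[OF y] by blast
  fix \<xi> \<eta> r assume "\<xi> \<in> carrier (fib (dual_bundle V2) (f y))"
  then show "dl \<xi> \<in> carrier (fib (dual_bundle V1) y)" by (rule dual_lift_fib[OF y])
  obtain \<xi>' where \<xi>: "\<xi>' \<in> carrier ?M2" "\<xi> = (f y, \<xi>')"
    using \<open>\<xi> \<in> carrier (fib (dual_bundle V2) (f y))\<close> unfolding V2.fib_dual_simps(1) by blast
  show "dl (r \<odot>\<^bsub>fib (dual_bundle V2) (f y)\<^esub> \<xi>) = r \<odot>\<^bsub>fib (dual_bundle V1) y\<^esub> dl \<xi>"
    unfolding \<xi>(2) V2.fib_dual_simps(4)[OF \<xi>(1)] dual_lift_apply[OF y] V1.fib_dual_simps(4)[OF lift[OF \<xi>(1)]]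
      dual_space_ops prod.inject
    by (intro conjI refl restrict_ext) (simp add: gluing_fib[OF y])
  assume "\<eta> \<in> carrier (fib (dual_bundle V2) (f y))"
  then obtain \<eta>' where \<eta>: "\<eta>' \<in> carrier ?M2" "\<eta> = (f y, \<eta>')"
    unfolding V2.fib_dual_simps(1) by blast
  show "dl (\<xi> \<oplus>\<^bsub>fib (dual_bundle V2) (f y)\<^esub> \<eta>) = dl \<xi> \<oplus>\<^bsub>fib (dual_bundle V1) y\<^esub> dl \<eta>"
    unfolding \<xi>(2) \<eta>(2) V2.fib_dual_simps(3)[OF \<xi>(1) \<eta>(1)] dual_lift_apply[OF y]
      V1.fib_dual_simps(3)[OF lift[OF \<xi>(1)] lift[OF \<eta>(1)]] dual_space_ops prod.inject
    by (intro conjI refl restrict_ext) (simp add: gluing_fib[OF y])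
qed

text \<open>The dual of \<open>V2\<close> becomes the left-hand factor. Smoothness of the lift is
  read off the diffeomorphism \<open>H\<close>, and its linearity holds since restriction along
  \<open>F\<close> is linear in the functional.\<close>

lemma dual_gluing:
  "vector_family_gluing (dual_bundle V2) (dual_bundle V1) (f ` Y) (inv_into Y f) dl"
proof (intro vector_family_gluing.intro vector_family_gluing_axioms.intro)
  show "vector_family (dual_bundle V2)" "vector_family (dual_bundle V1)" by unfold_locales
  show "f ` Y \<subseteq> points (base_sp (dual_bundle V2))" using gluing_base by (simp add: dual_base)
  show "inv_into Y f ` f ` Y \<subseteq> points (base_sp (dual_bundle V1))"
    using gluing_base(1) f_inj by (auto simp: dual_base)
  show "inj_on (inv_into Y f) (f ` Y)" by (rule inj_on_inv_into) simp
  show "dl v \<in> points (total_sp (dual_bundle V1))" if "v \<in> ov" for v using that by (rule dual_lift_points)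
  show "prj (dual_bundle V1) (dl v) = inv_into Y f (prj (dual_bundle V2) v)" if "v \<in> ov" for v
    by (simp add: dual_base dual_lift_def Let_def case_prod_beta)
  show "plot (total_sp (dual_bundle V1)) n U (\<lambda>u. dl (p u))"
    if "plot (total_sp (dual_bundle V2)) n U p" "p ` U \<subseteq> ov" for n U p
  proof -
    have "smooth_map (sub_diff (total_sp (dual_bundle V2)) ov) (sub_diff (total_sp (dual_bundle V1)) (dl ` ov)) dl"
      using H by (simp add: diffeomorphism_def)
    moreover have "plot (sub_diff (total_sp (dual_bundle V2)) ov) n U p"
      using that by (simp add: sub_diff_def)
    ultimately have "plot (sub_diff (total_sp (dual_bundle V1)) (dl ` ov)) n U (\<lambda>u. dl (p u))"
      by (rule smooth_mapD)
    then show ?thesis by (simp add: sub_diff_def)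
  qed
  show "linear_map class_ring (fib (dual_bundle V2) x) (fib (dual_bundle V1) (inv_into Y f x)) dl"
    if x: "x \<in> f ` Y" for x
  proof -
    obtain y where y: "y \<in> Y" "x = f y" using x by blast
    then have "inv_into Y f x = y" using f_inj by simp
    then show ?thesis using dual_lift_linear[OF y(1)] y(2) by simp
  qed
qed

lemma dual_forms_compatible:
  assumes g1: "pseudo_metric V1 g1" and g2: "pseudo_metric V2 g2" and fd: "finite_dim_bundle V1"
    and c: "compatible V1 Y f F (form_of g1) (form_of g2)"
  shows "compatible (dual_bundle V2) (f ` Y) (inv_into Y f) dl (dual_form V2 (form_of g2)) (dual_form V1 (form_of g1))"
  unfolding compatible_def
proof (intro ballI)
  fix x \<xi> \<eta>
  assume "x \<in> f ` Y" and \<xi>x: "\<xi> \<in> carrier (fib (dual_bundle V2) x)" and \<eta>x: "\<eta> \<in> carrier (fib (dual_bundle V2) x)"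
  then obtain y where y: "y \<in> Y" and x: "x = f y" by blast
  have h: "inv_into Y f x = y" using y x f_inj by simp
  have yV: "y \<in> points (base_sp V1)" and xV: "f y \<in> points (base_sp V2)" using y gluing_base by auto
  have sym1: "form_of g1 y v w = form_of g1 y w v" if "v \<in> carrier (fib V1 y)" "w \<in> carrier (fib V1 y)" for v w
    using g1 yV that by (auto simp: pseudo_metric_def)
  have sym2: "form_of g2 (f y) v w = form_of g2 (f y) w v"
    if "v \<in> carrier (fib V2 (f y))" "w \<in> carrier (fib V2 (f y))" for v w
    using g2 xV that by (auto simp: pseudo_metric_def)
  have surj: "form_map V1 (form_of g1) ` carrier (fib V1 y) = carrier (fib (dual_bundle V1) y)"
    using g1 yV fd by (intro V1.form_map_surj) (auto simp: finite_dim_bundle_def)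
  \<comment> \<open>Surjectivity for \<open>g1\<close> writes the restriction of
    \<open>\<xi>\<close> along \<open>F\<close> as the functional of some \<open>v\<close>. By
    compatibility the functional of \<open>F v\<close> for \<open>g2\<close> has the same
    restriction, so it equals \<open>\<xi>\<close> by injectivity of the dual lift. The single
    vector \<open>v\<close> thus computes both dual forms.\<close>
  have key: "\<exists>v\<in>carrier (fib V1 y). form_map V1 (form_of g1) v = dl \<xi> \<and> form_map V2 (form_of g2) (F v) = \<xi>"
    if \<xi>: "\<xi> \<in> carrier (fib (dual_bundle V2) (f y))" for \<xi>
  proof -
    have "dl \<xi> \<in> form_map V1 (form_of g1) ` carrier (fib V1 y)"
      unfolding surj by (rule dual_lift_fib[OF y \<xi>])
    then obtain v where v: "v \<in> carrier (fib V1 y)" "form_map V1 (form_of g1) v = dl \<xi>" by (elim imageE) simp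
    have Fv: "F v \<in> carrier (fib V2 (f y))" by (rule gluing_fib[OF y v(1)])
    have fm: "form_map V2 (form_of g2) (F v) \<in> carrier (fib (dual_bundle V2) (f y))"
      by (rule linear_map_class_ringD(3)[OF V2.form_map_linear[OF g2 xV] Fv])
    have pr: "prj V1 v = y" "prj V2 (F v) = f y"
      using v(1) Fv V1.in_fib_iff[OF yV] V2.in_fib_iff[OF xV] by auto
    have "dl (form_map V2 (form_of g2) (F v)) =
        (y, restrict (\<lambda>u. restrict (form_of g2 (f y) (F v)) (carrier (fib V2 (f y))) (F u)) (carrier (fib V1 y)))"
      unfolding form_map_def pr by (rule dual_lift_apply[OF y])
    also have "restrict (\<lambda>u. restrict (form_of g2 (f y) (F v)) (carrier (fib V2 (f y))) (F u)) (carrier (fib V1 y)) =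
        restrict (form_of g1 y v) (carrier (fib V1 y))"
      by (rule restrict_ext) (use c y v(1) in \<open>simp add: gluing_fib[OF y] compatible_def\<close>)
    also have "(y, restrict (form_of g1 y v) (carrier (fib V1 y))) = form_map V1 (form_of g1) v"
      by (simp add: form_map_def pr)
    also have "\<dots> = dl \<xi>" by (rule v(2))
    finally have "form_map V2 (form_of g2) (F v) = \<xi>"
      using dual_lift_inj dual_fib_over[OF y fm] dual_fib_over[OF y \<xi>] by (meson inj_onD)
    with v show ?thesis by blast
  qed
  obtain v where v: "v \<in> carrier (fib V1 y)" "form_map V1 (form_of g1) v = dl \<xi>" "form_map V2 (form_of g2) (F v) = \<xi>"
    using key[OF \<xi>x[unfolded x]] by blast
  obtain w where w: "w \<in> carrier (fib V1 y)" "form_map V1 (form_of g1) w = dl \<eta>" "form_map V2 (form_of g2) (F w) = \<eta>"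
    using key[OF \<eta>x[unfolded x]] by blast
  have "dual_form V2 (form_of g2) (f y) \<xi> \<eta> = form_of g2 (f y) (F v) (F w)"
    using V2.dual_form_eq[where b = "form_of g2", OF xV sym2 gluing_fib[OF y v(1)] gluing_fib[OF y w(1)]] v(3) w(3) by simp
  also have "\<dots> = form_of g1 y v w" using c y v(1) w(1) by (simp add: compatible_def)
  also have "\<dots> = dual_form V1 (form_of g1) y (dl \<xi>) (dl \<eta>)"
    using V1.dual_form_eq[where b = "form_of g1", OF yV sym1 v(1) w(1)] v(2) w(2) by simp
  finally show "dual_form V2 (form_of g2) x \<xi> \<eta> = dual_form V1 (form_of g1) (inv_into Y f x) (dl \<xi>) (dl \<eta>)"
    unfolding h by (simp add: x)
qed

end

theorem theorem6p2:
  fixes V1 :: "('x1, 'v1) bundle_data" and V2 :: "('x2, 'v2) bundle_data"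
    and Y :: "'x1 set" and f :: "'x1 \<Rightarrow> 'x2" and F :: "'v1 \<Rightarrow> 'v2"
    and g1 :: "'x1 \<Rightarrow> 'x1 \<times> (('x1 \<times> ('v1 \<Rightarrow> real)) tword \<Rightarrow>\<^sub>0 real) set"
    and g2 :: "'x2 \<Rightarrow> 'x2 \<times> (('x2 \<times> ('v2 \<Rightarrow> real)) tword \<Rightarrow>\<^sub>0 real) set"
  assumes "pseudo_bundle V1" and "pseudo_bundle V2"
    and "finite_dim_bundle V1" and "finite_dim_bundle V2"
    and "bounded_dim_bundle V1" and "bounded_dim_bundle V2"
    and "locally_trivial V1" and "locally_trivial V2"
    and "gluing V1 V2 Y f F"
    and "diffeomorphism (sub_diff (base_sp V1) Y) (sub_diff (base_sp V2) (f ` Y)) f"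
    and "diffeomorphism
           (sub_diff (total_sp (dual_bundle V2)) (over (dual_bundle V2) (f ` Y)))
           (sub_diff (total_sp (dual_bundle V1))
             (dual_lift V1 Y f F ` over (dual_bundle V2) (f ` Y)))
           (dual_lift V1 Y f F)"
    and "pseudo_metric V1 g1" and "pseudo_metric V2 g2"
    and "compatible V1 Y f F (form_of g1) (form_of g2)"
  shows
    "let W1 = dual_bundle V1; W2 = dual_bundle V2;
         h = inv_into Y f; H = dual_lift V1 Y f F;
         g1' = dual_form V1 (form_of g1); g2' = dual_form V2 (form_of g2)
     in diffeomorphism
          (total_sp (glued_clifford W2 W1 (f ` Y) h H g2' g1'))
          (total_sp (clifford_glued W2 W1 (f ` Y) h H g2' g1'))
          (clifford_comparison W2 W1 (f ` Y) h H g2' g1')"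
proof -
  have V: "vector_family V1" "vector_family V2" using assms(1,2) by (auto intro: pseudo_bundle.vector_family)
  have "Y \<subseteq> points (base_sp V1)" using assms(9) by (simp add: gluing_def)
  then have "points (sub_diff (base_sp V1) Y) = Y" by (auto simp: sub_diff_def)
  then have inj: "inj_on f Y" using assms(10) by (simp add: diffeomorphism_def bij_betw_def)
  have "clifford_gluing (dual_bundle V2) (dual_bundle V1) (f ` Y) (inv_into Y f) (dual_lift V1 Y f F)
      (dual_form V2 (form_of g2)) (dual_form V1 (form_of g1))"
    by (intro clifford_gluing.intro clifford_gluing_axioms.intro dual_gluing[OF V assms(9) inj assms(11)]
        dual_forms_compatible[OF V assms(9) inj assms(11,12,13,3,14)])
  then show ?thesis unfolding Let_def by (rule clifford_gluing.comparison_diffeomorphism)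
qed

end
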